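(* Let $A$ be a Noetherian henselian local commutative ring with maximal ideal $\mathfrak m_A$ and residue field $\mathbf F$, let $R$ be an $A$-algebra, let $\rho:R\to M_n(A)$ be a morphism of $A$-algebras and put $T=\mathrm{tr}\,\rho:R\to A$. Assume that $n!$ is invertible in $A$ and that $$\rho \bmod \mathfrak m_A=\begin{pmatrix}\tau_1 & *\\ 0&\tau_2\end{pmatrix}$$ is a non-semisimple extension of $\tau_2$ by $\tau_1$, where $\tau_1,\tau_2$ are non-isomorphic absolutely irreducible representations of $R$ over $\mathbf F$ of dimensions $n_1,n_2$ with $n_1+n_2=n$. Assume that $A$ is reduced and infinite, but $\#A/I_T<\infty$, where $I_T$ is the ideal of reducibility of $T$. Also assume that there exists an anti-automorphism $\tau:R\to R$ of $A$-algebras (i.e. $A$-linear with $\tau(xy)=\tau(y)\tau(x)$) with $\tau^2=\mathrm{id}$, $T\circ\tau=T$ and $\mathrm{tr}\,\tau_i\circ\tau=\mathrm{tr}\,\tau_i$ for $i=1,2$. Then $I_T$ is principal and generated by a non-zero-divisor.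
   Context: A pseudocharacter of dimension $d$ on an $A$-algebra $R$ is an $A$-linear map $R\to A$, central ($T(xy)=T(yx)$), with $T(1)=d$ and satisfying the $d$-dimensional pseudocharacter (Frobenius) identity, as traces of $d$-dimensional representations do. The ideal of reducibility $I_T$ of $T$ is the smallest ideal $I$ of $A$ such that $T$ mod $I$ is a sum $T_1+T_2$ of two pseudocharacters with $T_i\equiv \mathrm{tr}\,\tau_i$ mod $\mathfrak m_A$. *)

theory Defs
  imports
    "HOL-Combinatorics.Combinatorics"
    "HOL-Algebra.Ring_Divisibility"
    "HOL-Algebra.Algebraic_Closure_Type"
    "Jordan_Normal_Form.Matrix"
    "Jordan_Normal_Form.VS_Connect"
begin

text \<open>
  The base ring is a type of class \<^class>\<open>comm_ring_1\<close>; for ideals and quotients it is viewed as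
  the record \<^const>\<open>class_ring\<close>. Its residue field is a type of class \<^class>\<open>Fields.field\<close> together
  with the reduction map \<open>\<pi>\<close>, a surjective ring homomorphism whose kernel is the maximal ideal.
\<close>

definition local_ring_with_maximal_ideal :: "'a::comm_ring_1 set \<Rightarrow> bool" where
  "local_ring_with_maximal_ideal m \<longleftrightarrow> {M. maximalideal M (class_ring :: 'a ring)} = {m}"

definition residue_map :: "'a::comm_ring_1 set \<Rightarrow> ('a \<Rightarrow> 'f::field) \<Rightarrow> bool" where
  "residue_map m \<pi> \<longleftrightarrow> comm_ring_hom \<pi> \<and> surj \<pi> \<and> {a. \<pi> a = 0} = m"

text \<open>Simple roots in the residue field of monic polynomials lift to roots.\<close>

definition henselian :: "('a::comm_ring_1 \<Rightarrow> 'f::field) \<Rightarrow> bool" where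
  "henselian \<pi> \<longleftrightarrow>
    (\<forall>p \<alpha>. lead_coeff p = 1 \<longrightarrow> poly (map_poly \<pi> p) \<alpha> = 0 \<longrightarrow>
       poly (pderiv (map_poly \<pi> p)) \<alpha> \<noteq> 0 \<longrightarrow> (\<exists>a. poly p a = 0 \<and> \<pi> a = \<alpha>))"

locale assoc_algebra = Modules.module smul
  for smul :: "'a::comm_ring_1 \<Rightarrow> 'r::ring_1 \<Rightarrow> 'r" +
  assumes smul_mult_left: "smul a (x * y) = smul a x * y"
    and smul_mult_right: "smul a (x * y) = x * smul a y"

definition anti_automorphism ::
    "('a::comm_ring_1 \<Rightarrow> 'r::ring_1 \<Rightarrow> 'r) \<Rightarrow> ('r \<Rightarrow> 'r) \<Rightarrow> bool" where
  "anti_automorphism smul \<tau> \<longleftrightarrow>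
     Modules.module_hom smul smul \<tau> \<and> bij \<tau> \<and> (\<forall>x y. \<tau> (x * y) = \<tau> y * \<tau> x)"


text \<open>
  Matrix representations over a commutative \<open>A\<close>-algebra \<open>K\<close> with structure map \<open>\<phi>\<close>: morphisms of
  \<open>A\<close>-algebras from \<open>R\<close> to the \<open>n \<times> n\<close> matrices over \<open>K\<close>.
\<close>

definition mat_rep ::
    "('a::comm_ring_1 \<Rightarrow> 'r::ring_1 \<Rightarrow> 'r) \<Rightarrow> ('a \<Rightarrow> 'k::comm_ring_1) \<Rightarrow> nat \<Rightarrow> ('r \<Rightarrow> 'k mat) \<Rightarrow> bool"
where
  "mat_rep smul \<phi> n \<rho> \<longleftrightarrow>
     (\<forall>x. \<rho> x \<in> carrier_mat n n) \<and>
     \<rho> 1 = 1\<^sub>m n \<and>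
     (\<forall>x y. \<rho> (x + y) = \<rho> x + \<rho> y) \<and>
     (\<forall>x y. \<rho> (x * y) = \<rho> x * \<rho> y) \<and>
     (\<forall>a x. \<rho> (smul a x) = \<phi> a \<cdot>\<^sub>m \<rho> x)"

definition mat_trace :: "'k::comm_ring_1 mat \<Rightarrow> 'k" where
  "mat_trace M = (\<Sum>i<dim_row M. M $$ (i, i))"

definition stable_subspace :: "nat \<Rightarrow> ('r \<Rightarrow> 'k::field mat) \<Rightarrow> 'k vec set \<Rightarrow> bool" where
  "stable_subspace n \<rho> W \<longleftrightarrow>
     VectorSpace.subspace class_ring W (module_vec TYPE('k) n) \<and>
     (\<forall>x. \<forall>w\<in>W. \<rho> x *\<^sub>v w \<in> W)"

definition irreducible_rep :: "nat \<Rightarrow> ('r \<Rightarrow> 'k::field mat) \<Rightarrow> bool" where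
  "irreducible_rep n \<rho> \<longleftrightarrow>
     n > 0 \<and> (\<forall>W. stable_subspace n \<rho> W \<longrightarrow> W = {0\<^sub>v n} \<or> W = carrier_vec n)"

definition absolutely_irreducible_rep :: "nat \<Rightarrow> ('r \<Rightarrow> 'k::field mat) \<Rightarrow> bool" where
  "absolutely_irreducible_rep n \<rho> \<longleftrightarrow> irreducible_rep n (\<lambda>x. map_mat to_ac (\<rho> x))"

definition semisimple_rep :: "nat \<Rightarrow> ('r \<Rightarrow> 'k::field mat) \<Rightarrow> bool" where
  "semisimple_rep n \<rho> \<longleftrightarrow>
     (\<forall>W. stable_subspace n \<rho> W \<longrightarrow>
        (\<exists>W'. stable_subspace n \<rho> W' \<and> W \<inter> W' = {0\<^sub>v n} \<and>
              carrier_vec n = {w + w' | w w'. w \<in> W \<and> w' \<in> W'}))"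

definition isomorphic_reps ::
    "nat \<Rightarrow> ('r \<Rightarrow> 'k::field mat) \<Rightarrow> nat \<Rightarrow> ('r \<Rightarrow> 'k mat) \<Rightarrow> bool" where
  "isomorphic_reps n1 \<rho>1 n2 \<rho>2 \<longleftrightarrow>
     (\<exists>P\<in>carrier_mat n2 n1. \<exists>Q\<in>carrier_mat n1 n2.
        P * Q = 1\<^sub>m n2 \<and> Q * P = 1\<^sub>m n1 \<and> (\<forall>x. P * \<rho>1 x = \<rho>2 x * P))"


text \<open>
  For a permutation \<open>\<sigma>\<close> of \<open>{..d}\<close>, \<open>perm_trace B T x d \<sigma>\<close> is the product over the cycles
  \<open>(j\<^sub>1 \<dots> j\<^sub>k)\<close> of \<open>\<sigma>\<close>, fixed points included, of \<open>T (x\<^bsub>j\<^sub>1\<^esub> \<cdots> x\<^bsub>j\<^sub>k\<^esub>)\<close>. Each cycle is written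
  starting from its least element; for central \<open>T\<close> the starting point does not matter.
\<close>

definition perm_trace ::
    "('b, 'c) ring_scheme \<Rightarrow> ('r::ring_1 \<Rightarrow> 'b) \<Rightarrow> (nat \<Rightarrow> 'r) \<Rightarrow> nat \<Rightarrow> (nat \<Rightarrow> nat) \<Rightarrow> 'b" where
  "perm_trace B T x d \<sigma> =
     (\<Otimes>\<^bsub>B\<^esub>i\<in>{i\<in>{..d}. \<forall>j\<in>set (support \<sigma> i). i \<le> j}. T (prod_list (map x (support \<sigma> i))))"

text \<open>
  A pseudocharacter of dimension \<open>d\<close> on \<open>R\<close> with values in a commutative \<open>A\<close>-algebra \<open>B\<close>, given
  as a ring record with structure map \<open>\<beta>\<close>. The last clause is the Frobenius identity
  \<open>\<Sum>\<^bsub>\<sigma>\<in>S\<^bsub>d+1\<^esub>\<^esub> sgn(\<sigma>) T\<^bsup>\<sigma>\<^esup>(x\<^sub>0,\<dots>,x\<^sub>d) = 0\<close>. An \<open>A\<close>-linear map from \<open>R\<close> to \<open>A/I\<close> is the same thing as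
  an \<open>A/I\<close>-linear map on \<open>R/IR\<close>, so no base change of \<open>R\<close> is needed.
\<close>

definition pseudocharacter ::
    "('a::comm_ring_1 \<Rightarrow> 'r::ring_1 \<Rightarrow> 'r) \<Rightarrow> ('b, 'c) ring_scheme \<Rightarrow> ('a \<Rightarrow> 'b) \<Rightarrow> nat \<Rightarrow> ('r \<Rightarrow> 'b) \<Rightarrow> bool"
where
  "pseudocharacter smul B \<beta> d T \<longleftrightarrow>
     (\<forall>x. T x \<in> carrier B) \<and>
     (\<forall>x y. T (x + y) = T x \<oplus>\<^bsub>B\<^esub> T y) \<and>
     (\<forall>a x. T (smul a x) = \<beta> a \<otimes>\<^bsub>B\<^esub> T x) \<and>
     (\<forall>x y. T (x * y) = T (y * x)) \<and>
     T 1 = [d] \<cdot>\<^bsub>B\<^esub> \<one>\<^bsub>B\<^esub> \<and>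
     (\<forall>x. (\<Oplus>\<^bsub>B\<^esub>\<sigma>\<in>{\<sigma>. \<sigma> permutes {..d}}. [sign \<sigma>] \<cdot>\<^bsub>B\<^esub> perm_trace B T x d \<sigma>) = \<zero>\<^bsub>B\<^esub>)"

text \<open>
  \<open>T mod I\<close> is a sum of two pseudocharacters with values in \<open>A/I\<close> lifting the traces of \<open>\<tau>1\<close> and
  \<open>\<tau>2\<close>. The reduction of an element of \<open>A/I\<close> modulo the maximal ideal makes sense since \<open>I\<close> is
  contained in it, and is computed on any representative of the coset.
\<close>

definition reducible_mod ::
    "('a::comm_ring_1 \<Rightarrow> 'r::ring_1 \<Rightarrow> 'r) \<Rightarrow> ('a \<Rightarrow> 'f::field) \<Rightarrow> ('r \<Rightarrow> 'a) \<Rightarrow>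
     nat \<Rightarrow> ('r \<Rightarrow> 'f mat) \<Rightarrow> nat \<Rightarrow> ('r \<Rightarrow> 'f mat) \<Rightarrow> 'a set \<Rightarrow> bool"
where
  "reducible_mod smul \<pi> T n1 \<tau>1 n2 \<tau>2 I \<longleftrightarrow>
     ideal I class_ring \<and> I \<subseteq> {a. \<pi> a = 0} \<and>
     (\<exists>T1 T2.
        pseudocharacter smul (class_ring Quot I) (\<lambda>a. I +>\<^bsub>class_ring\<^esub> a) n1 T1 \<and>
        pseudocharacter smul (class_ring Quot I) (\<lambda>a. I +>\<^bsub>class_ring\<^esub> a) n2 T2 \<and>
        (\<forall>x. I +>\<^bsub>class_ring\<^esub> T x = T1 x \<oplus>\<^bsub>class_ring Quot I\<^esub> T2 x) \<and>
        (\<forall>x. \<forall>a\<in>T1 x. \<pi> a = mat_trace (\<tau>1 x)) \<and>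
        (\<forall>x. \<forall>a\<in>T2 x. \<pi> a = mat_trace (\<tau>2 x)))"

definition ideal_of_reducibility ::
    "('a::comm_ring_1 \<Rightarrow> 'r::ring_1 \<Rightarrow> 'r) \<Rightarrow> ('a \<Rightarrow> 'f::field) \<Rightarrow> ('r \<Rightarrow> 'a) \<Rightarrow>
     nat \<Rightarrow> ('r \<Rightarrow> 'f mat) \<Rightarrow> nat \<Rightarrow> ('r \<Rightarrow> 'f mat) \<Rightarrow> 'a set"
where
  "ideal_of_reducibility smul \<pi> T n1 \<tau>1 n2 \<tau>2 = (LEAST I. reducible_mod smul \<pi> T n1 \<tau>1 n2 \<tau>2 I)"

end

theory Submission
  imports Defs "Jordan_Normal_Form.Char_Poly"
begin

text \<open>
  Everything takes place in the image of \<open>\<rho>\<close>. Over the residue field, absolute irreducibility and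
  non-isomorphism of \<open>\<tau>1\<close> and \<open>\<tau>2\<close> make \<open>\<tau>1 \<times> \<tau>2\<close> surjective (\<open>density_two_reps\<close>), and non-splitting of the
  extension fills the upper right block, so the residual image consists of all block upper
  triangular matrices (\<open>upper_triangular_image\<close>). As \<open>n!\<close> is invertible, \<open>0, \<dots>, n - 1\<close> are distinct
  in the residue field. Some \<open>x\<close> in \<open>R\<close> reduces to the diagonal matrix with these entries, and by
  Hensel's lemma \<open>\<rho> x\<close> can be diagonalised by a matrix reducing to 1 (\<open>henselian_diagonalization\<close>). After
  conjugation the image contains all diagonal matrix units, hence is the order of block matrices with
  entries in \<open>A\<close> except in the lower left block, where they lie in an ideal \<open>C\<close>
  (\<open>tiled_rep_of_diagonal\<close>).

  The ideal of reducibility is \<open>C\<close>. Modulo \<open>C\<close> the diagonal blocks are representations, and their traces are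
  pseudocharacters by the Frobenius identity, which is a sum of determinants with two equal
  columns (\<open>frobenius_identity_matrices\<close>). Conversely let \<open>T = T1 + T2\<close> modulo \<open>I\<close>. The pseudocharacters \<open>T1\<close>
  and \<open>T2\<close> live on \<open>R\<close> and need not factor through the image of \<open>\<rho>\<close>, so idempotents of the image
  are of no direct use. Instead the Frobenius identity for \<open>T1\<close> at elements with \<open>\<tau>1\<close>-image the
  diagonal matrix units and \<open>\<tau>2\<close>-image 0 produces \<open>u\<close> with \<open>T1 (u y) = 0\<close> for all \<open>y\<close> and \<open>\<tau>2 u\<close> with diagonal
  entries 1 (\<open>pseudochar_annihilator\<close>); symmetrically there is \<open>v\<close> for \<open>T2\<close>. Then \<open>T (v x u y)\<close> is in \<open>I\<close> for all
  \<open>x\<close> and \<open>y\<close>, which forces \<open>C \<subseteq> I\<close> (\<open>corner_ideal_minimal\<close>).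

  The anti-automorphism exchanges the upper right and the lower left corner up to units. The former is generated by
  one matrix unit, so \<open>C\<close> is generated by one entry \<open>g\<close> (\<open>corner_ideal_principal\<close>). Finally, if \<open>g y = 0\<close>
  with \<open>y\<close> in the maximal ideal, a power of \<open>y\<close> lies in \<open>g A\<close> since \<open>A/gA\<close> is finite, so \<open>y\<close> is nilpotent and
  vanishes; and \<open>g\<close> itself is nonzero because \<open>A\<close> is infinite (\<open>non_zero_divisor_of_finite_quotient\<close>).
\<close>

section \<open>Cycles of a permutation\<close>

text \<open>
  The index set of the product in \<^const>\<open>perm_trace\<close>.
\<close>

definition cycle_minima :: "nat set \<Rightarrow> (nat \<Rightarrow> nat) \<Rightarrow> nat set" where
  "cycle_minima S \<sigma> = {i\<in>S. \<forall>j\<in>set (support \<sigma> i). i \<le> j}"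

lemma permutes_permutation:
  "finite S \<Longrightarrow> \<sigma> permutes S \<Longrightarrow> permutation \<sigma>"
  unfolding permutation_permutes by blast

lemma mem_support: "permutation \<sigma> \<Longrightarrow> i \<in> set (support \<sigma> i)"
  using least_power_of_permutation(2)[of \<sigma> i] by force

lemma support_subset:
  assumes "\<sigma> permutes S" "i \<in> S"
  shows "set (support \<sigma> i) \<subseteq> S"
  using permutes_in_image[OF permutes_funpow[OF assms(1)]] assms(2) by auto

lemma support_eq_of_mem:
  assumes "permutation \<sigma>" "j \<in> set (support \<sigma> i)"
  shows "set (support \<sigma> j) = set (support \<sigma> i)"
  using disjoint_support[OF assms(1)] mem_support[OF assms(1), of j] assms(2)
  unfolding disjoint_def by blast

lemma cycles_cover:
  assumes "finite S" "\<sigma> permutes S"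
  shows "(\<Union>i\<in>cycle_minima S \<sigma>. set (support \<sigma> i)) = S"
proof
  show "(\<Union>i\<in>cycle_minima S \<sigma>. set (support \<sigma> i)) \<subseteq> S"
    using support_subset[OF assms(2)] unfolding cycle_minima_def by blast
next
  have p: "permutation \<sigma>" using permutes_permutation[OF assms] .
  show "S \<subseteq> (\<Union>i\<in>cycle_minima S \<sigma>. set (support \<sigma> i))"
  proof
    fix a assume a: "a \<in> S"
    define i where "i = Min (set (support \<sigma> a))"
    have ne: "set (support \<sigma> a) \<noteq> {}" using mem_support[OF p, of a] by (metis empty_iff)
    have i: "i \<in> set (support \<sigma> a)" unfolding i_def by (rule Min_in) (use ne in auto)
    have eq: "set (support \<sigma> i) = set (support \<sigma> a)" by (rule support_eq_of_mem[OF p i])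
    have "i \<in> S" using support_subset[OF assms(2) a] i by blast
    moreover have "\<forall>j\<in>set (support \<sigma> i). i \<le> j"
      unfolding eq unfolding i_def by (intro ballI Min_le) auto
    ultimately have "i \<in> cycle_minima S \<sigma>" unfolding cycle_minima_def by blast
    moreover have "a \<in> set (support \<sigma> i)" unfolding eq using mem_support[OF p] .
    ultimately show "a \<in> (\<Union>i\<in>cycle_minima S \<sigma>. set (support \<sigma> i))" by blast
  qed
qed

lemma cycles_disjoint:
  assumes p: "permutation \<sigma>"
    and "i \<in> cycle_minima S \<sigma>" "j \<in> cycle_minima S \<sigma>" "i \<noteq> j"
  shows "set (support \<sigma> i) \<inter> set (support \<sigma> j) = {}"
proof (rule ccontr)
  assume "set (support \<sigma> i) \<inter> set (support \<sigma> j) \<noteq> {}"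
  then obtain k where k: "k \<in> set (support \<sigma> i)" "k \<in> set (support \<sigma> j)" by blast
  have eq: "set (support \<sigma> i) = set (support \<sigma> j)"
    using support_eq_of_mem[OF p k(1)] support_eq_of_mem[OF p k(2)] by simp
  have "i \<le> j" using assms(2) mem_support[OF p, of j] eq unfolding cycle_minima_def by blast
  moreover have "j \<le> i" using assms(3) mem_support[OF p, of i] eq unfolding cycle_minima_def by blast
  ultimately show False using assms(4) by simp
qed

lemma prod_support:
  assumes p: "permutation \<sigma>"
  shows "(\<Prod>k<least_power \<sigma> i. h ((\<sigma> ^^ k) i)) = (\<Prod>j\<in>set (support \<sigma> i). (h j :: 'a::comm_monoid_mult))"
proof -
  have "prod_list (map h (support \<sigma> i)) = (\<Prod>j\<in>set (support \<sigma> i). h j)"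
    by (rule prod.distinct_set_conv_list[OF cycle_of_permutation[OF p], symmetric])
  moreover have "prod_list (map h (support \<sigma> i)) = (\<Prod>k<least_power \<sigma> i. h ((\<sigma> ^^ k) i))"
    by (simp add: comp_def prod.list_conv_set_nth atLeast0LessThan)
  ultimately show ?thesis by simp
qed

section \<open>Products of sums over functions on disjoint sets\<close>

lemma sum_PiE_insert:
  assumes "i \<notin> S"
  shows "(\<Sum>f\<in>PiE (insert i S) (\<lambda>_. D). h f) = (\<Sum>a\<in>D. \<Sum>f\<in>PiE S (\<lambda>_. D). h (f(i := a)))"
proof -
  have inj: "inj_on (\<lambda>(y, g). g(i := y)) (D \<times> PiE S (\<lambda>_. D))"
    by (rule inj_combinator[OF assms])
  show ?thesis unfolding PiE_insert_eq sum.cartesian_product sum.reindex[OF inj]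
    by (rule sum.cong) (auto simp: case_prod_beta)
qed

lemma sum_PiE_Un:
  assumes "A \<inter> B = {}"
  shows "(\<Sum>f\<in>PiE A (\<lambda>_. D). \<Sum>g\<in>PiE B (\<lambda>_. D). h (\<lambda>x. if x \<in> A then f x else g x))
    = (\<Sum>k\<in>PiE (A \<union> B) (\<lambda>_. D). h k)"
  unfolding sum.cartesian_product
proof (rule sum.reindex_bij_witness[where j = "\<lambda>(f, g) x. if x \<in> A then f x else g x"
      and i = "\<lambda>k. (restrict k A, restrict k B)"], goal_cases)
  case (1 a)
  then show ?case using assms
    by (auto simp: fun_eq_iff restrict_def PiE_def extensional_def)
next
  case (2 a)
  then show ?case using assms by (auto simp: PiE_def extensional_def Pi_def)
next
  case (3 a)
  then show ?case by (auto simp: fun_eq_iff restrict_def PiE_def extensional_def)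
next
  case (4 a)
  then show ?case by (auto simp: PiE_def extensional_def Pi_def)
next
  case (5 a) then show ?case by auto
qed

text \<open>
  Expanding the product amounts to gluing functions on the disjoint blocks. This turns a product over the
  cycles of a permutation into a single sum over functions on all indices.
\<close>

lemma prod_sum_PiE_Union:
  fixes h :: "'i \<Rightarrow> ('j \<Rightarrow> 'k) \<Rightarrow> 'a::comm_semiring_1"
  assumes "finite P"
    and "\<And>i j. i \<in> P \<Longrightarrow> j \<in> P \<Longrightarrow> i \<noteq> j \<Longrightarrow> B' i \<inter> B' j = {}"
    and "\<And>i f g. i \<in> P \<Longrightarrow> (\<And>x. x \<in> B' i \<Longrightarrow> f x = g x) \<Longrightarrow> h i f = h i g"
  shows "(\<Prod>i\<in>P. \<Sum>f\<in>PiE (B' i) (\<lambda>_. D). h i f) = (\<Sum>f\<in>PiE (\<Union>i\<in>P. B' i) (\<lambda>_. D). \<Prod>i\<in>P. h i f)"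
  using assms
proof (induction P rule: finite_induct)
  case empty
  then show ?case by simp
next
  case (insert i P)
  let ?U = "\<Union>j\<in>P. B' j"
  have dis: "B' i \<inter> ?U = {}" using insert.hyps insert.prems(1) by blast
  have IH: "(\<Prod>i\<in>P. \<Sum>f\<in>PiE (B' i) (\<lambda>_. D). h i f) = (\<Sum>f\<in>PiE ?U (\<lambda>_. D). \<Prod>i\<in>P. h i f)"
    by (rule insert.IH) (use insert.prems in blast)+
  have "(\<Prod>j\<in>insert i P. \<Sum>f\<in>PiE (B' j) (\<lambda>_. D). h j f)
      = (\<Sum>f\<in>PiE (B' i) (\<lambda>_. D). \<Sum>g\<in>PiE ?U (\<lambda>_. D). h i f * (\<Prod>j\<in>P. h j g))"
    using insert.hyps by (simp add: IH sum_product)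
  also have "\<dots> = (\<Sum>f\<in>PiE (B' i) (\<lambda>_. D). \<Sum>g\<in>PiE ?U (\<lambda>_. D).
      (\<lambda>k. h i k * (\<Prod>j\<in>P. h j k)) (\<lambda>x. if x \<in> B' i then f x else g x))"
  proof (intro sum.cong refl)
    fix f g
    have "h i f = h i (\<lambda>x. if x \<in> B' i then f x else g x)"
      by (rule insert.prems(2)) auto
    moreover have "(\<Prod>j\<in>P. h j g) = (\<Prod>j\<in>P. h j (\<lambda>x. if x \<in> B' i then f x else g x))"
      by (intro prod.cong refl insert.prems(2)) (use dis in auto)
    ultimately show "h i f * (\<Prod>j\<in>P. h j g) = (\<lambda>k. h i k * (\<Prod>j\<in>P. h j k)) (\<lambda>x. if x \<in> B' i then f x else g x)"
      by simp
  qed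
  also have "\<dots> = (\<Sum>k\<in>PiE (B' i \<union> ?U) (\<lambda>_. D). h i k * (\<Prod>j\<in>P. h j k))"
    by (rule sum_PiE_Un[OF dis])
  finally show ?case using insert.hyps by simp
qed

section \<open>Traces of products as sums over closed walks\<close>

fun mat_prod :: "nat \<Rightarrow> ('i \<Rightarrow> 'a::comm_ring_1 mat) \<Rightarrow> 'i list \<Rightarrow> 'a mat" where
  "mat_prod d Y [] = 1\<^sub>m d"
| "mat_prod d Y (i # l) = Y i * mat_prod d Y l"

lemma mat_prod_carrier: "(\<And>i. Y i \<in> carrier_mat d d) \<Longrightarrow> mat_prod d Y l \<in> carrier_mat d d"
  by (induction l) (auto intro: mult_carrier_mat)

lemma index_mult_mat_sum:
  assumes "A \<in> carrier_mat d e" "B \<in> carrier_mat e f" "i < d" "j < f"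
  shows "(A * B) $$ (i, j) = (\<Sum>k<e. A $$ (i, k) * B $$ (k, j))"
  using assms by (auto simp: scalar_prod_def atLeast0LessThan intro!: sum.cong)

text \<open>
  The weight of the walk \<open>f l\<^sub>0 \<rightarrow> f l\<^sub>1 \<rightarrow> \<dots> \<rightarrow> b\<close>, where the step out of \<open>f l\<^sub>i\<close> is weighted by the matrix
  attached to \<open>l\<^sub>i\<close>; the end point \<open>b\<close> is kept free so that it can be set to \<open>f l\<^sub>0\<close> to close the walk.
\<close>

fun walk :: "('i \<Rightarrow> 'a::comm_ring_1 mat) \<Rightarrow> ('i \<Rightarrow> nat) \<Rightarrow> 'i list \<Rightarrow> nat \<Rightarrow> 'a" where
  "walk Y f [] b = 1"
| "walk Y f [i] b = Y i $$ (f i, b)"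
| "walk Y f (i # j # l) b = Y i $$ (f i, f j) * walk Y f (j # l) b"

lemma walk_cong: "(\<And>x. x \<in> set l \<Longrightarrow> f x = g x) \<Longrightarrow> walk Y f l b = walk Y g l b"
  by (induction Y f l b rule: walk.induct) auto

lemma walk_prod:
  "walk Y f l b = (\<Prod>k<length l. Y (l ! k) $$ (f (l ! k), if Suc k < length l then f (l ! Suc k) else b))"
proof (induction Y f l b rule: walk.induct)
  case (3 Y f i j l b)
  show ?case unfolding walk.simps 3
    by (simp add: prod.lessThan_Suc_shift del: prod.lessThan_Suc cong: if_cong)
qed auto

text \<open>
  The arbitrary row weight \<open>g\<close> makes the induction go through, since it becomes a row of the next
  factor; an indicator function as weight recovers a single entry of the product.
\<close>

lemma weighted_mat_prod_column:
  assumes Y: "\<And>i. Y i \<in> carrier_mat d d" and "distinct l" "l \<noteq> []" "b < d"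
  shows "(\<Sum>a<d. g a * mat_prod d Y l $$ (a, b))
    = (\<Sum>f\<in>PiE (set l) (\<lambda>_. {..<d}). g (f (hd l)) * walk Y f l b)"
  using assms(2-)
proof (induction l arbitrary: g rule: induct_list012)
  case 1
  then show ?case by simp
next
  case (2 i)
  show ?case using Y[of i] right_mult_one_mat[OF Y[of i]]
    by (simp add: sum_PiE_insert)
next
  case (3 i j l)
  have c: "mat_prod d Y (j # l) \<in> carrier_mat d d" by (rule mat_prod_carrier[OF Y])
  have "(\<Sum>a<d. g a * mat_prod d Y (i # j # l) $$ (a, b))
      = (\<Sum>a<d. g a * (\<Sum>k<d. Y i $$ (a, k) * mat_prod d Y (j # l) $$ (k, b)))"
    using index_mult_mat_sum[OF Y[of i] c _ \<open>b < d\<close>] by (intro sum.cong refl) simp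
  also have "\<dots> = (\<Sum>a<d. g a * (\<Sum>f\<in>PiE (set (j # l)) (\<lambda>_. {..<d}). Y i $$ (a, f j) * walk Y f (j # l) b))"
    by (subst "3.IH"(2)) (use 3 in auto)
  also have "\<dots> = (\<Sum>a<d. \<Sum>f\<in>PiE (set (j # l)) (\<lambda>_. {..<d}). g a * walk Y (f(i := a)) (i # j # l) b)"
    unfolding sum_distrib_left
  proof (intro sum.cong refl, goal_cases)
    case (1 a f)
    have "walk Y f (j # l) b = walk Y (f(i := a)) (j # l) b"
      by (rule walk_cong) (use 3 in auto)
    moreover have "i \<noteq> j" using 3 by auto
    ultimately show ?case by simp
  qed
  also have "\<dots> = (\<Sum>f\<in>PiE (set (i # j # l)) (\<lambda>_. {..<d}). g (f (hd (i # j # l))) * walk Y f (i # j # l) b)"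
    using 3 sum_PiE_insert[of i "set (j # l)" "\<lambda>f. g (f i) * walk Y f (i # j # l) b" "{..<d}"]
    by auto
  finally show ?case .
qed

lemma mat_trace_mat_prod:
  assumes Y: "\<And>i. Y i \<in> carrier_mat d d" and l: "distinct l" "l \<noteq> []"
  shows "mat_trace (mat_prod d Y l) = (\<Sum>f\<in>PiE (set l) (\<lambda>_. {..<d}). walk Y f l (f (hd l)))"
proof -
  have c: "mat_prod d Y l \<in> carrier_mat d d" by (rule mat_prod_carrier[OF Y])
  have hd: "f (hd l) < d" if "f \<in> PiE (set l) (\<lambda>_. {..<d})" for f
    using that l(2) by (auto simp: PiE_def Pi_def)
  have "mat_trace (mat_prod d Y l) = (\<Sum>b<d. \<Sum>a<d. (if a = b then 1 else 0) * mat_prod d Y l $$ (a, b))"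
    using c unfolding mat_trace_def by (auto simp: if_distrib if_distribR sum.delta intro!: sum.cong cong: if_cong)
  also have "\<dots> = (\<Sum>b<d. \<Sum>f\<in>PiE (set l) (\<lambda>_. {..<d}). (if f (hd l) = b then 1 else 0) * walk Y f l b)"
    by (intro sum.cong refl weighted_mat_prod_column[OF Y l]) auto
  also have "\<dots> = (\<Sum>f\<in>PiE (set l) (\<lambda>_. {..<d}). \<Sum>b<d. if b = f (hd l) then walk Y f l b else 0)"
    by (subst sum.swap) (intro sum.cong refl, auto)
  also have "\<dots> = (\<Sum>f\<in>PiE (set l) (\<lambda>_. {..<d}). walk Y f l (f (hd l)))"
    by (intro sum.cong refl) (use hd in simp)
  finally show ?thesis .
qed

lemma walk_support:
  assumes p: "permutation \<sigma>"
  shows "walk Y f (support \<sigma> i) (f i) = (\<Prod>j\<in>set (support \<sigma> i). Y j $$ (f j, f (\<sigma> j)))"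
proof -
  have "walk Y f (support \<sigma> i) (f i) = (\<Prod>k<least_power \<sigma> i. Y ((\<sigma> ^^ k) i) $$ (f ((\<sigma> ^^ k) i), f (\<sigma> ((\<sigma> ^^ k) i))))"
    unfolding walk_prod
  proof (rule prod.cong, goal_cases)
    case (2 k)
    show ?case
    proof (cases "Suc k < least_power \<sigma> i")
      case True
      then show ?thesis by simp
    next
      case False
      then have "Suc k = least_power \<sigma> i" using 2 by simp
      then have "\<sigma> ((\<sigma> ^^ k) i) = i" using least_power_of_permutation(1)[OF p, of i] by (metis comp_apply funpow.simps(2))
      then show ?thesis using False 2 by simp
    qed
  qed simp
  also have "\<dots> = (\<Prod>j\<in>set (support \<sigma> i). Y j $$ (f j, f (\<sigma> j)))"
    by (rule prod_support[OF p])
  finally show ?thesis .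
qed

text \<open>
  Each cycle contributes the trace of a product, that is a sum over closed walks along the cycle.
  Together these walks form a function \<open>f\<close> on all indices, and the weight is the Leibniz term of \<open>\<sigma>\<close> for
  the matrix with entries \<open>(i, j) \<mapsto> Y i $$ (f i, f j)\<close>.
\<close>

lemma prod_cycle_traces:
  assumes Y: "\<And>i. Y i \<in> carrier_mat d d" and S: "finite S" "\<sigma> permutes S"
  shows "(\<Prod>i\<in>cycle_minima S \<sigma>. mat_trace (mat_prod d Y (support \<sigma> i)))
    = (\<Sum>f\<in>PiE S (\<lambda>_. {..<d}). \<Prod>j\<in>S. Y j $$ (f j, f (\<sigma> j)))"
proof -
  have p: "permutation \<sigma>" by (rule permutes_permutation[OF S])
  let ?P = "cycle_minima S \<sigma>"
  have fin: "finite ?P" using S unfolding cycle_minima_def by simp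
  have ne: "support \<sigma> i \<noteq> []" for i using mem_support[OF p, of i] by force
  have hd: "hd (support \<sigma> i) = i" for i
    using least_power_of_permutation(2)[OF p, of i] by (simp add: hd_map upt_conv_Cons)
  have mem: "\<sigma> j \<in> set (support \<sigma> i)" if "j \<in> set (support \<sigma> i)" for i j
    using that unfolding support_set[OF p] by (auto simp: image_iff intro: exI[of _ "Suc _"])
  have "(\<Prod>i\<in>?P. mat_trace (mat_prod d Y (support \<sigma> i)))
     = (\<Prod>i\<in>?P. \<Sum>f\<in>PiE (set (support \<sigma> i)) (\<lambda>_. {..<d}). \<Prod>j\<in>set (support \<sigma> i). Y j $$ (f j, f (\<sigma> j)))"
    by (intro prod.cong refl)
      (simp only: mat_trace_mat_prod[OF Y cycle_of_permutation[OF p] ne] hd walk_support[OF p])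
  also have "\<dots> = (\<Sum>f\<in>PiE (\<Union>i\<in>?P. set (support \<sigma> i)) (\<lambda>_. {..<d}).
       \<Prod>i\<in>?P. \<Prod>j\<in>set (support \<sigma> i). Y j $$ (f j, f (\<sigma> j)))"
  proof (rule prod_sum_PiE_Union[OF fin])
    show "set (support \<sigma> i) \<inter> set (support \<sigma> j) = {}" if "i \<in> ?P" "j \<in> ?P" "i \<noteq> j" for i j
      by (rule cycles_disjoint[OF p that])
    show "(\<Prod>j\<in>set (support \<sigma> i). Y j $$ (f j, f (\<sigma> j))) = (\<Prod>j\<in>set (support \<sigma> i). Y j $$ (g j, g (\<sigma> j)))"
      if "\<And>x. x \<in> set (support \<sigma> i) \<Longrightarrow> f x = g x" for i f g
      by (intro prod.cong refl) (simp only: that mem)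
  qed
  also have "\<dots> = (\<Sum>f\<in>PiE S (\<lambda>_. {..<d}). \<Prod>j\<in>S. Y j $$ (f j, f (\<sigma> j)))"
  proof (subst cycles_cover[OF S], intro sum.cong refl, goal_cases)
    case (1 f)
    have "(\<Prod>j\<in>(\<Union>i\<in>?P. set (support \<sigma> i)). Y j $$ (f j, f (\<sigma> j)))
       = (\<Prod>i\<in>?P. \<Prod>j\<in>set (support \<sigma> i). Y j $$ (f j, f (\<sigma> j)))"
      by (rule prod.UNION_disjoint[OF fin]) (use cycles_disjoint[OF p] in auto)
    then show ?case unfolding cycles_cover[OF S] by simp
  qed
  finally show ?thesis .
qed

text \<open>
  The signed sum over permutations of the products of cycle traces becomes a sum of determinants
  \<open>det (Y i $$ (f i, f j))\<close> of size \<open>d + 1\<close>, one for each \<open>f : {0..d} \<rightarrow> {0..<d}\<close>. Such an \<open>f\<close> is not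
  injective, so two columns agree.
\<close>

theorem frobenius_identity_matrices:
  fixes Y :: "nat \<Rightarrow> 'a::comm_ring_1 mat"
  assumes Y: "\<And>i. Y i \<in> carrier_mat d d"
  shows "(\<Sum>\<sigma> | \<sigma> permutes {..d}. of_int (sign \<sigma>) *
      (\<Prod>i\<in>cycle_minima {..d} \<sigma>. mat_trace (mat_prod d Y (support \<sigma> i)))) = 0"
proof -
  let ?F = "PiE {..d} (\<lambda>_. {..<d})"
  let ?N = "\<lambda>f. mat (Suc d) (Suc d) (\<lambda>(i, j). Y i $$ (f i, f j))"
  have "(\<Sum>\<sigma> | \<sigma> permutes {..d}. of_int (sign \<sigma>) *
      (\<Prod>i\<in>cycle_minima {..d} \<sigma>. mat_trace (mat_prod d Y (support \<sigma> i))))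
    = (\<Sum>\<sigma> | \<sigma> permutes {..d}. \<Sum>f\<in>?F. of_int (sign \<sigma>) * (\<Prod>j\<in>{..d}. Y j $$ (f j, f (\<sigma> j))))"
    by (intro sum.cong refl) (simp add: prod_cycle_traces[OF Y] sum_distrib_left)
  also have "\<dots> = (\<Sum>f\<in>?F. \<Sum>\<sigma> | \<sigma> permutes {..d}. of_int (sign \<sigma>) * (\<Prod>j\<in>{..d}. Y j $$ (f j, f (\<sigma> j))))"
    by (rule sum.swap)
  also have "\<dots> = (\<Sum>f\<in>?F. det (?N f))"
  proof (intro sum.cong refl, goal_cases)
    case (1 f)
    have S: "{0..<Suc d} = {..d}" by auto
    have "det (?N f) = (\<Sum>\<sigma> | \<sigma> permutes {..d}. of_int (sign \<sigma>) * (\<Prod>j\<in>{..d}. ?N f $$ (j, \<sigma> j)))"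
      by (subst det_def'[of _ "Suc d"]) (auto simp: S intro!: sum.cong)
    also have "\<dots> = (\<Sum>\<sigma> | \<sigma> permutes {..d}. of_int (sign \<sigma>) * (\<Prod>j\<in>{..d}. Y j $$ (f j, f (\<sigma> j))))"
    proof (intro sum.cong refl arg_cong2[of _ _ _ _ "(*)"] prod.cong, goal_cases)
      case (1 \<sigma> j)
      then have "\<sigma> j \<in> {..d}" using permutes_in_image[of \<sigma> "{..d}" j] by simp
      then show ?case using 1 by (simp add: less_Suc_eq_le)
    qed
    finally show ?case by simp
  qed
  also have "\<dots> = 0"
  proof (rule sum.neutral, intro ballI)
    fix f assume f: "f \<in> ?F"
    have "card (f ` {..d}) \<le> card {..<d}"
      by (rule card_mono) (use f in \<open>auto simp: PiE_def Pi_def\<close>)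
    then have "\<not> inj_on f {..d}" using card_image[of f "{..d}"] by auto
    then obtain i j where ij: "i \<le> d" "j \<le> d" "i \<noteq> j" "f i = f j"
      unfolding inj_on_def by auto
    show "det (?N f) = 0"
      by (rule det_identical_columns[of _ "Suc d" i j]) (use ij in \<open>auto intro!: eq_vecI\<close>)
  qed
  finally show ?thesis .
qed

section \<open>Congruences modulo an ideal\<close>

text \<open>
  Ideals in closure form, which replaces the record operations of \<^const>\<open>ideal\<close> by those of the type class.
\<close>

definition is_ideal :: "'a::comm_ring_1 set \<Rightarrow> bool" where
  "is_ideal C \<longleftrightarrow> 0 \<in> C \<and> (\<forall>a\<in>C. \<forall>b\<in>C. a + b \<in> C) \<and> (\<forall>a\<in>C. \<forall>r. r * a \<in> C)"

lemma ideal_class_ring_iff: "ideal C (class_ring :: 'a::comm_ring_1 ring) \<longleftrightarrow> is_ideal C"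
proof
  assume "ideal C (class_ring :: 'a ring)"
  then interpret ideal C "class_ring :: 'a ring" .
  show "is_ideal C" unfolding is_ideal_def
    using additive_subgroup.zero_closed[OF is_additive_subgroup] a_closed I_l_closed by simp
next
  assume C: "is_ideal C"
  have neg: "- a \<in> C" if "a \<in> C" for a
  proof -
    have "(- 1) * a \<in> C" using C that unfolding is_ideal_def by blast
    then show ?thesis by simp
  qed
  have inv: "inv\<^bsub>add_monoid (class_ring :: 'a ring)\<^esub> a = - a" for a :: 'a
    unfolding a_inv_def[symmetric] by (simp add: class_ring_simps)
  show "ideal C (class_ring :: 'a ring)"
  proof (rule idealI)
    show "ring (class_ring :: 'a ring)" by (rule class_ring.ring_axioms)
    show "subgroup C (add_monoid (class_ring :: 'a ring))"
      by (rule subgroup.intro) (use C neg inv in \<open>auto simp: is_ideal_def\<close>)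
  qed (use C in \<open>auto simp: is_ideal_def mult.commute\<close>)
qed

lemma is_idealD:
  assumes "is_ideal C"
  shows ideal_zero: "0 \<in> C" and ideal_add: "a \<in> C \<Longrightarrow> b \<in> C \<Longrightarrow> a + b \<in> C"
    and ideal_mult: "a \<in> C \<Longrightarrow> r * a \<in> C" and ideal_mult': "a \<in> C \<Longrightarrow> a * r \<in> C"
    and ideal_uminus: "a \<in> C \<Longrightarrow> - a \<in> C"
proof -
  show "0 \<in> C" using assms unfolding is_ideal_def by auto
  show "a \<in> C \<Longrightarrow> b \<in> C \<Longrightarrow> a + b \<in> C" for a b using assms unfolding is_ideal_def by auto
  show mu: "a \<in> C \<Longrightarrow> r * a \<in> C" for a r using assms unfolding is_ideal_def by auto
  show "a \<in> C \<Longrightarrow> a * r \<in> C" for a r using mu[of a r] by (simp add: mult.commute)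
  show "a \<in> C \<Longrightarrow> - a \<in> C" for a using mu[of a "-1"] by simp
qed

lemma ideal_sum:
  assumes "is_ideal C" "\<And>i. i \<in> S \<Longrightarrow> f i \<in> C"
  shows "sum f S \<in> C"
  using assms(2) by (induction S rule: infinite_finite_induct)
    (auto intro: ideal_zero[OF assms(1)] ideal_add[OF assms(1)])

lemma cong_ideal_trans:
  assumes "is_ideal C" "a - b \<in> C" "b - c \<in> C" shows "a - c \<in> C"
  using ideal_add[OF assms] by simp

lemma cong_ideal_sym:
  assumes "is_ideal C" "a - b \<in> C" shows "b - a \<in> C"
  using ideal_uminus[OF assms] by simp

lemma cong_ideal_mult:
  assumes C: "is_ideal C" and "a - b \<in> C" "a' - b' \<in> C"
  shows "a * a' - b * b' \<in> C"
proof -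
  have "a * a' - b * b' = (a - b) * a' + b * (a' - b')" by (simp add: algebra_simps)
  then show ?thesis using ideal_add[OF C ideal_mult'[OF C assms(2)] ideal_mult[OF C assms(3)]] by simp
qed

lemma cong_ideal_prod:
  assumes C: "is_ideal C" and "\<And>i. i \<in> S \<Longrightarrow> f i - g i \<in> C"
  shows "prod f S - prod g S \<in> C"
  using assms(2)
  by (induction S rule: infinite_finite_induct) (auto intro: ideal_zero[OF C] cong_ideal_mult[OF C])

lemma cong_ideal_sum:
  assumes C: "is_ideal C" and "\<And>i. i \<in> S \<Longrightarrow> f i - g i \<in> C"
  shows "sum f S - sum g S \<in> C"
  using ideal_sum[OF C, of S "\<lambda>i. f i - g i"] assms(2) by (simp add: sum_subtractf)

abbreviation coset :: "'a::comm_ring_1 set \<Rightarrow> 'a \<Rightarrow> 'a set" where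
  "coset C a \<equiv> C +>\<^bsub>class_ring\<^esub> a"

lemma coset_eq: "coset C (a :: 'a::comm_ring_1) = {c + a | c. c \<in> C}"
  unfolding a_r_coset_def' by auto

lemma mem_coset_iff: "b \<in> coset C a \<longleftrightarrow> b - a \<in> C"
  unfolding coset_eq by (auto intro!: exI[of _ "b - a"])

lemma coset_eq_iff:
  assumes C: "is_ideal C" shows "coset C a = coset C b \<longleftrightarrow> a - b \<in> C"
proof
  assume "coset C a = coset C b"
  moreover have "a \<in> coset C a" unfolding mem_coset_iff using ideal_zero[OF C] by simp
  ultimately show "a - b \<in> C" unfolding mem_coset_iff[symmetric] by simp
next
  assume "a - b \<in> C"
  then show "coset C a = coset C b"
    using cong_ideal_trans[OF C, of _ a b] cong_ideal_trans[OF C, of _ b a] cong_ideal_sym[OF C, of a b]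
    by (auto simp: mem_coset_iff)
qed

lemma carrier_quot: "carrier (class_ring Quot C) = range (coset C)"
  unfolding FactRing_def A_RCOSETS_def' by auto

context
  fixes C :: "'a::comm_ring_1 set"
  assumes C: "is_ideal C"
begin

interpretation quot: ring_hom_cring "class_ring :: 'a ring" "class_ring Quot C" "coset C"
  by (rule ideal.rcos_ring_hom_cring[OF _ class_cring.cring_axioms])
    (simp add: ideal_class_ring_iff C)

lemma coset_mult: "coset C a \<otimes>\<^bsub>class_ring Quot C\<^esub> coset C b = coset C (a * b)"
  using quot.hom_mult[of a b] by simp

lemma coset_add: "coset C a \<oplus>\<^bsub>class_ring Quot C\<^esub> coset C b = coset C (a + b)"
  using quot.hom_add[of a b] by simp

lemma coset_zero: "\<zero>\<^bsub>class_ring Quot C\<^esub> = coset C 0"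
  using quot.hom_zero by simp

lemma coset_one: "\<one>\<^bsub>class_ring Quot C\<^esub> = coset C 1"
  using quot.hom_one by simp

lemma coset_finprod: "(\<Otimes>\<^bsub>class_ring Quot C\<^esub>i\<in>S. coset C (f i)) = coset C (prod f S)"
  using quot.hom_finprod[of f S] by (simp add: class_ring_simps comp_def)

lemma coset_finsum: "(\<Oplus>\<^bsub>class_ring Quot C\<^esub>i\<in>S. coset C (f i)) = coset C (sum f S)"
  using quot.hom_finsum[of f S] by (simp add: class_ring_simps comp_def)

lemma coset_nat_pow:
  fixes k :: nat
  shows "[k] \<cdot>\<^bsub>class_ring Quot C\<^esub> coset C a = coset C (of_nat k * a)"
proof (induction k)
  case 0
  then show ?case by (simp add: coset_zero)
next
  case (Suc k)
  have "coset C a \<in> carrier (class_ring Quot C)" by (simp add: carrier_quot)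
  then show ?case using Suc
    by (simp add: quot.S.add.nat_pow_Suc coset_add algebra_simps)
qed

lemma coset_int_pow:
  fixes k :: int
  shows "[k] \<cdot>\<^bsub>class_ring Quot C\<^esub> coset C a = coset C (of_int k * a)"
proof (cases "k \<ge> 0")
  case True
  then show ?thesis by (simp add: add_pow_int_ge coset_nat_pow)
next
  case False
  have "\<ominus>\<^bsub>class_ring Quot C\<^esub> coset C b = coset C (- b)" for b
    using quot.hom_a_inv[of b] by (simp add: class_ring_simps)
  then show ?thesis using False by (simp add: add_pow_int_lt coset_nat_pow)
qed

end

section \<open>Pseudocharacters modulo an ideal\<close>

text \<open>
  A pseudocharacter with values in \<open>A/C\<close>, described by an arbitrary lift \<open>t\<close> of its values to \<open>A\<close>. This
  replaces computations with cosets by congruences in \<open>A\<close>.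
\<close>

definition pseudochar_mod ::
    "('a::comm_ring_1 \<Rightarrow> 'r::ring_1 \<Rightarrow> 'r) \<Rightarrow> 'a set \<Rightarrow> nat \<Rightarrow> ('r \<Rightarrow> 'a) \<Rightarrow> bool" where
  "pseudochar_mod smul C d t \<longleftrightarrow>
     (\<forall>x y. t (x + y) - (t x + t y) \<in> C) \<and>
     (\<forall>a x. t (smul a x) - a * t x \<in> C) \<and>
     (\<forall>x y. t (x * y) - t (y * x) \<in> C) \<and>
     t 1 - of_nat d \<in> C \<and>
     (\<forall>x. (\<Sum>\<sigma> | \<sigma> permutes {..d}. of_int (sign \<sigma>) *
        (\<Prod>i\<in>cycle_minima {..d} \<sigma>. t (prod_list (map x (support \<sigma> i))))) \<in> C)"

lemma pseudocharacter_quot_iff: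
  assumes C: "is_ideal C"
  shows "pseudocharacter smul (class_ring Quot C) (coset C) d (\<lambda>x. coset C (t x))
    \<longleftrightarrow> pseudochar_mod smul C d t"
  unfolding pseudocharacter_def pseudochar_mod_def perm_trace_def cycle_minima_def[symmetric]
    coset_finprod[OF C] coset_int_pow[OF C] coset_finsum[OF C] coset_zero[OF C] coset_one[OF C]
    coset_nat_pow[OF C] coset_add[OF C] coset_mult[OF C] coset_eq_iff[OF C] carrier_quot
  by simp

text \<open>
  Since \<open>I\<close> lies in the kernel of \<open>\<pi>\<close>, the reduction of a coset may be computed on the chosen lift.
\<close>

lemma reducible_mod_iff:
  fixes T :: "'r::ring_1 \<Rightarrow> 'a::comm_ring_1" and \<pi> :: "'a \<Rightarrow> 'f::field"
  assumes "comm_ring_hom \<pi>"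
  shows "reducible_mod smul \<pi> T n1 \<tau>1 n2 \<tau>2 I \<longleftrightarrow>
    is_ideal I \<and> I \<subseteq> {a. \<pi> a = 0} \<and>
    (\<exists>t1 t2. pseudochar_mod smul I n1 t1 \<and> pseudochar_mod smul I n2 t2 \<and>
       (\<forall>x. T x - (t1 x + t2 x) \<in> I) \<and>
       (\<forall>x. \<pi> (t1 x) = mat_trace (\<tau>1 x)) \<and> (\<forall>x. \<pi> (t2 x) = mat_trace (\<tau>2 x)))"
    (is "?L \<longleftrightarrow> ?R")
proof
  interpret comm_ring_hom \<pi> by fact
  assume L: ?L
  then have I: "is_ideal I" and sub: "I \<subseteq> {a. \<pi> a = 0}"
    unfolding reducible_mod_def ideal_class_ring_iff by auto
  from L obtain T1 T2 where
    T1: "pseudocharacter smul (class_ring Quot I) (coset I) n1 T1" and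
    T2: "pseudocharacter smul (class_ring Quot I) (coset I) n2 T2" and
    sum: "\<And>x. coset I (T x) = T1 x \<oplus>\<^bsub>class_ring Quot I\<^esub> T2 x" and
    r1: "\<And>x a. a \<in> T1 x \<Longrightarrow> \<pi> a = mat_trace (\<tau>1 x)" and
    r2: "\<And>x a. a \<in> T2 x \<Longrightarrow> \<pi> a = mat_trace (\<tau>2 x)"
    unfolding reducible_mod_def by blast
  have "T1 x \<in> range (coset I)" "T2 x \<in> range (coset I)" for x
    using T1 T2 unfolding pseudocharacter_def carrier_quot by simp_all
  then have "\<forall>x. \<exists>a. T1 x = coset I a" "\<forall>x. \<exists>a. T2 x = coset I a"
    by (simp_all add: image_iff)
  then obtain t1 t2 where t: "T1 = (\<lambda>x. coset I (t1 x))" "T2 = (\<lambda>x. coset I (t2 x))"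
    by metis
  have "t1 x \<in> T1 x" "t2 x \<in> T2 x" for x
    unfolding t mem_coset_iff using ideal_zero[OF I] by auto
  then show ?R using I sub T1 T2 sum r1 r2
    unfolding t pseudocharacter_quot_iff[OF I] coset_add[OF I] coset_eq_iff[OF I] by blast
next
  interpret comm_ring_hom \<pi> by fact
  assume ?R
  then obtain t1 t2 where I: "is_ideal I" and sub: "I \<subseteq> {a. \<pi> a = 0}"
    and t: "pseudochar_mod smul I n1 t1" "pseudochar_mod smul I n2 t2"
      "\<And>x. T x - (t1 x + t2 x) \<in> I"
      "\<And>x. \<pi> (t1 x) = mat_trace (\<tau>1 x)" "\<And>x. \<pi> (t2 x) = mat_trace (\<tau>2 x)" by blast
  have eq: "\<pi> a = \<pi> b" if "a \<in> coset I b" for a b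
    using that sub unfolding mem_coset_iff by (auto simp: hom_minus)
  show ?L unfolding reducible_mod_def ideal_class_ring_iff
    by (intro conjI I sub exI[of _ "\<lambda>x. coset I (t1 x)"] exI[of _ "\<lambda>x. coset I (t2 x)"])
      (use t eq in \<open>auto simp: pseudocharacter_quot_iff[OF I] coset_add[OF I] coset_eq_iff[OF I]\<close>)
qed

lemma mat_trace_mult_commute:
  assumes "A \<in> carrier_mat d d" "B \<in> carrier_mat d d"
  shows "mat_trace (A * B) = mat_trace (B * A)"
proof -
  have "mat_trace (A * B) = (\<Sum>i<d. \<Sum>k<d. A $$ (i, k) * B $$ (k, i))"
    using assms unfolding mat_trace_def by (auto intro!: sum.cong index_mult_mat_sum simp del: index_mult_mat(1))
  also have "\<dots> = (\<Sum>k<d. \<Sum>i<d. B $$ (k, i) * A $$ (i, k))"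
    by (subst sum.swap) (simp add: mult.commute)
  also have "\<dots> = mat_trace (B * A)"
    using assms unfolding mat_trace_def by (auto intro!: sum.cong index_mult_mat_sum[symmetric] simp del: index_mult_mat(1))
  finally show ?thesis .
qed

lemma mat_trace_cong_mod:
  assumes C: "is_ideal C" and "A \<in> carrier_mat d d" "B \<in> carrier_mat d d"
    and "\<And>p q. p < d \<Longrightarrow> q < d \<Longrightarrow> A $$ (p, q) - B $$ (p, q) \<in> C"
  shows "mat_trace A - mat_trace B \<in> C"
  using assms(2,3) unfolding mat_trace_def by (auto intro!: cong_ideal_sum[OF C] assms(4))

text \<open>
  Traces of matrices satisfy the Frobenius identity, and the identity survives modulo \<open>C\<close> if \<open>B\<close> is
  multiplicative only up to \<open>C\<close>. This applies to the diagonal blocks of a representation whose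
  lower left block has entries in \<open>C\<close>.
\<close>

proposition pseudochar_mod_trace:
  fixes B :: "'r::ring_1 \<Rightarrow> 'a::comm_ring_1 mat"
  assumes C: "is_ideal C"
    and B: "\<And>x. B x \<in> carrier_mat d d"
    and one: "B 1 = 1\<^sub>m d"
    and add: "\<And>x y. B (x + y) = B x + B y"
    and smul: "\<And>a x. B (smul a x) = a \<cdot>\<^sub>m B x"
    and mult: "\<And>x y p q. p < d \<Longrightarrow> q < d \<Longrightarrow> B (x * y) $$ (p, q) - (B x * B y) $$ (p, q) \<in> C"
  shows "pseudochar_mod smul C d (\<lambda>x. mat_trace (B x))"
proof -
  have dims: "dim_row (B x) = d" "dim_col (B x) = d" for x using B[of x] by auto
  have BB: "B x * B y \<in> carrier_mat d d" for x y using mult_carrier_mat[OF B B] .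
  have tr_mult: "mat_trace (B (x * y)) - mat_trace (B x * B y) \<in> C" for x y
    by (rule mat_trace_cong_mod[OF C B BB mult])
  have central: "mat_trace (B (x * y)) - mat_trace (B (y * x)) \<in> C" for x y
    using cong_ideal_trans[OF C tr_mult cong_ideal_sym[OF C tr_mult], of x y]
    unfolding mat_trace_mult_commute[OF B B, of x y]
    using cong_ideal_trans[OF C tr_mult[of x y, unfolded mat_trace_mult_commute[OF B B, of x y]]
        cong_ideal_sym[OF C tr_mult[of y x]]] by blast
  have list: "B (prod_list (map x l)) $$ (p, q) - mat_prod d (\<lambda>i. B (x i)) l $$ (p, q) \<in> C"
    if "p < d" "q < d" for x :: "nat \<Rightarrow> 'r" and l p q
    using that
  proof (induction l arbitrary: p q)
    case Nil
    then show ?case by (simp add: one ideal_zero[OF C])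
  next
    case (Cons i l)
    let ?P = "mat_prod d (\<lambda>i. B (x i)) l"
    have P: "?P \<in> carrier_mat d d" by (rule mat_prod_carrier[OF B])
    have "(B (x i) * B (prod_list (map x l))) $$ (p, q) - (B (x i) * ?P) $$ (p, q) \<in> C"
      unfolding index_mult_mat_sum[OF B B Cons.prems] index_mult_mat_sum[OF B P Cons.prems]
      by (intro cong_ideal_sum[OF C] cong_ideal_mult[OF C])
        (use Cons in \<open>auto simp: ideal_zero[OF C]\<close>)
    then show ?case
      using cong_ideal_trans[OF C mult[OF Cons.prems, of "x i" "prod_list (map x l)"]] by simp
  qed
  have tr_list: "mat_trace (B (prod_list (map x l))) - mat_trace (mat_prod d (\<lambda>i. B (x i)) l) \<in> C"
    for x :: "nat \<Rightarrow> 'r" and l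
    by (rule mat_trace_cong_mod[OF C B mat_prod_carrier[OF B] list])
  have frob: "(\<Sum>\<sigma> | \<sigma> permutes {..d}. of_int (sign \<sigma>) *
        (\<Prod>i\<in>cycle_minima {..d} \<sigma>. mat_trace (B (prod_list (map x (support \<sigma> i)))))) \<in> C"
    (is "?lhs x \<in> C") for x
  proof -
    have "?lhs x - (\<Sum>\<sigma> | \<sigma> permutes {..d}. of_int (sign \<sigma>) *
        (\<Prod>i\<in>cycle_minima {..d} \<sigma>. mat_trace (mat_prod d (\<lambda>i. B (x i)) (support \<sigma> i)))) \<in> C"
      by (intro cong_ideal_sum[OF C] cong_ideal_mult[OF C] cong_ideal_prod[OF C] tr_list)
        (simp add: ideal_zero[OF C])
    then show ?thesis unfolding frobenius_identity_matrices[of "\<lambda>i. B (x i)" d, OF B] diff_zero .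
  qed
  have "mat_trace (B (x + y)) = mat_trace (B x) + mat_trace (B y)" for x y
    unfolding mat_trace_def add by (simp add: dims sum.distrib)
  moreover have "mat_trace (B (smul a x)) = a * mat_trace (B x)" for a x
    unfolding mat_trace_def smul by (simp add: dims sum_distrib_left)
  moreover have "mat_trace (B 1) = of_nat d" unfolding one mat_trace_def by simp
  ultimately show ?thesis unfolding pseudochar_mod_def using central frob ideal_zero[OF C] by simp
qed

section \<open>Annihilators of pseudocharacters\<close>

text \<open>
  In the Frobenius identity the last variable \<open>y\<close> occurs in exactly one cycle; by centrality that cycle
  can be rotated until \<open>y\<close> comes last, which isolates a factor \<open>t (w * y)\<close>. For \<open>\<sigma> \<noteq> id\<close>, either the
  cycle of \<open>y\<close> contains other variables, or some other cycle has length at least 2.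
\<close>

lemma perm_trace_last_variable:
  fixes t :: "'r::ring_1 \<Rightarrow> 'a::comm_ring_1" and x :: "nat \<Rightarrow> 'r"
  assumes C: "is_ideal C" and central: "\<And>x y. t (x * y) - t (y * x) \<in> C"
    and \<sigma>: "\<sigma> permutes {..d}"
  shows "\<exists>c w. (\<forall>y. (\<Prod>i\<in>cycle_minima {..d} \<sigma>. t (prod_list (map (x(d := y)) (support \<sigma> i))))
        - c * t (w * y) \<in> C) \<and>
      (\<sigma> = id \<longrightarrow> w = 1 \<and> c = (\<Prod>i<d. t (x i))) \<and>
      (\<sigma> \<noteq> id \<longrightarrow> (\<exists>l. l \<noteq> [] \<and> set l \<subseteq> {..<d} \<and> w = prod_list (map x l)) \<or>
        (\<exists>l c'. 2 \<le> length l \<and> distinct l \<and> set l \<subseteq> {..<d} \<and> c = t (prod_list (map x l)) * c'))"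
proof -
  have p: "permutation \<sigma>" by (rule permutes_permutation[OF _ \<sigma>]) simp
  let ?P = "cycle_minima {..d} \<sigma>"
  have fin: "finite ?P" unfolding cycle_minima_def by simp
  have cover: "(\<Union>i\<in>?P. set (support \<sigma> i)) = {..d}" by (rule cycles_cover[OF _ \<sigma>]) simp
  have "d \<in> (\<Union>i\<in>?P. set (support \<sigma> i))" unfolding cover by simp
  then obtain i0 where i0: "i0 \<in> ?P" "d \<in> set (support \<sigma> i0)" by blast
  obtain as bs where split: "support \<sigma> i0 = as @ d # bs" using split_list[OF i0(2)] by blast
  have dist: "distinct (support \<sigma> i)" for i by (rule cycle_of_permutation[OF p])
  have sub: "set (support \<sigma> i) \<subseteq> {..d}" if "i \<in> ?P" for i
    by (rule support_subset[OF \<sigma>]) (use that in \<open>auto simp: cycle_minima_def\<close>)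
  have dnot: "d \<notin> set as" "d \<notin> set bs" using dist[of i0] unfolding split by auto
  have d': "d \<notin> set (support \<sigma> i)" if "i \<in> ?P - {i0}" for i
    using cycles_disjoint[OF p, of i "{..d}" i0] that i0 by blast
  have lt: "set (support \<sigma> i) \<subseteq> {..<d}" if "i \<in> ?P - {i0}" for i
    using sub[of i] d'[OF that] that by (force simp: order.order_iff_strict)
  define c where "c = (\<Prod>i\<in>?P - {i0}. t (prod_list (map x (support \<sigma> i))))"
  \<comment> \<open>The cycle reads \<open>as, d, bs\<close>; rotating \<open>d\<close> to the end puts \<open>bs\<close> in front of \<open>as\<close>.\<close>
  define w where "w = prod_list (map x (bs @ as))"
  have upd: "map (x(d := y)) l = map x l" if "d \<notin> set l" for l y using that by simp
  have main: "(\<Prod>i\<in>?P. t (prod_list (map (x(d := y)) (support \<sigma> i)))) - c * t (w * y) \<in> C" for y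
  proof -
    have "(\<Prod>i\<in>?P. t (prod_list (map (x(d := y)) (support \<sigma> i))))
       = c * t (prod_list (map (x(d := y)) (support \<sigma> i0)))"
      unfolding c_def by (subst prod.remove[OF fin i0(1)], subst mult.commute)
        (intro arg_cong2[of _ _ _ _ "(*)"] prod.cong refl, simp only: upd[OF d'])
    moreover have "t (prod_list (map (x(d := y)) (support \<sigma> i0))) - t (w * y) \<in> C"
      using central[of "prod_list (map x as) * y" "prod_list (map x bs)"] dnot
      unfolding split w_def by (simp add: upd mult.assoc)
    ultimately show ?thesis
      using cong_ideal_mult[OF C, of c c] ideal_zero[OF C] by simp
  qed
  have "w = 1 \<and> c = (\<Prod>i<d. t (x i))" if id: "\<sigma> = id"
  proof -
    have l1: "least_power id i = 1" for i :: nat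
      unfolding least_power_def by (rule Least_equality) auto
    have si: "support \<sigma> i = [i]" for i unfolding id by (simp add: l1)
    have P: "?P = {..d}" unfolding cycle_minima_def by (auto simp: si simp del: set_map)
    have "i0 = d" using i0(2) unfolding si by simp
    moreover have "as = [] \<and> bs = []" using split unfolding si by (cases as) auto
    moreover have "{..d} - {d} = {..<d}" by auto
    ultimately show ?thesis unfolding c_def w_def P si by simp
  qed
  moreover have "(\<exists>l. l \<noteq> [] \<and> set l \<subseteq> {..<d} \<and> w = prod_list (map x l)) \<or>
        (\<exists>l c'. 2 \<le> length l \<and> distinct l \<and> set l \<subseteq> {..<d} \<and> c = t (prod_list (map x l)) * c')"
    if nid: "\<sigma> \<noteq> id"
  proof (cases "bs @ as = []")
    case False
    have "set (bs @ as) \<subseteq> {..<d}" using sub[OF i0(1)] dnot unfolding split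
      by (force simp: order.order_iff_strict)
    then show ?thesis using False unfolding w_def by blast
  next
    case True
    then have s0: "support \<sigma> i0 = [d]" using split by simp
    obtain j where j: "\<sigma> j \<noteq> j" using nid by (auto simp: fun_eq_iff)
    have jS: "j \<in> {..d}" using j \<sigma> by (metis permutes_not_in)
    then have "j \<in> (\<Union>i\<in>?P. set (support \<sigma> i))" unfolding cover .
    then obtain i where i: "i \<in> ?P" "j \<in> set (support \<sigma> i)" by blast
    have \<sigma>j: "\<sigma> k \<in> set (support \<sigma> i)" if "k \<in> set (support \<sigma> i)" for i k
      using that unfolding support_set[OF p] by (auto simp: image_iff intro: exI[of _ "Suc _"])
    have "i \<noteq> i0" using i(2) \<sigma>j[OF i(2)] j unfolding s0[symmetric] using s0
      by (metis empty_iff empty_set insert_iff list.simps(15))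
    then have ii: "i \<in> ?P - {i0}" using i by simp
    have "card {j, \<sigma> j} \<le> card (set (support \<sigma> i))"
      by (rule card_mono) (use i \<sigma>j in auto)
    also have "\<dots> \<le> length (support \<sigma> i)" by (rule card_length)
    finally have "2 \<le> length (support \<sigma> i)" using j by simp
    moreover have "c = t (prod_list (map x (support \<sigma> i))) *
        (\<Prod>i\<in>?P - {i0} - {i}. t (prod_list (map x (support \<sigma> i))))"
      unfolding c_def by (rule prod.remove[OF _ ii]) (use fin in simp)
    ultimately show ?thesis using dist[of i] lt[OF ii] by blast
  qed
  ultimately show ?thesis using main by blast
qed

text \<open>
  Collecting the terms \<open>c * t (w * y)\<close> of the Frobenius identity into \<open>t (u * y)\<close> gives an element \<open>u\<close>
  annihilated by \<open>t\<close>. If the \<open>x i\<close> look to \<open>t\<close> like orthogonal diagonal matrix units modulo the kernel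
  of \<open>\<pi>\<close> while \<open>\<tau>'\<close> kills them, only the term of the identity permutation contributes to \<open>\<tau>' u\<close>, and it
  contributes 1. So \<open>u\<close> separates \<open>t\<close> from \<open>\<tau>'\<close>.
\<close>

proposition pseudochar_annihilator:
  fixes t :: "'r::ring_1 \<Rightarrow> 'a::comm_ring_1" and \<pi> :: "'a \<Rightarrow> 'f::field"
  assumes alg: "assoc_algebra smul" and C: "is_ideal C" and hom: "comm_ring_hom \<pi>"
    and t: "pseudochar_mod smul C d t"
    and rep: "mat_rep smul \<pi> e \<tau>'"
    and x1: "\<And>i. i < d \<Longrightarrow> \<pi> (t (x i)) = 1"
    and x0: "\<And>l. 2 \<le> length l \<Longrightarrow> distinct l \<Longrightarrow> set l \<subseteq> {..<d} \<Longrightarrow> \<pi> (t (prod_list (map x l))) = 0"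
    and x': "\<And>i. i < d \<Longrightarrow> \<tau>' (x i) = 0\<^sub>m e e"
  shows "\<exists>u. (\<forall>y. t (u * y) \<in> C) \<and> (\<forall>p<e. \<tau>' u $$ (p, p) = 1)"
proof -
  interpret comm_ring_hom \<pi> by fact
  interpret A: assoc_algebra smul by fact
  let ?S = "{\<sigma>. \<sigma> permutes {..d}}"
  define Q where "Q \<sigma> c w \<longleftrightarrow> (\<forall>y. (\<Prod>i\<in>cycle_minima {..d} \<sigma>. t (prod_list (map (x(d := y)) (support \<sigma> i))))
        - c * t (w * y) \<in> C) \<and>
      (\<sigma> = id \<longrightarrow> w = 1 \<and> c = (\<Prod>i<d. t (x i))) \<and>
      (\<sigma> \<noteq> id \<longrightarrow> (\<exists>l. l \<noteq> [] \<and> set l \<subseteq> {..<d} \<and> w = prod_list (map x l)) \<or>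
        (\<exists>l c'. 2 \<le> length l \<and> distinct l \<and> set l \<subseteq> {..<d} \<and> c = t (prod_list (map x l)) * c'))" for \<sigma> c w
  have central: "t (x * y) - t (y * x) \<in> C" for x y using t unfolding pseudochar_mod_def by blast
  have add: "t (x + y) - (t x + t y) \<in> C" for x y using t unfolding pseudochar_mod_def by blast
  have sm: "t (smul a x) - a * t x \<in> C" for a x using t unfolding pseudochar_mod_def by blast
  have "\<exists>c w. Q \<sigma> c w" if "\<sigma> \<in> ?S" for \<sigma>
    unfolding Q_def by (rule perm_trace_last_variable, rule C, rule central) (use that in simp)
  then obtain c w where "\<And>\<sigma>. \<sigma> \<in> ?S \<Longrightarrow> Q \<sigma> (c \<sigma>) (w \<sigma>)" by metis
  note cw = this[unfolded Q_def]
  define u where "u = (\<Sum>\<sigma>\<in>?S. smul (of_int (sign \<sigma>) * c \<sigma>) (w \<sigma>))"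
  have finS: "finite ?S" by (rule finite_permutations) simp
  have t0: "t 0 \<in> C" using ideal_uminus[OF C add[of 0 0]] by simp
  have tsum: "t (sum f S) - (\<Sum>i\<in>S. t (f i)) \<in> C" if "finite S" for f and S :: "(nat \<Rightarrow> nat) set"
    using that
  proof (induction S rule: finite_induct)
    case empty
    then show ?case using t0 by simp
  next
    case (insert i S)
    have "(t (f i) + t (sum f S)) - (t (f i) + (\<Sum>i\<in>S. t (f i))) \<in> C"
      using insert.IH by simp
    from cong_ideal_trans[OF C add this] show ?case using insert.hyps by simp
  qed
  have "t (u * y) \<in> C" for y
  proof -
    have uy: "u * y = (\<Sum>\<sigma>\<in>?S. smul (of_int (sign \<sigma>) * c \<sigma>) (w \<sigma> * y))"
      unfolding u_def sum_distrib_right by (simp add: A.smul_mult_left)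
    have 1: "t (u * y) - (\<Sum>\<sigma>\<in>?S. of_int (sign \<sigma>) * (c \<sigma> * t (w \<sigma> * y))) \<in> C"
      unfolding uy using cong_ideal_trans[OF C tsum[OF finS] cong_ideal_sum[OF C]] sm
      by (metis (mono_tags, lifting) mult.assoc)
    have 2: "(\<Sum>\<sigma>\<in>?S. of_int (sign \<sigma>) *
        (\<Prod>i\<in>cycle_minima {..d} \<sigma>. t (prod_list (map (x(d := y)) (support \<sigma> i)))))
       - (\<Sum>\<sigma>\<in>?S. of_int (sign \<sigma>) * (c \<sigma> * t (w \<sigma> * y))) \<in> C"
      by (intro cong_ideal_sum[OF C] cong_ideal_mult[OF C]) (use cw ideal_zero[OF C] in auto)
    have 3: "(\<Sum>\<sigma>\<in>?S. of_int (sign \<sigma>) *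
        (\<Prod>i\<in>cycle_minima {..d} \<sigma>. t (prod_list (map (x(d := y)) (support \<sigma> i))))) \<in> C"
      using t unfolding pseudochar_mod_def by blast
    show ?thesis
      using ideal_add[OF C cong_ideal_trans[OF C 1 cong_ideal_sym[OF C 2]] 3] by simp
  qed
  moreover have "\<tau>' u $$ (p, p) = 1" if p: "p < e" for p
  proof -
    have car: "\<tau>' x \<in> carrier_mat e e" for x using rep unfolding mat_rep_def by blast
    have dims: "dim_row (\<tau>' x) = e" "dim_col (\<tau>' x) = e" for x using car[of x] by auto
    have radd: "\<tau>' (x + y) = \<tau>' x + \<tau>' y" and rmul: "\<tau>' (x * y) = \<tau>' x * \<tau>' y"
      and rsm: "\<tau>' (smul a x) = \<pi> a \<cdot>\<^sub>m \<tau>' x" and r1: "\<tau>' 1 = 1\<^sub>m e" for x y a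
      using rep unfolding mat_rep_def by blast+
    have r0: "\<tau>' 0 $$ (p, p) = 0" using radd[of 0 0] p dims[of 0]
      by (metis add_cancel_right_right add_0 index_add_mat(1))
    have rsum: "\<tau>' (sum f S) $$ (p, p) = (\<Sum>i\<in>S. \<tau>' (f i) $$ (p, p))" if "finite S"
      for f and S :: "(nat \<Rightarrow> nat) set"
      using that by (induction S rule: finite_induct) (simp_all add: r0 radd dims p)
    have "\<tau>' u $$ (p, p) = (\<Sum>\<sigma>\<in>?S. of_int (sign \<sigma>) * \<pi> (c \<sigma>) * \<tau>' (w \<sigma>) $$ (p, p))"
      unfolding u_def rsum[OF finS] rsm by (simp add: dims p hom_mult)
    also have "\<dots> = (\<Sum>\<sigma>\<in>?S. if \<sigma> = id then 1 else 0)"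
    proof (intro sum.cong refl)
      fix \<sigma> assume \<sigma>: "\<sigma> \<in> ?S"
      show "of_int (sign \<sigma>) * \<pi> (c \<sigma>) * \<tau>' (w \<sigma>) $$ (p, p) = (if \<sigma> = id then 1 else 0)"
      proof (cases "\<sigma> = id")
        case True
        then have "w \<sigma> = 1" "c \<sigma> = (\<Prod>i<d. t (x i))" using cw[OF \<sigma>] by auto
        then show ?thesis using True p by (simp add: r1 hom_prod x1)
      next
        case False
        then consider l where "l \<noteq> []" "set l \<subseteq> {..<d}" "w \<sigma> = prod_list (map x l)"
          | l c' where "2 \<le> length l" "distinct l" "set l \<subseteq> {..<d}" "c \<sigma> = t (prod_list (map x l)) * c'"
          using cw[OF \<sigma>] by blast
        then show ?thesis
        proof cases
          case 1
          then obtain i l' where l: "l = i # l'" by (cases l) auto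
          have "\<tau>' (w \<sigma>) = 0\<^sub>m e e"
            unfolding 1 l using 1 l x'[of i] left_mult_zero_mat[OF car] by (simp add: rmul)
          then show ?thesis using False p by simp
        next
          case 2
          then have "\<pi> (c \<sigma>) = 0" using x0 by (simp add: hom_mult)
          then show ?thesis using False by simp
        qed
      qed
    qed
    also have "\<dots> = 1" using finS permutes_id[of "{..d}"] by (simp add: sum.delta)
    finally show ?thesis .
  qed
  ultimately show ?thesis by blast
qed

section \<open>The density theorem for irreducible matrix representations\<close>

lemma mat_repD:
  assumes "mat_rep smul \<phi> n \<rho>"
  shows rep_carrier: "\<rho> x \<in> carrier_mat n n" and rep_one: "\<rho> 1 = 1\<^sub>m n"
    and rep_add: "\<rho> (x + y) = \<rho> x + \<rho> y" and rep_mult: "\<rho> (x * y) = \<rho> x * \<rho> y"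
    and rep_smul: "\<rho> (smul a x) = \<phi> a \<cdot>\<^sub>m \<rho> x"
  using assms unfolding mat_rep_def by blast+

lemma rep_dims: "mat_rep smul \<phi> n \<rho> \<Longrightarrow> dim_row (\<rho> x) = n \<and> dim_col (\<rho> x) = n"
  using rep_carrier by blast

lemma rep_diff:
  assumes "mat_rep smul \<phi> n \<rho>"
  shows "\<rho> (x - y) = \<rho> x - \<rho> y"
proof -
  have "\<rho> x = \<rho> (x - y) + \<rho> y" using rep_add[OF assms, of "x - y" y] by simp
  then show ?thesis using rep_carrier[OF assms] by (auto intro!: eq_matI simp: rep_dims[OF assms])
qed

lemma rep_zero:
  assumes "mat_rep smul \<phi> n \<rho>"
  shows "\<rho> 0 = 0\<^sub>m n n"
  using rep_diff[OF assms, of 0 0] rep_carrier[OF assms, of 0] by (auto intro!: eq_matI simp: rep_dims[OF assms])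

lemma stable_subspace_iff:
  "stable_subspace n (\<rho> :: 'r \<Rightarrow> 'k::field mat) W \<longleftrightarrow>
    W \<subseteq> carrier_vec n \<and> 0\<^sub>v n \<in> W \<and> (\<forall>v\<in>W. \<forall>w\<in>W. v + w \<in> W) \<and>
    (\<forall>c. \<forall>v\<in>W. c \<cdot>\<^sub>v v \<in> W) \<and> (\<forall>x. \<forall>w\<in>W. \<rho> x *\<^sub>v w \<in> W)"
proof -
  have vs: "vectorspace (class_ring :: 'k ring) (module_vec TYPE('k) n)" by (rule vec_vs)
  then have "Module.module (class_ring :: 'k ring) (module_vec TYPE('k) n)" by (rule vectorspace.axioms)
  then show ?thesis
    unfolding stable_subspace_def subspace_def submodule_def using vs
    by (auto simp: module_vec_def)
qed

definition elem_mat :: "nat \<Rightarrow> nat \<Rightarrow> nat \<Rightarrow> 'a::zero_neq_one mat" where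
  "elem_mat n i j = mat n n (\<lambda>(p, q). if p = i \<and> q = j then 1 else 0)"

lemma elem_mat_carrier [simp]: "elem_mat n i j \<in> carrier_mat n n"
  and elem_mat_dims [simp]: "dim_row (elem_mat n i j) = n" "dim_col (elem_mat n i j) = n"
  and elem_mat_index [simp]: "p < n \<Longrightarrow> q < n \<Longrightarrow> elem_mat n i j $$ (p, q) = (if p = i \<and> q = j then 1 else 0)"
  unfolding elem_mat_def by auto

lemma index_mult_unit_vec:
  assumes "A \<in> carrier_mat m n" "i < m" "j < n"
  shows "(A *\<^sub>v unit_vec n j) $ i = (A $$ (i, j) :: 'a::comm_ring_1)"
proof -
  have "(A *\<^sub>v unit_vec n j) $ i = (\<Sum>k<n. A $$ (i, k) * (if k = j then 1 else 0))"
    using assms by (auto simp: scalar_prod_def atLeast0LessThan unit_vec_def intro!: sum.cong)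
  then show ?thesis using assms by (simp add: if_distrib cong: if_cong)
qed

lemma smult_mat_mult_vec:
  assumes "A \<in> carrier_mat m n" "v \<in> carrier_vec n"
  shows "(c \<cdot>\<^sub>m A) *\<^sub>v v = c \<cdot>\<^sub>v (A *\<^sub>v (v :: 'a::comm_ring_1 vec))"
  using assms by (intro eq_vecI) (auto simp: scalar_prod_def sum_distrib_left mult.assoc)

lemma eq_mat_by_vec:
  fixes A :: "'a::comm_ring_1 mat"
  assumes "A \<in> carrier_mat m n" "B \<in> carrier_mat m n"
    and "\<And>v. v \<in> carrier_vec n \<Longrightarrow> A *\<^sub>v v = B *\<^sub>v v"
  shows "A = B"
proof (rule eq_matI)
  fix i j assume "i < dim_row B" "j < dim_col B"
  then have ij: "i < m" "j < n" using assms by auto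
  have "(A *\<^sub>v unit_vec n j) $ i = (B *\<^sub>v unit_vec n j) $ i" using assms(3) by simp
  then show "A $$ (i, j) = B $$ (i, j)"
    unfolding index_mult_unit_vec[OF assms(1) ij] index_mult_unit_vec[OF assms(2) ij] .
qed (use assms in auto)

text \<open>
  The homomorphisms in the density theorem arise as maps on vectors, while Schur's lemma is about matrices.
\<close>

lemma linear_map_matrix:
  fixes f :: "'k::comm_ring_1 vec \<Rightarrow> 'k vec"
  assumes car: "\<And>v. v \<in> carrier_vec n \<Longrightarrow> f v \<in> carrier_vec m"
    and add: "\<And>v w. v \<in> carrier_vec n \<Longrightarrow> w \<in> carrier_vec n \<Longrightarrow> f (v + w) = f v + f w"
    and sm: "\<And>c v. v \<in> carrier_vec n \<Longrightarrow> f (c \<cdot>\<^sub>v v) = c \<cdot>\<^sub>v f v"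
  obtains M where "M \<in> carrier_mat m n" "\<And>v. v \<in> carrier_vec n \<Longrightarrow> f v = M *\<^sub>v v"
proof
  let ?M = "mat m n (\<lambda>(i, j). f (unit_vec n j) $ i)"
  show M: "?M \<in> carrier_mat m n" by simp
  fix v :: "'k vec" assume v: "v \<in> carrier_vec n"
  have z: "f (0\<^sub>v n) = 0\<^sub>v m"
  proof -
    have "f (0 \<cdot>\<^sub>v 0\<^sub>v n) = 0 \<cdot>\<^sub>v f (0\<^sub>v n)" by (rule sm) simp
    moreover have "0 \<cdot>\<^sub>v 0\<^sub>v n = (0\<^sub>v n :: 'k vec)" by auto
    ultimately have "f (0\<^sub>v n) = 0 \<cdot>\<^sub>v f (0\<^sub>v n)" by simp
    moreover have "0 \<cdot>\<^sub>v f (0\<^sub>v n) = 0\<^sub>v m" using car[of "0\<^sub>v n"] by auto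
    ultimately show ?thesis by simp
  qed
  \<comment> \<open>The first \<open>k\<close> coordinates are treated by induction on \<open>k\<close>.\<close>
  have "f (vec n (\<lambda>i. if i < k then v $ i else 0)) $ p = (\<Sum>j<k. v $ j * f (unit_vec n j) $ p)"
    if "k \<le> n" "p < m" for k p
    using that(1)
  proof (induction k)
    case 0
    have "vec n (\<lambda>i. if i < 0 then v $ i else 0) = 0\<^sub>v n" by auto
    then show ?case using z that by simp
  next
    case (Suc k)
    let ?w = "vec n (\<lambda>i. if i < k then v $ i else 0)"
    have "vec n (\<lambda>i. if i < Suc k then v $ i else 0) = ?w + v $ k \<cdot>\<^sub>v unit_vec n k"
      using Suc.prems by (auto simp: less_Suc_eq)
    then have "f (vec n (\<lambda>i. if i < Suc k then v $ i else 0)) = f ?w + v $ k \<cdot>\<^sub>v f (unit_vec n k)"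
      by (simp add: add sm)
    then show ?case using Suc that(2) car[of "unit_vec n k"] by simp
  qed
  from this[of n] have coord: "f v $ p = (\<Sum>j<n. v $ j * f (unit_vec n j) $ p)" if "p < m" for p
  proof -
    have "vec n (\<lambda>i. if i < n then v $ i else 0) = v" using v by auto
    then show ?thesis using \<open>\<And>p. n \<le> n \<Longrightarrow> p < m \<Longrightarrow> _ p\<close>[of p] that by simp
  qed
  show "f v = ?M *\<^sub>v v"
  proof (rule eq_vecI)
    show "dim_vec (f v) = dim_vec (?M *\<^sub>v v)" using car[OF v] by simp
    fix p assume "p < dim_vec (?M *\<^sub>v v)"
    then have p: "p < m" by simp
    then show "f v $ p = (?M *\<^sub>v v) $ p"
      unfolding coord[OF p] using v
      by (auto simp: scalar_prod_def atLeast0LessThan mult.commute intro!: sum.cong)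
  qed
qed

text \<open>
  Pairwise non-isomorphic irreducible representations with scalar endomorphisms only: the situation of
  the Jacobson density theorem.
\<close>

locale schur_family =
  fixes smul :: "'a::comm_ring_1 \<Rightarrow> 'r::ring_1 \<Rightarrow> 'r" and \<pi> :: "'a \<Rightarrow> 'f::field"
    and d :: "'b \<Rightarrow> nat" and \<rho> :: "'b \<Rightarrow> 'r \<Rightarrow> 'f mat" and B :: "'b set"
  assumes rep: "b \<in> B \<Longrightarrow> mat_rep smul \<pi> (d b) (\<rho> b)"
    and surj: "surj \<pi>"
    and irr: "b \<in> B \<Longrightarrow> irreducible_rep (d b) (\<rho> b)"
    and schur_same: "\<And>b M. b \<in> B \<Longrightarrow> M \<in> carrier_mat (d b) (d b) \<Longrightarrow>
        (\<And>x. M * \<rho> b x = \<rho> b x * M) \<Longrightarrow> \<exists>c. M = c \<cdot>\<^sub>m 1\<^sub>m (d b)"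
    and schur_diff: "\<And>b c M. b \<in> B \<Longrightarrow> c \<in> B \<Longrightarrow> b \<noteq> c \<Longrightarrow> M \<in> carrier_mat (d c) (d b) \<Longrightarrow>
        (\<And>x. M * \<rho> b x = \<rho> c x * M) \<Longrightarrow> M = 0\<^sub>m (d c) (d b)"
begin

definition killing :: "('b \<times> nat) set \<Rightarrow> 'r set" where
  "killing J = {x. \<forall>(b, i)\<in>J. \<rho> b x *\<^sub>v unit_vec (d b) i = 0\<^sub>v (d b)}"

lemma act_add: "b \<in> B \<Longrightarrow> v \<in> carrier_vec (d b) \<Longrightarrow> \<rho> b (x + y) *\<^sub>v v = \<rho> b x *\<^sub>v v + \<rho> b y *\<^sub>v v"
  by (simp add: rep_add[OF rep] add_mult_distrib_mat_vec[OF rep_carrier[OF rep] rep_carrier[OF rep]])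

lemma act_diff: "b \<in> B \<Longrightarrow> v \<in> carrier_vec (d b) \<Longrightarrow> \<rho> b (x - y) *\<^sub>v v = \<rho> b x *\<^sub>v v - \<rho> b y *\<^sub>v v"
  by (simp add: rep_diff[OF rep] minus_mult_distrib_mat_vec[OF rep_carrier[OF rep] rep_carrier[OF rep]])

lemma act_mult: "b \<in> B \<Longrightarrow> v \<in> carrier_vec (d b) \<Longrightarrow> \<rho> b (x * y) *\<^sub>v v = \<rho> b x *\<^sub>v (\<rho> b y *\<^sub>v v)"
  by (simp add: rep_mult[OF rep] assoc_mult_mat_vec[OF rep_carrier[OF rep] rep_carrier[OF rep]])

lemma act_smul: "b \<in> B \<Longrightarrow> v \<in> carrier_vec (d b) \<Longrightarrow> \<rho> b (smul a x) *\<^sub>v v = \<pi> a \<cdot>\<^sub>v (\<rho> b x *\<^sub>v v)"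
  by (simp add: rep_smul[OF rep] smult_mat_mult_vec[OF rep_carrier[OF rep]])

lemma act_carrier: "b \<in> B \<Longrightarrow> v \<in> carrier_vec (d b) \<Longrightarrow> \<rho> b x *\<^sub>v v \<in> carrier_vec (d b)"
  by (rule mult_mat_vec_carrier[OF rep_carrier[OF rep]])

lemma killing_closed:
  assumes J: "J \<subseteq> B \<times> UNIV"
  shows "x \<in> killing J \<Longrightarrow> y \<in> killing J \<Longrightarrow> x + y \<in> killing J"
    and "x \<in> killing J \<Longrightarrow> y \<in> killing J \<Longrightarrow> x - y \<in> killing J"
    and "x \<in> killing J \<Longrightarrow> smul a x \<in> killing J"
    and "x \<in> killing J \<Longrightarrow> y * x \<in> killing J"
proof -
  have b: "b \<in> B" if "(b, i) \<in> J" for b i using that J by auto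
  have z: "\<rho> b x *\<^sub>v 0\<^sub>v (d b) = 0\<^sub>v (d b)" if "b \<in> B" for b x
    using mult_mat_vec_carrier[OF rep_carrier[OF rep[OF that]], of "0\<^sub>v (d b)" x]
    by (intro eq_vecI) (use rep_dims[OF rep[OF that]] in \<open>auto simp: scalar_prod_def\<close>)
  show "x \<in> killing J \<Longrightarrow> y \<in> killing J \<Longrightarrow> x + y \<in> killing J"
    "x \<in> killing J \<Longrightarrow> y \<in> killing J \<Longrightarrow> x - y \<in> killing J"
    "x \<in> killing J \<Longrightarrow> smul a x \<in> killing J"
    "x \<in> killing J \<Longrightarrow> y * x \<in> killing J"
    unfolding killing_def
    by (fastforce simp: b act_add act_diff act_smul act_mult z)+
qed

text \<open>
  The images \<open>y v\<close> with \<open>y\<close> in the left ideal form a stable subspace, so irreducibility applies.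
\<close>

lemma killing_moves:
  assumes J: "J \<subseteq> B \<times> UNIV" and b: "b \<in> B"
    and x: "x \<in> killing J" "\<rho> b x *\<^sub>v v \<noteq> 0\<^sub>v (d b)" and v: "v \<in> carrier_vec (d b)"
    and u: "u \<in> carrier_vec (d b)"
  shows "\<exists>y\<in>killing J. \<rho> b y *\<^sub>v v = u"
proof -
  let ?W = "{\<rho> b y *\<^sub>v v | y. y \<in> killing J}"
  have "stable_subspace (d b) (\<rho> b) ?W"
    unfolding stable_subspace_iff
  proof (intro conjI ballI allI)
    show "?W \<subseteq> carrier_vec (d b)" using act_carrier[OF b v] by auto
    have "x - x \<in> killing J" using killing_closed(2)[OF J x(1) x(1)] .
    moreover have "\<rho> b (x - x) *\<^sub>v v = 0\<^sub>v (d b)" unfolding act_diff[OF b v]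
      using act_carrier[OF b v] by simp
    ultimately show "0\<^sub>v (d b) \<in> ?W" by (metis (mono_tags, lifting) mem_Collect_eq)
  next
    fix w w' assume "w \<in> ?W" "w' \<in> ?W"
    then obtain y y' where "w = \<rho> b y *\<^sub>v v" "w' = \<rho> b y' *\<^sub>v v" "y \<in> killing J" "y' \<in> killing J" by blast
    then have "w + w' = \<rho> b (y + y') *\<^sub>v v" "y + y' \<in> killing J"
      using killing_closed(1)[OF J] by (auto simp: act_add[OF b v])
    then show "w + w' \<in> ?W" by blast
  next
    fix c w assume "w \<in> ?W"
    then obtain y where y: "w = \<rho> b y *\<^sub>v v" "y \<in> killing J" by blast
    obtain a where "c = \<pi> a" using surj by (metis surjD)
    then have "c \<cdot>\<^sub>v w = \<rho> b (smul a y) *\<^sub>v v" "smul a y \<in> killing J"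
      using y killing_closed(3)[OF J] by (auto simp: act_smul[OF b v])
    then show "c \<cdot>\<^sub>v w \<in> ?W" by blast
  next
    fix z w assume "w \<in> ?W"
    then obtain y where y: "w = \<rho> b y *\<^sub>v v" "y \<in> killing J" by blast
    then have "\<rho> b z *\<^sub>v w = \<rho> b (z * y) *\<^sub>v v" "z * y \<in> killing J"
      using killing_closed(4)[OF J] by (auto simp: act_mult[OF b v])
    then show "\<rho> b z *\<^sub>v w \<in> ?W" by blast
  qed
  then have "?W = {0\<^sub>v (d b)} \<or> ?W = carrier_vec (d b)" using irr[OF b] unfolding irreducible_rep_def by blast
  moreover have "\<rho> b x *\<^sub>v v \<in> ?W" using x by blast
  ultimately have "?W = carrier_vec (d b)" using x(2) by auto
  then have "u \<in> ?W" using u by simp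
  then show ?thesis by blast
qed

text \<open>
  Induction on \<open>J\<close>. When an index \<open>(b, q)\<close> is added and \<open>v\<close> is annihilated, the assignment
  \<open>x e\<^sub>q \<mapsto> x v\<close> defines a homomorphism between two members of the family. Schur's lemma makes it zero
  or a scalar \<open>l\<close>, and the induction hypothesis applies to \<open>v\<close> or to \<open>v - l e\<^sub>q\<close>.
\<close>

lemma killing_annihilates:
  fixes v :: "'f vec"
  assumes "finite J" "J \<subseteq> Sigma B (\<lambda>b. {..<d b})"
    and "c \<in> B" "v \<in> carrier_vec (d c)"
    and "\<And>x. x \<in> killing J \<Longrightarrow> \<rho> c x *\<^sub>v v = 0\<^sub>v (d c)"
    and "k < d c" "(c, k) \<notin> J"
  shows "v $ k = 0"
  using assms
proof (induction J arbitrary: c v k rule: finite_induct)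
  case empty
  have "\<rho> c 1 *\<^sub>v v = 0\<^sub>v (d c)" by (rule empty.prems(4)) (simp add: killing_def)
  then show ?case using empty.prems by (simp add: rep_one[OF rep])
next
  case (insert bq J)
  obtain b q where bq: "bq = (b, q)" by force
  have b: "b \<in> B" and q: "q < d b" and JS: "J \<subseteq> Sigma B (\<lambda>b. {..<d b})" and J: "J \<subseteq> B \<times> UNIV"
    using insert.prems(1) unfolding bq by auto
  have c: "c \<in> B" and v: "v \<in> carrier_vec (d c)" by fact+
  let ?e = "unit_vec (d b) q"
  have e: "?e \<in> carrier_vec (d b)" by simp
  have "\<exists>x\<in>killing J. \<rho> b x *\<^sub>v ?e \<noteq> 0\<^sub>v (d b)"
    using insert.IH[OF JS b e _ q] insert.hyps(2) q unfolding bq by fastforce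
  then obtain x0 where x0: "x0 \<in> killing J" "\<rho> b x0 *\<^sub>v ?e \<noteq> 0\<^sub>v (d b)" by blast
  have "\<forall>u\<in>carrier_vec (d b). \<exists>y\<in>killing J. \<rho> b y *\<^sub>v ?e = u"
    using killing_moves[OF J b x0 e] by blast
  then obtain g where g: "\<And>u. u \<in> carrier_vec (d b) \<Longrightarrow> g u \<in> killing J"
    "\<And>u. u \<in> carrier_vec (d b) \<Longrightarrow> \<rho> b (g u) *\<^sub>v ?e = u" by metis
  define \<theta> where "\<theta> u = \<rho> c (g u) *\<^sub>v v" for u
  \<comment> \<open>\<open>x e\<^sub>q \<mapsto> x v\<close> is well defined on \<open>killing J\<close>.\<close>
  have \<theta>: "\<rho> c x *\<^sub>v v = \<theta> (\<rho> b x *\<^sub>v ?e)" if x: "x \<in> killing J" for x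
  proof -
    let ?u = "\<rho> b x *\<^sub>v ?e"
    have u: "?u \<in> carrier_vec (d b)" by (rule act_carrier[OF b e])
    have "x - g ?u \<in> killing J" by (rule killing_closed(2)[OF J x g(1)[OF u]])
    moreover have "\<rho> b (x - g ?u) *\<^sub>v ?e = 0\<^sub>v (d b)"
      unfolding act_diff[OF b e] g(2)[OF u] using u by simp
    ultimately have "x - g ?u \<in> killing (insert bq J)" unfolding killing_def bq by simp
    then have "\<rho> c (x - g ?u) *\<^sub>v v = 0\<^sub>v (d c)" by (rule insert.prems(4))
    then have eq: "\<rho> c x *\<^sub>v v - \<rho> c (g ?u) *\<^sub>v v = 0\<^sub>v (d c)" unfolding act_diff[OF c v] .
    have "(\<rho> c x *\<^sub>v v) $ i = (\<rho> c (g ?u) *\<^sub>v v) $ i" if "i < d c" for i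
      using arg_cong[OF eq, of "\<lambda>w. vec_index w i"] that act_carrier[OF c v, of "g ?u"]
        act_carrier[OF c v, of x] rep_dims[OF rep[OF c]] by (simp del: index_mult_mat_vec)
    then show ?thesis unfolding \<theta>_def
      by (intro eq_vecI) (simp_all add: rep_dims[OF rep[OF c]] del: index_mult_mat_vec)
  qed
  have \<theta>car: "\<theta> u \<in> carrier_vec (d c)" for u unfolding \<theta>_def by (rule act_carrier[OF c v])
  have \<theta>add: "\<theta> (u + w) = \<theta> u + \<theta> w" if "u \<in> carrier_vec (d b)" "w \<in> carrier_vec (d b)" for u w
    using \<theta>[OF killing_closed(1)[OF J g(1)[OF that(1)] g(1)[OF that(2)]]]
    unfolding act_add[OF c v] act_add[OF b e] g(2)[OF that(1)] g(2)[OF that(2)] \<theta>_def ..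
  have \<theta>sm: "\<theta> (l \<cdot>\<^sub>v u) = l \<cdot>\<^sub>v \<theta> u" if "u \<in> carrier_vec (d b)" for u l
  proof -
    obtain a where a: "l = \<pi> a" using surj by (metis surjD)
    show ?thesis using \<theta>[OF killing_closed(3)[OF J g(1)[OF that], of a]]
      unfolding act_smul[OF c v] act_smul[OF b e] g(2)[OF that] \<theta>_def a ..
  qed
  have \<theta>act: "\<theta> (\<rho> b y *\<^sub>v u) = \<rho> c y *\<^sub>v \<theta> u" if "u \<in> carrier_vec (d b)" for u y
    using \<theta>[OF killing_closed(4)[OF J g(1)[OF that], of y]]
    unfolding act_mult[OF c v] act_mult[OF b e] g(2)[OF that] \<theta>_def ..
  obtain M where M: "M \<in> carrier_mat (d c) (d b)" "\<And>u. u \<in> carrier_vec (d b) \<Longrightarrow> \<theta> u = M *\<^sub>v u"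
    using linear_map_matrix[of "d b" \<theta> "d c"] \<theta>car \<theta>add \<theta>sm by blast
  have comm: "M * \<rho> b y = \<rho> c y * M" for y
  proof (rule eq_mat_by_vec)
    show "M * \<rho> b y \<in> carrier_mat (d c) (d b)" by (rule mult_carrier_mat[OF M(1) rep_carrier[OF rep[OF b]]])
    show "\<rho> c y * M \<in> carrier_mat (d c) (d b)" by (rule mult_carrier_mat[OF rep_carrier[OF rep[OF c]] M(1)])
    fix u :: "'f vec" assume u: "u \<in> carrier_vec (d b)"
    show "(M * \<rho> b y) *\<^sub>v u = (\<rho> c y * M) *\<^sub>v u"
      unfolding assoc_mult_mat_vec[OF M(1) rep_carrier[OF rep[OF b]] u]
        assoc_mult_mat_vec[OF rep_carrier[OF rep[OF c]] M(1) u]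
      using \<theta>act[OF u] M(2)[OF u] M(2)[OF act_carrier[OF b u]] by simp
  qed
  show ?case
  proof (cases "b = c")
    case False
    have "M = 0\<^sub>m (d c) (d b)" by (rule schur_diff[OF b c False M(1) comm])
    then have "\<theta> u = 0\<^sub>v (d c)" if "u \<in> carrier_vec (d b)" for u
      using M(2)[OF that] that by auto
    then have "\<rho> c x *\<^sub>v v = 0\<^sub>v (d c)" if "x \<in> killing J" for x
      using \<theta>[OF that] act_carrier[OF b e] by simp
    then show ?thesis using insert.IH[OF JS c v] insert.prems by blast
  next
    case True
    obtain l where l: "M = l \<cdot>\<^sub>m 1\<^sub>m (d b)" using schur_same[OF b, of M] M(1) comm True by blast
    let ?v = "v - l \<cdot>\<^sub>v ?e"
    have v': "?v \<in> carrier_vec (d c)" using v True by simp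
    have "\<rho> c x *\<^sub>v ?v = 0\<^sub>v (d c)" if x: "x \<in> killing J" for x
    proof -
      have "\<rho> c x *\<^sub>v v = l \<cdot>\<^sub>v (\<rho> c x *\<^sub>v ?e)"
        using \<theta>[OF x] M(2)[OF act_carrier[OF b e, of x]] act_carrier[OF b e, of x] True
        unfolding l by (simp add: smult_mat_mult_vec[of _ "d b" "d b"])
      moreover have "\<rho> c x *\<^sub>v ?v = \<rho> c x *\<^sub>v v - l \<cdot>\<^sub>v (\<rho> c x *\<^sub>v ?e)"
        using mult_minus_distrib_mat_vec[OF rep_carrier[OF rep[OF c]] v, of "l \<cdot>\<^sub>v ?e" x]
          mult_mat_vec[OF rep_carrier[OF rep[OF c], of x], of ?e l] True e by simp
      ultimately show ?thesis using act_carrier[OF c v, of x] by simp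
    qed
    then have "?v $ k = 0" using insert.IH[OF JS c v'] insert.prems by blast
    then show ?thesis using insert.prems True v unfolding bq by (auto simp: unit_vec_def split: if_splits)
  qed
qed

text \<open>
  Take for \<open>J\<close> all indices but \<open>(b, j)\<close>: some element kills all other basis vectors but not this
  one, and by irreducibility it can be arranged to send it to any given basis vector.
\<close>

theorem density:
  assumes fin: "finite B" and b: "b \<in> B" and ij: "i < d b" "j < d b"
  shows "\<exists>x. \<rho> b x = elem_mat (d b) i j \<and> (\<forall>c\<in>B. c \<noteq> b \<longrightarrow> \<rho> c x = 0\<^sub>m (d c) (d c))"
proof -
  let ?J = "Sigma B (\<lambda>b. {..<d b}) - {(b, j)}"
  have J: "finite ?J" "?J \<subseteq> Sigma B (\<lambda>b. {..<d b})" "?J \<subseteq> B \<times> UNIV" using fin by auto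
  have e: "unit_vec (d b) k \<in> carrier_vec (d b)" for k by simp
  have "\<exists>x\<in>killing ?J. \<rho> b x *\<^sub>v unit_vec (d b) j \<noteq> 0\<^sub>v (d b)"
    using killing_annihilates[OF J(1,2) b e _ ij(2), of j] ij by fastforce
  then obtain x0 where x0: "x0 \<in> killing ?J" "\<rho> b x0 *\<^sub>v unit_vec (d b) j \<noteq> 0\<^sub>v (d b)" by blast
  obtain x where x: "x \<in> killing ?J" "\<rho> b x *\<^sub>v unit_vec (d b) j = unit_vec (d b) i"
    using killing_moves[OF J(3) b x0 e e, of i] by blast
  have kill: "\<rho> c x *\<^sub>v unit_vec (d c) k = 0\<^sub>v (d c)" if "c \<in> B" "k < d c" "(c, k) \<noteq> (b, j)" for c k
    using x(1) that unfolding killing_def by blast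
  have col: "\<rho> c x $$ (p, q) = (\<rho> c x *\<^sub>v unit_vec (d c) q) $ p" if "c \<in> B" "p < d c" "q < d c" for c p q
    using index_mult_unit_vec[OF rep_carrier[OF rep[OF that(1)]] that(2,3)] by simp
  have "\<rho> b x = elem_mat (d b) i j"
  proof (rule eq_matI)
    fix p q assume "p < dim_row (elem_mat (d b) i j :: 'f mat)" "q < dim_col (elem_mat (d b) i j :: 'f mat)"
    then have "p < d b" "q < d b" by auto
    then show "\<rho> b x $$ (p, q) = elem_mat (d b) i j $$ (p, q)"
      using col[OF b] kill[OF b] x(2) by (cases "q = j") (auto simp: unit_vec_def)
  qed (use rep_dims[OF rep[OF b]] in auto)
  moreover have "\<rho> c x = 0\<^sub>m (d c) (d c)" if c: "c \<in> B" "c \<noteq> b" for c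
    by (rule eq_matI) (use rep_dims[OF rep[OF c(1)]] col[OF c(1)] kill[OF c(1)] c(2) in auto)
  ultimately show ?thesis by blast
qed

end

section \<open>Schur's lemma\<close>

text \<open>
  A projection of the algebraic closure onto the base field: it carries linear algebra over the closure
  back to the base field.
\<close>

lemma ex_functional_alg_closure:
  "\<exists>l :: 'f::field alg_closure \<Rightarrow> 'f. (\<forall>a b. l (a + b) = l a + l b) \<and>
     (\<forall>c a. l (to_ac c * a) = c * l a) \<and> l 1 = 1"
proof -
  interpret V: vector_space_pair "\<lambda>(c::'f) (a::'f alg_closure). to_ac c * a" "(*) :: 'f \<Rightarrow> 'f \<Rightarrow> 'f"
    by unfold_locales (auto simp: algebra_simps)
  have "V.vs1.independent {1}" by simp
  from V.linear_independent_extend[OF this, of "\<lambda>_. 1"] obtain l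
    where l: "Vector_Spaces.linear (\<lambda>(c::'f) (a::'f alg_closure). to_ac c * a) (*) l" "l 1 = 1" by auto
  interpret L: Vector_Spaces.linear "\<lambda>(c::'f) (a::'f alg_closure). to_ac c * a" "(*)" l by (rule l(1))
  show ?thesis using L.add L.scale l(2) by blast
qed

text \<open>
  A stable subspace \<open>W\<close> over the base field is extended to the closure as the set of vectors that all
  linear functionals from the closure to the base field map into \<open>W\<close> (coordinatewise). This is stable, and the
  functional fixing 1 shows that it is proper and nonzero if \<open>W\<close> is.
\<close>

lemma irreducible_of_absolutely_irreducible:
  assumes rep: "mat_rep smul \<pi> n \<rho>" and abs: "absolutely_irreducible_rep n \<rho>"
  shows "irreducible_rep n (\<rho> :: 'r::ring_1 \<Rightarrow> 'f::field mat)"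
proof -
  let ?K = "\<lambda>x. map_mat to_ac (\<rho> x)"
  have n: "n > 0" and irr: "\<And>W. stable_subspace n ?K W \<Longrightarrow> W = {0\<^sub>v n} \<or> W = carrier_vec n"
    using abs unfolding absolutely_irreducible_rep_def irreducible_rep_def by auto
  have car: "\<rho> x \<in> carrier_mat n n" for x by (rule rep_carrier[OF rep])
  have "W = {0\<^sub>v n} \<or> W = carrier_vec n" if W: "stable_subspace n \<rho> W" for W
  proof (rule ccontr)
    assume neg: "\<not> (W = {0\<^sub>v n} \<or> W = carrier_vec n)"
    have sub: "W \<subseteq> carrier_vec n" and z: "0\<^sub>v n \<in> W" and add: "\<And>v w. v \<in> W \<Longrightarrow> w \<in> W \<Longrightarrow> v + w \<in> W"
      and sc: "\<And>c v. v \<in> W \<Longrightarrow> c \<cdot>\<^sub>v v \<in> W" and act: "\<And>x w. w \<in> W \<Longrightarrow> \<rho> x *\<^sub>v w \<in> W"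
      using W unfolding stable_subspace_iff by auto
    obtain w where w: "w \<in> W" "w \<noteq> 0\<^sub>v n" using neg z by blast
    obtain w0 where w0: "w0 \<in> carrier_vec n" "w0 \<notin> W" using neg sub by blast
    define functional where "functional l \<longleftrightarrow> (\<forall>a b. l (a + b) = l a + l b) \<and> (\<forall>c a. l (to_ac c * a) = c * l a)"
      for l :: "'f alg_closure \<Rightarrow> 'f"
    define WK where "WK = {v \<in> carrier_vec n. \<forall>l. functional l \<longrightarrow> map_vec l v \<in> W}"
    have "stable_subspace n ?K WK"
      unfolding stable_subspace_iff
    proof (intro conjI ballI allI)
      show "WK \<subseteq> carrier_vec n" unfolding WK_def by auto
      have "l 0 = 0" if "functional l" for l
        using that unfolding functional_def by (metis add_cancel_right_right add_0)
      then have "map_vec l (0\<^sub>v n) = 0\<^sub>v n" if "functional l" for l using that by auto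
      then show "0\<^sub>v n \<in> WK" unfolding WK_def using z by auto
    next
      fix v v' assume v: "v \<in> WK" "v' \<in> WK"
      have "map_vec l (v + v') = map_vec l v + map_vec l v'" if "functional l" for l
        using that v unfolding functional_def WK_def by auto
      then show "v + v' \<in> WK" using v add unfolding WK_def by auto
    next
      fix c v assume v: "v \<in> WK"
      have "map_vec l (c \<cdot>\<^sub>v v) \<in> W" if l: "functional l" for l
      proof -
        have "functional (\<lambda>a. l (c * a))"
          using l unfolding functional_def
          by (simp only: distrib_left mult.left_commute[of c "to_ac _"]) simp
        moreover have "map_vec l (c \<cdot>\<^sub>v v) = map_vec (\<lambda>a. l (c * a)) v" by auto
        ultimately show ?thesis using v unfolding WK_def by simp
      qed
      then show "c \<cdot>\<^sub>v v \<in> WK" using v unfolding WK_def by auto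
    next
      fix x v assume v: "v \<in> WK"
      then have vc: "v \<in> carrier_vec n" unfolding WK_def by auto
      have "map_vec l (?K x *\<^sub>v v) = \<rho> x *\<^sub>v map_vec l v" if l: "functional l" for l
      proof (rule eq_vecI)
        fix i assume "i < dim_vec (\<rho> x *\<^sub>v map_vec l v)"
        then have i: "i < n" using car[of x] by simp
        have l0: "l 0 = 0" using l unfolding functional_def by (metis add_cancel_right_right add_0)
        have lsum: "l (sum f S) = (\<Sum>j\<in>S. l (f j))" for f and S :: "nat set"
          using l unfolding functional_def by (induction S rule: infinite_finite_induct) (auto simp: l0)
        have "vec_index (?K x *\<^sub>v v) i = (\<Sum>j<n. to_ac (\<rho> x $$ (i, j)) * vec_index v j)"
          using car[of x] vc i by (auto simp: scalar_prod_def atLeast0LessThan intro!: sum.cong)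
        then show "vec_index (map_vec l (?K x *\<^sub>v v)) i = vec_index (\<rho> x *\<^sub>v map_vec l v) i"
          using car[of x] vc i l unfolding functional_def
          by (auto simp: lsum scalar_prod_def atLeast0LessThan intro!: sum.cong)
      qed (use car[of x] in auto)
      then have "map_vec l (?K x *\<^sub>v v) \<in> W" if "functional l" for l
        using v act that unfolding WK_def by auto
      moreover have "?K x *\<^sub>v v \<in> carrier_vec n" using car[of x] by (intro carrier_vecI) simp
      ultimately show "?K x *\<^sub>v v \<in> WK" unfolding WK_def by auto
    qed
    then have "WK = {0\<^sub>v n} \<or> WK = carrier_vec n" by (rule irr)
    moreover have "map_vec to_ac w \<in> WK"
    proof -
      have "map_vec l (map_vec to_ac w) = l 1 \<cdot>\<^sub>v w" if "functional l" for l
      proof -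
        have "l (to_ac a) = l 1 * a" for a using that unfolding functional_def
          by (metis mult.commute mult.right_neutral)
        then show ?thesis by auto
      qed
      then show ?thesis using w sub sc unfolding WK_def by auto
    qed
    moreover have "map_vec to_ac w \<noteq> 0\<^sub>v n"
    proof
      assume "map_vec to_ac w = 0\<^sub>v n"
      then have "vec_index (map_vec to_ac w) i = 0" if "i < n" for i using that by simp
      then have "vec_index w i = 0" if "i < n" for i using that w sub by force
      moreover have "w \<in> carrier_vec n" using w sub by blast
      ultimately have "w = 0\<^sub>v n" by (intro eq_vecI) auto
      then show False using w by simp
    qed
    moreover have "map_vec to_ac w0 \<notin> WK"
    proof
      obtain l :: "'f alg_closure \<Rightarrow> 'f" where l: "functional l" "l 1 = 1"
        using ex_functional_alg_closure unfolding functional_def by blast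
      assume "map_vec to_ac w0 \<in> WK"
      then have "map_vec l (map_vec to_ac w0) \<in> W" using l unfolding WK_def by blast
      moreover have "l (to_ac a) = a" for a using l unfolding functional_def
        by (metis mult.right_neutral)
      then have "map_vec l (map_vec to_ac w0) = w0" by auto
      ultimately show False using w0 by simp
    qed
    ultimately show False using w0 by auto
  qed
  then show ?thesis unfolding irreducible_rep_def using n by blast
qed

text \<open>
  Over the algebraic closure there is an eigenvalue, and its eigenspace is stable, hence everything. The
  scalar lies in the base field because it is an entry of \<open>M\<close>.
\<close>

proposition schur_scalar:
  assumes rep: "mat_rep smul \<pi> n \<rho>" and abs: "absolutely_irreducible_rep n (\<rho> :: 'r::ring_1 \<Rightarrow> 'f::field mat)"
    and M: "M \<in> carrier_mat n n" and comm: "\<And>x. M * \<rho> x = \<rho> x * M"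
  shows "\<exists>c. M = c \<cdot>\<^sub>m 1\<^sub>m n"
proof -
  let ?K = "map_mat to_ac :: 'f mat \<Rightarrow> _"
  interpret ac: comm_ring_hom "to_ac :: 'f \<Rightarrow> 'f alg_closure" by unfold_locales auto
  have n: "n > 0" and irr: "\<And>W. stable_subspace n (\<lambda>x. ?K (\<rho> x)) W \<Longrightarrow> W = {0\<^sub>v n} \<or> W = carrier_vec n"
    using abs unfolding absolutely_irreducible_rep_def irreducible_rep_def by auto
  have car: "\<rho> x \<in> carrier_mat n n" for x by (rule rep_carrier[OF rep])
  have MK: "?K M \<in> carrier_mat n n" using M by simp
  have carK: "?K (\<rho> x) \<in> carrier_mat n n" for x using car by simp
  have commK: "?K M * ?K (\<rho> x) = ?K (\<rho> x) * ?K M" for x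
    using comm[of x] ac.mat_hom_mult[OF M car] ac.mat_hom_mult[OF car M] by metis
  have "degree (char_poly (?K M)) > 0" using degree_monic_char_poly[OF MK] n by simp
  then obtain c where "poly (char_poly (?K M)) c = 0" using alg_closed_imp_poly_has_root by blast
  then have "eigenvalue (?K M) c" using eigenvalue_root_char_poly[OF MK] by simp
  then obtain v where v: "v \<in> carrier_vec n" "v \<noteq> 0\<^sub>v n" "?K M *\<^sub>v v = c \<cdot>\<^sub>v v"
    unfolding eigenvalue_def eigenvector_def using MK by auto
  let ?W = "{v \<in> carrier_vec n. ?K M *\<^sub>v v = c \<cdot>\<^sub>v v}"
  have "stable_subspace n (\<lambda>x. ?K (\<rho> x)) ?W"
    unfolding stable_subspace_iff
  proof (intro conjI ballI allI)
    show "0\<^sub>v n \<in> ?W" using MK by (auto simp: scalar_prod_def intro!: eq_vecI)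
  next
    fix v w assume "v \<in> ?W" "w \<in> ?W"
    then show "v + w \<in> ?W" using mult_add_distrib_mat_vec[OF MK, of v w]
      smult_add_distrib_vec[of v n w c] by auto
  next
    fix a v assume "v \<in> ?W"
    then show "a \<cdot>\<^sub>v v \<in> ?W" using mult_mat_vec[OF MK, of v a]
      by (auto simp: smult_smult_assoc mult.commute)
  next
    fix x v assume v: "v \<in> ?W"
    then have vc: "v \<in> carrier_vec n" by simp
    have "?K M *\<^sub>v (?K (\<rho> x) *\<^sub>v v) = ?K (\<rho> x) *\<^sub>v (?K M *\<^sub>v v)"
      using commK[of x] assoc_mult_mat_vec[OF MK carK vc] assoc_mult_mat_vec[OF carK MK vc] by metis
    then show "?K (\<rho> x) *\<^sub>v v \<in> ?W" using v mult_mat_vec[OF carK[of x] vc, of c] carK[of x] by auto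
  qed auto
  then have "?W = {0\<^sub>v n} \<or> ?W = carrier_vec n" by (rule irr)
  then have all: "?K M *\<^sub>v v = c \<cdot>\<^sub>v v" if "v \<in> carrier_vec n" for v using v that by blast
  have entry: "to_ac (M $$ (i, j)) = (if i = j then c else 0)" if "i < n" "j < n" for i j
  proof -
    have "to_ac (M $$ (i, j)) = vec_index (?K M *\<^sub>v unit_vec n j) i"
      using index_mult_unit_vec[OF MK that] that M by simp
    also have "?K M *\<^sub>v unit_vec n j = c \<cdot>\<^sub>v unit_vec n j" by (rule all) simp
    finally show ?thesis using that by (simp add: unit_vec_def)
  qed
  obtain c0 where c0: "M $$ (0, 0) = c0" by blast
  have "c = to_ac c0" using entry[of 0 0] n c0 by simp
  then have "M $$ (i, j) = (if i = j then c0 else 0)" if "i < n" "j < n" for i j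
    using entry[OF that] by (metis to_ac_eq_iff to_ac_0)
  then have "M = c0 \<cdot>\<^sub>m 1\<^sub>m n" using M by (intro eq_matI) auto
  then show ?thesis by blast
qed

text \<open>
  Kernel and image of the intertwiner are stable, so it is bijective; the preimages of the basis
  vectors are the columns of its inverse.
\<close>

proposition schur_intertwiner:
  assumes rep1: "mat_rep smul \<pi> n1 (\<rho>1 :: 'r::ring_1 \<Rightarrow> 'f::field mat)" and irr1: "irreducible_rep n1 \<rho>1"
    and rep2: "mat_rep smul \<pi> n2 \<rho>2" and irr2: "irreducible_rep n2 \<rho>2"
    and M: "M \<in> carrier_mat n2 n1" and comm: "\<And>x. M * \<rho>1 x = \<rho>2 x * M"
    and nz: "M \<noteq> 0\<^sub>m n2 n1"
  shows "isomorphic_reps n1 \<rho>1 n2 \<rho>2"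
proof -
  have c1: "\<rho>1 x \<in> carrier_mat n1 n1" and c2: "\<rho>2 x \<in> carrier_mat n2 n2" for x
    using rep_carrier[OF rep1] rep_carrier[OF rep2] by auto
  have actM: "M *\<^sub>v (\<rho>1 x *\<^sub>v v) = \<rho>2 x *\<^sub>v (M *\<^sub>v v)" if "v \<in> carrier_vec n1" for x v
    using comm[of x] assoc_mult_mat_vec[OF M c1 that] assoc_mult_mat_vec[OF c2 M that] by metis
  have Mc: "M *\<^sub>v v \<in> carrier_vec n2" for v using M by (intro carrier_vecI) simp
  have z: "A *\<^sub>v 0\<^sub>v m = 0\<^sub>v k" if "A \<in> carrier_mat k m" for A :: "'f mat" and k m
    using that by (auto simp: scalar_prod_def intro!: eq_vecI)
  have notall: "\<not> (\<forall>v\<in>carrier_vec n1. M *\<^sub>v v = 0\<^sub>v n2)"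
  proof
    assume *: "\<forall>v\<in>carrier_vec n1. M *\<^sub>v v = 0\<^sub>v n2"
    have "M = 0\<^sub>m n2 n1" by (rule eq_mat_by_vec[OF M]) (use * in auto)
    then show False using nz by simp
  qed
  let ?Ker = "{v \<in> carrier_vec n1. M *\<^sub>v v = 0\<^sub>v n2}"
  have "stable_subspace n1 \<rho>1 ?Ker"
    unfolding stable_subspace_iff
  proof (intro conjI ballI allI)
    show "0\<^sub>v n1 \<in> ?Ker" using z[OF M] by simp
  next
    fix v w assume "v \<in> ?Ker" "w \<in> ?Ker"
    then show "v + w \<in> ?Ker" using mult_add_distrib_mat_vec[OF M, of v w] by auto
  next
    fix a v assume "v \<in> ?Ker"
    then show "a \<cdot>\<^sub>v v \<in> ?Ker" using mult_mat_vec[OF M, of v a] by auto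
  next
    fix x v assume "v \<in> ?Ker"
    then show "\<rho>1 x *\<^sub>v v \<in> ?Ker" using actM[of v x] z[OF c2] c1[of x] by auto
  qed auto
  then have "?Ker = {0\<^sub>v n1} \<or> ?Ker = carrier_vec n1" using irr1 unfolding irreducible_rep_def by blast
  then have inj: "v = 0\<^sub>v n1" if "v \<in> carrier_vec n1" "M *\<^sub>v v = 0\<^sub>v n2" for v
    using notall that by blast
  let ?Im = "{M *\<^sub>v v | v. v \<in> carrier_vec n1}"
  have "stable_subspace n2 \<rho>2 ?Im"
    unfolding stable_subspace_iff
  proof (intro conjI ballI allI)
    show "?Im \<subseteq> carrier_vec n2" using Mc by auto
    have "0\<^sub>v n2 = M *\<^sub>v 0\<^sub>v n1" using z[OF M] by simp
    then show "0\<^sub>v n2 \<in> ?Im" using zero_carrier_vec by blast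
  next
    fix v w assume "v \<in> ?Im" "w \<in> ?Im"
    then obtain v' w' where "v = M *\<^sub>v v'" "w = M *\<^sub>v w'" "v' \<in> carrier_vec n1" "w' \<in> carrier_vec n1" by blast
    then have "v + w = M *\<^sub>v (v' + w')" "v' + w' \<in> carrier_vec n1"
      using mult_add_distrib_mat_vec[OF M, of v' w'] by auto
    then show "v + w \<in> ?Im" by blast
  next
    fix a v assume "v \<in> ?Im"
    then obtain v' where "v = M *\<^sub>v v'" "v' \<in> carrier_vec n1" by blast
    then have "a \<cdot>\<^sub>v v = M *\<^sub>v (a \<cdot>\<^sub>v v')" "a \<cdot>\<^sub>v v' \<in> carrier_vec n1"
      using mult_mat_vec[OF M, of v' a] by auto
    then show "a \<cdot>\<^sub>v v \<in> ?Im" by blast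
  next
    fix x v assume "v \<in> ?Im"
    then obtain v' where "v = M *\<^sub>v v'" "v' \<in> carrier_vec n1" by blast
    then have "\<rho>2 x *\<^sub>v v = M *\<^sub>v (\<rho>1 x *\<^sub>v v')" "\<rho>1 x *\<^sub>v v' \<in> carrier_vec n1"
      using actM[of v' x] c1[of x] by auto
    then show "\<rho>2 x *\<^sub>v v \<in> ?Im" by blast
  qed
  then have "?Im = {0\<^sub>v n2} \<or> ?Im = carrier_vec n2" using irr2 unfolding irreducible_rep_def by blast
  then have im: "?Im = carrier_vec n2" using notall by blast
  have "\<exists>v\<in>carrier_vec n1. M *\<^sub>v v = w" if "w \<in> carrier_vec n2" for w
  proof -
    have "w \<in> ?Im" unfolding im using that .
    then show ?thesis by blast
  qed
  then have "\<exists>v\<in>carrier_vec n1. M *\<^sub>v v = unit_vec n2 j" for j by simp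
  then obtain q where q: "\<And>j. q j \<in> carrier_vec n1" "\<And>j. M *\<^sub>v q j = unit_vec n2 j" by metis
  define Q where "Q = mat n1 n2 (\<lambda>(i, j). vec_index (q j) i)"
  have Q: "Q \<in> carrier_mat n1 n2" unfolding Q_def by simp
  have MQ: "M * Q = 1\<^sub>m n2"
  proof (rule eq_matI)
    fix i j assume "i < dim_row (1\<^sub>m n2 :: 'f mat)" "j < dim_col (1\<^sub>m n2 :: 'f mat)"
    then have ij: "i < n2" "j < n2" by auto
    have "(M * Q) $$ (i, j) = vec_index (M *\<^sub>v q j) i"
      using ij M q(1)[of j] by (auto simp: Q_def scalar_prod_def intro!: sum.cong)
    then show "(M * Q) $$ (i, j) = 1\<^sub>m n2 $$ (i, j)" unfolding q(2) using ij by (auto simp: unit_vec_def)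
  qed (use M Q in auto)
  have QM: "Q * M = 1\<^sub>m n1"
  proof (rule eq_mat_by_vec)
    show "Q * M \<in> carrier_mat n1 n1" using Q M by simp
    fix v :: "'f vec" assume v: "v \<in> carrier_vec n1"
    have u: "Q *\<^sub>v (M *\<^sub>v v) \<in> carrier_vec n1" using Q by (intro carrier_vecI) simp
    have "M *\<^sub>v (Q *\<^sub>v (M *\<^sub>v v)) = (M * Q) *\<^sub>v (M *\<^sub>v v)"
      using assoc_mult_mat_vec[OF M Q Mc] by simp
    also have "\<dots> = M *\<^sub>v v" unfolding MQ using Mc[of v] by simp
    finally have "M *\<^sub>v (Q *\<^sub>v (M *\<^sub>v v) - v) = 0\<^sub>v n2"
      using mult_minus_distrib_mat_vec[OF M u v] Mc[of v] by simp
    then have eq: "Q *\<^sub>v (M *\<^sub>v v) - v = 0\<^sub>v n1" using inj[of "Q *\<^sub>v (M *\<^sub>v v) - v"] u v by simp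
    have "vec_index (Q *\<^sub>v (M *\<^sub>v v)) i = vec_index v i" if "i < n1" for i
      using arg_cong[OF eq, of "\<lambda>w. vec_index w i"] that u v by (simp del: index_mult_mat_vec)
    then have "Q *\<^sub>v (M *\<^sub>v v) = v" using u v Q by (intro eq_vecI) (simp_all del: index_mult_mat_vec)
    then show "(Q * M) *\<^sub>v v = 1\<^sub>m n1 *\<^sub>v v" using assoc_mult_mat_vec[OF Q M v] v by simp
  qed simp
  show ?thesis unfolding isomorphic_reps_def using M Q MQ QM comm by blast
qed

lemma isomorphic_reps_sym:
  assumes iso: "isomorphic_reps n1 \<rho>1 n2 (\<rho>2 :: 'r \<Rightarrow> 'f::field mat)"
    and c1: "\<And>x. \<rho>1 x \<in> carrier_mat n1 n1" and c2: "\<And>x. \<rho>2 x \<in> carrier_mat n2 n2"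
  shows "isomorphic_reps n2 \<rho>2 n1 \<rho>1"
proof -
  obtain P Q where P: "P \<in> carrier_mat n2 n1" and Q: "Q \<in> carrier_mat n1 n2"
    and PQ: "P * Q = 1\<^sub>m n2" and QP: "Q * P = 1\<^sub>m n1" and comm: "\<And>x. P * \<rho>1 x = \<rho>2 x * P"
    using iso unfolding isomorphic_reps_def by blast
  have "Q * \<rho>2 x = \<rho>1 x * Q" for x
  proof -
    have "Q * \<rho>2 x = Q * \<rho>2 x * (P * Q)" unfolding PQ using right_mult_one_mat[OF mult_carrier_mat[OF Q c2]] by simp
    also have "\<dots> = Q * (\<rho>2 x * P) * Q"
      using assoc_mult_mat[OF mult_carrier_mat[OF Q c2] P Q] assoc_mult_mat[OF Q c2 P] by simp
    also have "\<dots> = Q * P * \<rho>1 x * Q"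
      unfolding comm[symmetric] using assoc_mult_mat[OF Q P c1] by simp
    also have "\<dots> = \<rho>1 x * Q" unfolding QP using c1[of x] by simp
    finally show ?thesis .
  qed
  then show ?thesis unfolding isomorphic_reps_def using P Q PQ QP by blast
qed

section \<open>The image of a non-split extension\<close>

lemma rep_sum_index:
  assumes rep: "mat_rep smul \<phi> n \<rho>" and "finite S" and "p < n" "q < n"
  shows "\<rho> (sum f S) $$ (p, q) = (\<Sum>i\<in>S. \<rho> (f i) $$ (p, q))"
  using assms(2)
  by (induction S rule: finite_induct)
    (simp_all add: rep_zero[OF rep] rep_add[OF rep] rep_dims[OF rep] assms(3,4))

text \<open>
  The image is closed under linear combinations, so it is enough to hit matrix units.
\<close>

lemma image_spanned_by_matrix_units:
  fixes \<rho> :: "'b \<Rightarrow> 'r::ring_1 \<Rightarrow> 'f::comm_ring_1 mat" and \<pi> :: "'a::comm_ring_1 \<Rightarrow> 'f"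
  assumes rep: "\<And>b. b \<in> B \<Longrightarrow> mat_rep smul \<pi> (d b) (\<rho> b)" and surj: "surj \<pi>"
    and fin: "finite I" and I: "I \<subseteq> (SIGMA b:B. {..<d b} \<times> {..<d b})"
    and unit: "\<And>b i j. (b, i, j) \<in> I \<Longrightarrow>
      \<exists>x. \<forall>c\<in>B. \<rho> c x = (if c = b then elem_mat (d c) i j else 0\<^sub>m (d c) (d c))"
    and A: "\<And>b. b \<in> B \<Longrightarrow> A b \<in> carrier_mat (d b) (d b)"
    and supp: "\<And>b i j. b \<in> B \<Longrightarrow> i < d b \<Longrightarrow> j < d b \<Longrightarrow> (b, i, j) \<notin> I \<Longrightarrow> A b $$ (i, j) = 0"
  shows "\<exists>x. \<forall>b\<in>B. \<rho> b x = A b"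
proof -
  have "\<forall>t\<in>I. \<exists>x. \<forall>c\<in>B. \<rho> c x = (if c = fst t then elem_mat (d c) (fst (snd t)) (snd (snd t)) else 0\<^sub>m (d c) (d c))"
    using unit by force
  then obtain e where e: "\<And>t c. t \<in> I \<Longrightarrow> c \<in> B \<Longrightarrow>
      \<rho> c (e t) = (if c = fst t then elem_mat (d c) (fst (snd t)) (snd (snd t)) else 0\<^sub>m (d c) (d c))"
    by metis
  have "\<exists>l. \<forall>c. \<pi> (l c) = c" using surj by (metis surjD)
  then obtain l where l: "\<And>c. \<pi> (l c) = c" by blast
  let ?x = "\<Sum>t\<in>I. smul (l (A (fst t) $$ (snd t))) (e t)"
  have "\<rho> c ?x = A c" if c: "c \<in> B" for c
  proof (rule eq_matI)
    fix p q assume "p < dim_row (A c)" "q < dim_col (A c)"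
    then have pq: "p < d c" "q < d c" using A[OF c] by auto
    have "\<rho> c ?x $$ (p, q) = (\<Sum>t\<in>I. \<rho> c (smul (l (A (fst t) $$ (snd t))) (e t)) $$ (p, q))"
      by (rule rep_sum_index[OF rep[OF c] fin pq])
    also have "\<dots> = (\<Sum>t\<in>I. if t = (c, p, q) then A c $$ (p, q) else 0)"
    proof (rule sum.cong[OF refl])
      fix t assume t: "t \<in> I"
      show "\<rho> c (smul (l (A (fst t) $$ (snd t))) (e t)) $$ (p, q) = (if t = (c, p, q) then A c $$ (p, q) else 0)"
        unfolding rep_smul[OF rep[OF c]] l e[OF t c] using pq by (cases t) auto
    qed
    also have "\<dots> = A c $$ (p, q)" using fin supp[OF c pq] by (simp add: sum.delta)
    finally show "\<rho> c ?x $$ (p, q) = A c $$ (p, q)" .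
  qed (use rep_dims[OF rep[OF c]] A[OF c] in auto)
  then show ?thesis by blast
qed

text \<open>
  Absolute irreducibility makes the endomorphisms scalar, so the density theorem applies to the pair and
  lifts all matrix units. This is the Burnside-Wedderburn theorem for two representations.
\<close>

proposition density_two_reps:
  fixes \<tau>1 \<tau>2 :: "'r::ring_1 \<Rightarrow> 'f::field mat"
  assumes surj: "surj \<pi>"
    and tau1: "mat_rep smul \<pi> n1 \<tau>1" "absolutely_irreducible_rep n1 \<tau>1"
    and tau2: "mat_rep smul \<pi> n2 \<tau>2" "absolutely_irreducible_rep n2 \<tau>2"
    and non_iso: "\<not> isomorphic_reps n1 \<tau>1 n2 \<tau>2"
    and A1: "A1 \<in> carrier_mat n1 n1" and A2: "A2 \<in> carrier_mat n2 n2"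
  shows "\<exists>x. \<tau>1 x = A1 \<and> \<tau>2 x = A2"
proof -
  let ?d = "\<lambda>b. if b then n1 else n2" and ?\<rho> = "\<lambda>b. if b then \<tau>1 else \<tau>2"
  have irr1: "irreducible_rep n1 \<tau>1" and irr2: "irreducible_rep n2 \<tau>2"
    using irreducible_of_absolutely_irreducible tau1 tau2 by blast+
  have non_iso': "\<not> isomorphic_reps n2 \<tau>2 n1 \<tau>1"
    using non_iso isomorphic_reps_sym[of n2 \<tau>2 n1 \<tau>1] rep_carrier[OF tau1(1)] rep_carrier[OF tau2(1)] by blast
  interpret schur_family smul \<pi> ?d ?\<rho> "UNIV :: bool set"
  proof
    show "mat_rep smul \<pi> (?d b) (?\<rho> b)" for b using tau1 tau2 by simp
    show "surj \<pi>" by fact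
    show "irreducible_rep (?d b) (?\<rho> b)" for b using irr1 irr2 by simp
    show "\<exists>c. M = c \<cdot>\<^sub>m 1\<^sub>m (?d b)"
      if "M \<in> carrier_mat (?d b) (?d b)" "\<And>x. M * ?\<rho> b x = ?\<rho> b x * M" for b M
      using schur_scalar[OF tau1, of M] schur_scalar[OF tau2, of M] that by (cases b) auto
    show "M = 0\<^sub>m (?d c) (?d b)"
      if "b \<noteq> c" "M \<in> carrier_mat (?d c) (?d b)" "\<And>x. M * ?\<rho> b x = ?\<rho> c x * M" for b c M
      using schur_intertwiner[OF tau1(1) irr1 tau2(1) irr2, of M]
        schur_intertwiner[OF tau2(1) irr2 tau1(1) irr1, of M] non_iso non_iso' that
      by (cases b; cases c) auto
  qed
  have "\<exists>x. \<forall>b\<in>UNIV. ?\<rho> b x = (\<lambda>b. if b then A1 else A2) b"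
  proof (rule image_spanned_by_matrix_units[where d = ?d and I = "SIGMA b:UNIV. {..<?d b} \<times> {..<?d b}"])
    show "mat_rep smul \<pi> (?d b) (?\<rho> b)" for b by (rule rep) simp
    show "\<exists>x. \<forall>c\<in>UNIV. ?\<rho> c x = (if c = b then elem_mat (?d c) i j else 0\<^sub>m (?d c) (?d c))"
      if "(b, i, j) \<in> (SIGMA b:UNIV. {..<?d b} \<times> {..<?d b})" for b i j
      using density[of b i j] that by auto
    show "(\<lambda>b. if b then A1 else A2) b \<in> carrier_mat (?d b) (?d b)" for b using A1 A2 by simp
  qed (use surj in auto)
  then show ?thesis by (metis UNIV_I)
qed

lemma append_vec_cases:
  assumes "v \<in> carrier_vec (n1 + n2)"
  obtains v1 v2 where "v = v1 @\<^sub>v v2" "v1 \<in> carrier_vec n1" "v2 \<in> carrier_vec n2"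
  using vec_first_last_append[OF assms] vec_first_carrier vec_last_carrier by metis

lemma append_vec_inject:
  assumes "v1 \<in> carrier_vec n1" "w1 \<in> carrier_vec n1" "v2 \<in> carrier_vec n2" "w2 \<in> carrier_vec n2"
  shows "v1 @\<^sub>v v2 = w1 @\<^sub>v w2 \<longleftrightarrow> v1 = w1 \<and> v2 = w2"
  using assms append_vec_eq[of v1 n1 w1 v2 w2] by blast

lemma minus_plus_cancel_vec:
  "v \<in> carrier_vec n \<Longrightarrow> w \<in> carrier_vec n \<Longrightarrow> v - w + w = (v :: 'a::ring_1 vec)"
  by (intro eq_vecI) auto

lemma append_vec_scale: "c \<cdot>\<^sub>v (v1 @\<^sub>v v2) = (c \<cdot>\<^sub>v v1) @\<^sub>v (c \<cdot>\<^sub>v v2)"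
  by (intro eq_vecI) auto

lemma ex_mat_mult_vec:
  assumes w: "w \<in> carrier_vec n" "w \<noteq> 0\<^sub>v n" and u: "u \<in> carrier_vec n"
  shows "\<exists>A\<in>carrier_mat n n. A *\<^sub>v w = (u :: 'f::field vec)"
proof -
  obtain k where k: "k < n" "vec_index w k \<noteq> 0" using w by (metis carrier_vecD eq_vecI index_zero_vec)
  let ?A = "mat n n (\<lambda>(i, j). if j = k then vec_index u i / vec_index w k else 0)"
  have "vec_index (?A *\<^sub>v w) i = vec_index u i" if "i < n" for i
  proof -
    have "vec_index (?A *\<^sub>v w) i = (\<Sum>j<n. if j = k then vec_index u i else 0)"
      using that w k by (auto simp: scalar_prod_def atLeast0LessThan if_distrib if_distribR simp del: sum.delta intro!: sum.cong)
    then show ?thesis using k by simp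
  qed
  then have "?A *\<^sub>v w = u" using u by (intro eq_vecI) auto
  then show ?thesis by (intro bexI[of _ ?A]) auto
qed

locale block_extension =
  fixes smul :: "'a::comm_ring_1 \<Rightarrow> 'r::ring_1 \<Rightarrow> 'r" and \<pi> :: "'a \<Rightarrow> 'f::field"
    and n1 n2 :: nat and r \<tau>1 \<tau>2 b
  assumes surj: "surj \<pi>"
    and rep: "mat_rep smul \<pi> (n1 + n2) r"
    and rep1: "mat_rep smul \<pi> n1 \<tau>1" and rep2: "mat_rep smul \<pi> n2 \<tau>2"
    and b: "\<And>x. b x \<in> carrier_mat n1 n2"
    and r: "\<And>x. r x = four_block_mat (\<tau>1 x) (b x) (0\<^sub>m n2 n1) (\<tau>2 x)"
    and dense: "\<And>A1 A2. A1 \<in> carrier_mat n1 n1 \<Longrightarrow> A2 \<in> carrier_mat n2 n2 \<Longrightarrow> \<exists>x. \<tau>1 x = A1 \<and> \<tau>2 x = A2"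
begin

lemma c1: "\<tau>1 x \<in> carrier_mat n1 n1" and c2: "\<tau>2 x \<in> carrier_mat n2 n2"
  using rep_carrier[OF rep1] rep_carrier[OF rep2] .

lemma act:
  assumes "v1 \<in> carrier_vec n1" "v2 \<in> carrier_vec n2"
  shows "r x *\<^sub>v (v1 @\<^sub>v v2) = (\<tau>1 x *\<^sub>v v1 + b x *\<^sub>v v2) @\<^sub>v (\<tau>2 x *\<^sub>v v2)"
proof -
  have "0\<^sub>m n2 n1 *\<^sub>v v1 + \<tau>2 x *\<^sub>v v2 = \<tau>2 x *\<^sub>v v2"
    using assms c2[of x] by (intro eq_vecI) auto
  then show ?thesis unfolding r using four_block_mat_mult_vec[OF c1 b zero_carrier_mat c2 assms, of x x x] by simp
qed

lemma carrier_simps: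
  assumes "v1 \<in> carrier_vec n1" "v2 \<in> carrier_vec n2"
  shows "\<tau>1 x *\<^sub>v v1 \<in> carrier_vec n1" "b x *\<^sub>v v2 \<in> carrier_vec n1" "\<tau>2 x *\<^sub>v v2 \<in> carrier_vec n2"
  using mult_mat_vec_carrier[OF c1 assms(1)] mult_mat_vec_carrier[OF b assms(2)] mult_mat_vec_carrier[OF c2 assms(2)]
  by auto

text \<open>
  If the upper right block vanishes on the kernel of \<open>\<tau>1 \<times> \<tau>2\<close>, then an element \<open>e\<close> with \<open>\<tau>1 e = 0\<close> and
  \<open>\<tau>2 e = 1\<close> acts as a central idempotent. Its image, the graph of \<open>\<beta> = b e\<close>, is a stable complement of
  the subspace of \<open>\<tau>1\<close>, and every stable subspace is a sum of some of these two simple pieces.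
\<close>

lemma semisimple_of_trivial_radical:
  assumes split: "\<And>z. \<tau>1 z = 0\<^sub>m n1 n1 \<Longrightarrow> \<tau>2 z = 0\<^sub>m n2 n2 \<Longrightarrow> b z = 0\<^sub>m n1 n2"
  shows "semisimple_rep (n1 + n2) r"
proof -
  obtain e where e: "\<tau>1 e = 0\<^sub>m n1 n1" "\<tau>2 e = 1\<^sub>m n2" using dense[of "0\<^sub>m n1 n1" "1\<^sub>m n2"] by auto
  define \<beta> where "\<beta> = b e"
  have \<beta>: "\<beta> \<in> carrier_mat n1 n2" unfolding \<beta>_def by (rule b)
  have \<beta>v: "\<beta> *\<^sub>v v \<in> carrier_vec n1" if "v \<in> carrier_vec n2" for v
    using mult_mat_vec_carrier[OF \<beta> that] .
  have r0: "r z = 0\<^sub>m (n1 + n2) (n1 + n2)" if "\<tau>1 z = 0\<^sub>m n1 n1" "\<tau>2 z = 0\<^sub>m n2 n2" for z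
    unfolding r that split[OF that] by (intro eq_matI) auto
  have ev: "r e *\<^sub>v (v1 @\<^sub>v v2) = (\<beta> *\<^sub>v v2) @\<^sub>v v2" if "v1 \<in> carrier_vec n1" "v2 \<in> carrier_vec n2" for v1 v2
  proof -
    have "0\<^sub>m n1 n1 *\<^sub>v v1 = 0\<^sub>v n1" using that by (intro eq_vecI) (auto simp: scalar_prod_def)
    then have "0\<^sub>m n1 n1 *\<^sub>v v1 + \<beta> *\<^sub>v v2 = \<beta> *\<^sub>v v2" using \<beta>v[OF that(2)] by simp
    then show ?thesis unfolding act[OF that] e \<beta>_def[symmetric] using that by simp
  qed
  have comm: "r (x * e) = r (e * x)" for x
  proof -
    have "r (x * e - e * x) = 0\<^sub>m (n1 + n2) (n1 + n2)"
    proof (rule r0)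
      show "\<tau>1 (x * e - e * x) = 0\<^sub>m n1 n1"
        unfolding rep_diff[OF rep1] rep_mult[OF rep1] e using c1[of x] by simp
      show "\<tau>2 (x * e - e * x) = 0\<^sub>m n2 n2"
        unfolding rep_diff[OF rep2] rep_mult[OF rep2] e using c2[of x] by simp
    qed
    then have eq: "r (x * e) - r (e * x) = 0\<^sub>m (n1 + n2) (n1 + n2)" unfolding rep_diff[OF rep] .
    show ?thesis
    proof (rule eq_matI)
      fix p q assume "p < dim_row (r (e * x))" "q < dim_col (r (e * x))"
      then have pq: "p < n1 + n2" "q < n1 + n2" using rep_dims[OF rep] by auto
      then have "(r (x * e) - r (e * x)) $$ (p, q) = 0" unfolding eq by simp
      then show "r (x * e) $$ (p, q) = r (e * x) $$ (p, q)" using pq by (simp add: rep_dims[OF rep])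
    qed (simp_all add: rep_dims[OF rep])
  qed
  \<comment> \<open>The graph of \<open>\<beta>\<close> is stable because \<open>e\<close> acts as a central element.\<close>
  have sec: "\<tau>1 x *\<^sub>v (\<beta> *\<^sub>v v) + b x *\<^sub>v v = \<beta> *\<^sub>v (\<tau>2 x *\<^sub>v v)" if v: "v \<in> carrier_vec n2" for x v
  proof -
    let ?v = "0\<^sub>v n1 @\<^sub>v v"
    have z: "0\<^sub>v n1 \<in> carrier_vec n1" by simp
    have vc: "?v \<in> carrier_vec (n1 + n2)" using v by simp
    have "r x *\<^sub>v (r e *\<^sub>v ?v) = r e *\<^sub>v (r x *\<^sub>v ?v)"
      using comm[of x] assoc_mult_mat_vec[OF rep_carrier[OF rep] rep_carrier[OF rep] vc]
      unfolding rep_mult[OF rep] by metis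
    then have "(\<tau>1 x *\<^sub>v (\<beta> *\<^sub>v v) + b x *\<^sub>v v) @\<^sub>v (\<tau>2 x *\<^sub>v v) = (\<beta> *\<^sub>v (\<tau>2 x *\<^sub>v v)) @\<^sub>v (\<tau>2 x *\<^sub>v v)"
      using act[OF z v, of x] carrier_simps[OF z v, of x] by (simp add: ev[OF z v] act[OF \<beta>v[OF v] v] ev v)
    moreover have t: "\<tau>2 x *\<^sub>v v \<in> carrier_vec n2" by (rule carrier_simps(3)[OF z v])
    moreover have "\<tau>1 x *\<^sub>v (\<beta> *\<^sub>v v) + b x *\<^sub>v v \<in> carrier_vec n1"
      using carrier_simps[OF \<beta>v[OF v] v, of x] by simp
    ultimately show ?thesis using append_vec_inject[OF _ \<beta>v[OF t] t t] by blast
  qed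
  show ?thesis unfolding semisimple_rep_def
  proof (intro allI impI)
    fix W assume W: "stable_subspace (n1 + n2) r W"
    have sub: "W \<subseteq> carrier_vec (n1 + n2)" and z: "0\<^sub>v (n1 + n2) \<in> W"
      and add: "\<And>v w. v \<in> W \<Longrightarrow> w \<in> W \<Longrightarrow> v + w \<in> W"
      and sc: "\<And>c v. v \<in> W \<Longrightarrow> c \<cdot>\<^sub>v v \<in> W" and rW: "\<And>x w. w \<in> W \<Longrightarrow> r x *\<^sub>v w \<in> W"
      using W unfolding stable_subspace_iff by auto
    define P1 where "P1 \<longleftrightarrow> (\<exists>v\<in>carrier_vec n1. v \<noteq> 0\<^sub>v n1 \<and> v @\<^sub>v 0\<^sub>v n2 \<in> W)"
    define P2 where "P2 \<longleftrightarrow> (\<exists>v\<in>carrier_vec n1. \<exists>w\<in>carrier_vec n2. w \<noteq> 0\<^sub>v n2 \<and> v @\<^sub>v w \<in> W)"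
    have W1: "u @\<^sub>v 0\<^sub>v n2 \<in> W" if P: "P1" and u: "u \<in> carrier_vec n1" for u
    proof -
      obtain v where v: "v \<in> carrier_vec n1" "v \<noteq> 0\<^sub>v n1" "v @\<^sub>v 0\<^sub>v n2 \<in> W" using P unfolding P1_def by blast
      obtain A where A: "A \<in> carrier_mat n1 n1" "A *\<^sub>v v = u" using ex_mat_mult_vec[OF v(1,2) u] by blast
      obtain x where x: "\<tau>1 x = A" using dense[OF A(1), of "0\<^sub>m n2 n2"] by auto
      have "r x *\<^sub>v (v @\<^sub>v 0\<^sub>v n2) = u @\<^sub>v 0\<^sub>v n2"
      proof -
        have "b x *\<^sub>v 0\<^sub>v n2 = 0\<^sub>v n1" "\<tau>2 x *\<^sub>v 0\<^sub>v n2 = 0\<^sub>v n2"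
          using b[of x] c2[of x] by (auto simp: scalar_prod_def intro!: eq_vecI)
        then show ?thesis unfolding act[OF v(1) zero_carrier_vec] x A(2) using u by simp
      qed
      then show ?thesis using rW[OF v(3), of x] by simp
    qed
    have W2: "(\<beta> *\<^sub>v u) @\<^sub>v u \<in> W" if P: "P2" and u: "u \<in> carrier_vec n2" for u
    proof -
      obtain v w where vw: "v \<in> carrier_vec n1" "w \<in> carrier_vec n2" "w \<noteq> 0\<^sub>v n2" "v @\<^sub>v w \<in> W"
        using P unfolding P2_def by blast
      obtain A where A: "A \<in> carrier_mat n2 n2" "A *\<^sub>v w = u" using ex_mat_mult_vec[OF vw(2,3) u] by blast
      obtain x where x: "\<tau>2 x = A" using dense[OF _ A(1), of "0\<^sub>m n1 n1"] by auto
      have "r e *\<^sub>v (r x *\<^sub>v (v @\<^sub>v w)) = (\<beta> *\<^sub>v u) @\<^sub>v u"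
        unfolding act[OF vw(1,2)] x A(2) by (rule ev) (use carrier_simps[OF vw(1,2), of x] u in auto)
      then show ?thesis using rW[OF rW[OF vw(4), of x], of e] by simp
    qed
    \<comment> \<open>\<open>P1\<close> and \<open>P2\<close> say which simple pieces lie in \<open>W\<close>; \<open>W'\<close> is spanned by the other ones.\<close>
    define W' where "W' = {v1 @\<^sub>v v2 | v1 v2. v1 \<in> carrier_vec n1 \<and> v2 \<in> carrier_vec n2 \<and>
      (P1 \<longrightarrow> v1 = \<beta> *\<^sub>v v2) \<and> (P2 \<longrightarrow> v2 = 0\<^sub>v n2)}"
    have W'I: "v1 @\<^sub>v v2 \<in> W'" if "v1 \<in> carrier_vec n1" "v2 \<in> carrier_vec n2"
      "P1 \<Longrightarrow> v1 = \<beta> *\<^sub>v v2" "P2 \<Longrightarrow> v2 = 0\<^sub>v n2" for v1 v2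
      using that unfolding W'_def by blast
    have \<beta>0: "\<beta> *\<^sub>v 0\<^sub>v n2 = 0\<^sub>v n1" using \<beta> by (auto simp: scalar_prod_def intro!: eq_vecI)
    have zz: "0\<^sub>v (n1 + n2) = (0\<^sub>v n1 @\<^sub>v 0\<^sub>v n2 :: 'f vec)" by (intro eq_vecI) auto
    have "stable_subspace (n1 + n2) r W'"
      unfolding stable_subspace_iff
    proof (intro conjI ballI allI)
      show "W' \<subseteq> carrier_vec (n1 + n2)" unfolding W'_def by auto
      show "0\<^sub>v (n1 + n2) \<in> W'" unfolding zz by (rule W'I) (auto simp: \<beta>0)
    next
      fix v w assume "v \<in> W'" "w \<in> W'"
      then obtain v1 v2 w1 w2 where v: "v = v1 @\<^sub>v v2" "v1 \<in> carrier_vec n1" "v2 \<in> carrier_vec n2"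
          "P1 \<longrightarrow> v1 = \<beta> *\<^sub>v v2" "P2 \<longrightarrow> v2 = 0\<^sub>v n2"
        and w: "w = w1 @\<^sub>v w2" "w1 \<in> carrier_vec n1" "w2 \<in> carrier_vec n2"
          "P1 \<longrightarrow> w1 = \<beta> *\<^sub>v w2" "P2 \<longrightarrow> w2 = 0\<^sub>v n2"
        unfolding W'_def by blast
      have "v + w = (v1 + w1) @\<^sub>v (v2 + w2)"
        unfolding v(1) w(1) by (rule append_vec_add[OF v(2) w(2) v(3) w(3)])
      moreover have "(v1 + w1) @\<^sub>v (v2 + w2) \<in> W'"
        by (rule W'I) (use v w mult_add_distrib_mat_vec[OF \<beta> v(3) w(3)] in auto)
      ultimately show "v + w \<in> W'" by simp
    next
      fix c v assume "v \<in> W'"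
      then obtain v1 v2 where v: "v = v1 @\<^sub>v v2" "v1 \<in> carrier_vec n1" "v2 \<in> carrier_vec n2"
          "P1 \<longrightarrow> v1 = \<beta> *\<^sub>v v2" "P2 \<longrightarrow> v2 = 0\<^sub>v n2"
        unfolding W'_def by blast
      have "c \<cdot>\<^sub>v v = (c \<cdot>\<^sub>v v1) @\<^sub>v (c \<cdot>\<^sub>v v2)" unfolding v(1) by (rule append_vec_scale)
      moreover have "(c \<cdot>\<^sub>v v1) @\<^sub>v (c \<cdot>\<^sub>v v2) \<in> W'"
        by (rule W'I) (use v mult_mat_vec[OF \<beta> v(3), of c] in auto)
      ultimately show "c \<cdot>\<^sub>v v \<in> W'" by simp
    next
      fix x v assume "v \<in> W'"
      then obtain v1 v2 where v: "v = v1 @\<^sub>v v2" "v1 \<in> carrier_vec n1" "v2 \<in> carrier_vec n2"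
          "P1 \<longrightarrow> v1 = \<beta> *\<^sub>v v2" "P2 \<longrightarrow> v2 = 0\<^sub>v n2"
        unfolding W'_def by blast
      have t0: "\<tau>2 x *\<^sub>v 0\<^sub>v n2 = 0\<^sub>v n2" using c2[of x] by (auto simp: scalar_prod_def intro!: eq_vecI)
      show "r x *\<^sub>v v \<in> W'" unfolding v(1) act[OF v(2,3)]
        by (rule W'I) (use carrier_simps[OF v(2,3), of x] sec[OF v(3), of x] v(4,5) t0 in auto)
    qed
    moreover have "W \<inter> W' = {0\<^sub>v (n1 + n2)}"
    proof (intro equalityI subsetI)
      fix w assume w: "w \<in> W \<inter> W'"
      then obtain v1 v2 where v: "w = v1 @\<^sub>v v2" "v1 \<in> carrier_vec n1" "v2 \<in> carrier_vec n2"
          "P1 \<longrightarrow> v1 = \<beta> *\<^sub>v v2" "P2 \<longrightarrow> v2 = 0\<^sub>v n2"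
        unfolding W'_def by blast
      have v2: "v2 = 0\<^sub>v n2" using v w unfolding P2_def by blast
      have "v1 = 0\<^sub>v n1"
      proof (rule ccontr)
        assume "v1 \<noteq> 0\<^sub>v n1"
        then have P1 using v w v2 unfolding P1_def by blast
        then show False using v(4) v2 \<beta>0 \<open>v1 \<noteq> 0\<^sub>v n1\<close> by simp
      qed
      then show "w \<in> {0\<^sub>v (n1 + n2)}" using v v2 zz by simp
    next
      fix w :: "'f vec" assume "w \<in> {0\<^sub>v (n1 + n2)}"
      then show "w \<in> W \<inter> W'" using z W'I[of "0\<^sub>v n1" "0\<^sub>v n2"] \<beta>0 zz by simp
    qed
    moreover have "carrier_vec (n1 + n2) = {w + w' | w w'. w \<in> W \<and> w' \<in> W'}"
    proof (intro equalityI subsetI)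
      fix v :: "'f vec" assume "v \<in> carrier_vec (n1 + n2)"
      then obtain v1 v2 where v: "v = v1 @\<^sub>v v2" "v1 \<in> carrier_vec n1" "v2 \<in> carrier_vec n2"
        by (rule append_vec_cases)
      let ?f = "(v1 - \<beta> *\<^sub>v v2) @\<^sub>v 0\<^sub>v n2" and ?s = "(\<beta> *\<^sub>v v2) @\<^sub>v v2"
      let ?z = "0\<^sub>v (n1 + n2) :: 'f vec"
      have d: "v1 - \<beta> *\<^sub>v v2 \<in> carrier_vec n1" using v \<beta>v by simp
      have fc: "?f \<in> carrier_vec (n1 + n2)" "?s \<in> carrier_vec (n1 + n2)" using d v \<beta>v by auto
      have "v1 - \<beta> *\<^sub>v v2 + \<beta> *\<^sub>v v2 = v1" by (rule minus_plus_cancel_vec[OF v(2) \<beta>v[OF v(3)]])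
      then have sum: "v = ?f + ?s"
        unfolding v(1) append_vec_add[OF d \<beta>v[OF v(3)] zero_carrier_vec v(3)] using v(3) by simp
      have zW': "?z \<in> W'" unfolding zz by (rule W'I) (auto simp: \<beta>0)
      have f: "if P1 then ?f \<in> W else ?f \<in> W'" using W1[OF _ d] W'I[OF d zero_carrier_vec] by auto
      have s: "if P2 then ?s \<in> W else ?s \<in> W'" using W2[OF _ v(3)] W'I[OF \<beta>v[OF v(3)] v(3)] by auto
      have addW': "w + w' \<in> W'" if "w \<in> W'" "w' \<in> W'" for w w'
        using \<open>stable_subspace (n1 + n2) r W'\<close> that unfolding stable_subspace_iff by blast
      have "v = ((if P1 then ?f else ?z) + (if P2 then ?s else ?z)) + ((if P1 then ?z else ?f) + (if P2 then ?z else ?s))"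
        using sum fc by (auto simp: comm_add_vec[of ?f "n1 + n2"])
      moreover have "(if P1 then ?f else ?z) + (if P2 then ?s else ?z) \<in> W"
        by (rule add) (use f s z in \<open>auto split: if_splits\<close>)
      moreover have "(if P1 then ?z else ?f) + (if P2 then ?z else ?s) \<in> W'"
        by (rule addW') (use f s zW' in \<open>auto split: if_splits\<close>)
      ultimately show "v \<in> {w + w' | w w'. w \<in> W \<and> w' \<in> W'}" by blast
    next
      fix v assume "v \<in> {w + w' | w w'. w \<in> W \<and> w' \<in> W'}"
      then show "v \<in> carrier_vec (n1 + n2)"
        using sub \<open>stable_subspace (n1 + n2) r W'\<close> unfolding stable_subspace_iff
        by (auto simp: subset_iff)
    qed
    ultimately show "\<exists>W'. stable_subspace (n1 + n2) r W' \<and> W \<inter> W' = {0\<^sub>v (n1 + n2)} \<and>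
        carrier_vec (n1 + n2) = {w + w' | w w'. w \<in> W \<and> w' \<in> W'}" by blast
  qed
qed

lemma r_mult_blocks:
  "b (x * y) = \<tau>1 x * b y + b x * \<tau>2 y"
proof -
  have "four_block_mat (\<tau>1 (x * y)) (b (x * y)) (0\<^sub>m n2 n1) (\<tau>2 (x * y))
     = four_block_mat (\<tau>1 x * \<tau>1 y + b x * 0\<^sub>m n2 n1) (\<tau>1 x * b y + b x * \<tau>2 y)
        (0\<^sub>m n2 n1 * \<tau>1 y + \<tau>2 x * 0\<^sub>m n2 n1) (0\<^sub>m n2 n1 * b y + \<tau>2 x * \<tau>2 y)"
    using rep_mult[OF rep, of x y] unfolding r
    using mult_four_block_mat[OF c1 b zero_carrier_mat c2 c1 b zero_carrier_mat c2, of x x x y y y] by simp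
  then have eq: "four_block_mat (\<tau>1 (x * y)) (b (x * y)) (0\<^sub>m n2 n1) (\<tau>2 (x * y)) $$ (i, n1 + j)
     = four_block_mat (\<tau>1 x * \<tau>1 y + b x * 0\<^sub>m n2 n1) (\<tau>1 x * b y + b x * \<tau>2 y)
        (0\<^sub>m n2 n1 * \<tau>1 y + \<tau>2 x * 0\<^sub>m n2 n1) (0\<^sub>m n2 n1 * b y + \<tau>2 x * \<tau>2 y) $$ (i, n1 + j)" for i j
    by simp
  have dims: "dim_row (b z) = n1" "dim_col (b z) = n2" for z using b[of z] by auto
  show ?thesis
  proof (rule eq_matI)
    fix i j assume "i < dim_row (\<tau>1 x * b y + b x * \<tau>2 y)" "j < dim_col (\<tau>1 x * b y + b x * \<tau>2 y)"
    then have "i < n1" "j < n2" using dims rep_dims[OF rep2] by auto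
    then show "b (x * y) $$ (i, j) = (\<tau>1 x * b y + b x * \<tau>2 y) $$ (i, j)"
      using eq[of i j] by (simp add: rep_dims[OF rep1] rep_dims[OF rep2] dims del: index_mult_mat(1) index_add_mat(1))
  qed (simp_all add: dims rep_dims[OF rep2])
qed

text \<open>
  For a non-split extension the kernel of \<open>\<tau>1 \<times> \<tau>2\<close> contains some \<open>z\<close> with a nonzero upper right
  block. Multiplying \<open>z\<close> on both sides by lifts of matrix units gives every matrix unit in that
  block, and then density fills the diagonal blocks.
\<close>

proposition upper_triangular_image:
  assumes ns: "\<not> semisimple_rep (n1 + n2) r"
    and N: "N \<in> carrier_mat (n1 + n2) (n1 + n2)"
    and low: "\<And>i j. n1 \<le> i \<Longrightarrow> i < n1 + n2 \<Longrightarrow> j < n1 \<Longrightarrow> N $$ (i, j) = 0"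
  shows "\<exists>x. r x = N"
proof -
  obtain z where z: "\<tau>1 z = 0\<^sub>m n1 n1" "\<tau>2 z = 0\<^sub>m n2 n2" "b z \<noteq> 0\<^sub>m n1 n2"
    using ns semisimple_of_trivial_radical by blast
  have dims: "dim_row (b x) = n1" "dim_col (b x) = n2" for x using b[of x] by auto
  obtain k l where kl: "k < n1" "l < n2" "b z $$ (k, l) \<noteq> 0"
  proof -
    have "\<exists>k l. k < n1 \<and> l < n2 \<and> b z $$ (k, l) \<noteq> 0"
    proof (rule ccontr)
      assume "\<nexists>k l. k < n1 \<and> l < n2 \<and> b z $$ (k, l) \<noteq> 0"
      then have "b z = 0\<^sub>m n1 n2" by (intro eq_matI) (auto simp: dims)
      then show False using z by simp
    qed
    then show thesis using that by blast
  qed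
  have rI: "r x = M" if "M \<in> carrier_mat (n1 + n2) (n1 + n2)"
    "\<And>i j. i < n1 \<Longrightarrow> j < n1 \<Longrightarrow> \<tau>1 x $$ (i, j) = M $$ (i, j)"
    "\<And>i j. i < n1 \<Longrightarrow> j < n2 \<Longrightarrow> b x $$ (i, j) = M $$ (i, n1 + j)"
    "\<And>i j. i < n2 \<Longrightarrow> j < n2 \<Longrightarrow> \<tau>2 x $$ (i, j) = M $$ (n1 + i, n1 + j)"
    "\<And>i j. i < n2 \<Longrightarrow> j < n1 \<Longrightarrow> M $$ (n1 + i, j) = 0" for x M
  proof (rule eq_matI)
    fix i j assume "i < dim_row M" "j < dim_col M"
    then have ij: "i < n1 + n2" "j < n1 + n2" using that(1) by auto
    show "r x $$ (i, j) = M $$ (i, j)"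
      using ij that(2)[of i j] that(3)[of i "j - n1"] that(4)[of "i - n1" "j - n1"] that(5)[of "i - n1" j]
      unfolding r by (auto simp: rep_dims[OF rep1] rep_dims[OF rep2])
  qed (use that(1) rep_dims[OF rep] in auto)
  have unit: "\<exists>x. r x = elem_mat (n1 + n2) i (n1 + j)" if ij: "i < n1" "j < n2" for i j
  proof -
    let ?A = "elem_mat n1 i k :: 'f mat" and ?D = "inverse (b z $$ (k, l)) \<cdot>\<^sub>m (elem_mat n2 l j :: 'f mat)"
    obtain y where y: "\<tau>1 y = ?A" "\<tau>2 y = 0\<^sub>m n2 n2" using dense[of ?A "0\<^sub>m n2 n2"] by auto
    obtain y' where y': "\<tau>1 y' = 0\<^sub>m n1 n1" "\<tau>2 y' = ?D" using dense[of "0\<^sub>m n1 n1" ?D] by auto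
    have byz: "b (y * z) = ?A * b z"
      unfolding r_mult_blocks y z using b[of y] right_add_zero_mat[OF mult_carrier_mat[OF elem_mat_carrier b[of z]]] by simp
    have t1: "\<tau>1 (y * z * y') = 0\<^sub>m n1 n1" unfolding rep_mult[OF rep1] y' by (rule right_mult_zero_mat[OF mult_carrier_mat[OF c1 c1]])
    have t2: "\<tau>2 (y * z * y') = 0\<^sub>m n2 n2" unfolding rep_mult[OF rep2] y z using left_mult_zero_mat[OF c2] by simp
    have bb: "b (y * z * y') = (?A * b z) * ?D"
    proof -
      have "\<tau>1 (y * z) = 0\<^sub>m n1 n1" unfolding rep_mult[OF rep1] z y by simp
      moreover have "?A * b z * ?D \<in> carrier_mat n1 n2"
        by (intro mult_carrier_mat[OF mult_carrier_mat[OF _ b]]) auto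
      ultimately show ?thesis unfolding r_mult_blocks[of "y * z"] byz y' using b[of y'] by simp
    qed
    have entry: "b (y * z * y') $$ (p, q) = (if p = i \<and> q = j then 1 else 0)" if pq: "p < n1" "q < n2" for p q
    proof -
      have Ab: "?A * b z \<in> carrier_mat n1 n2" by (rule mult_carrier_mat[OF _ b]) simp
      have row: "(?A * b z) $$ (p, s) = (if p = i then b z $$ (k, s) else 0)" if "s < n2" for s
        unfolding index_mult_mat_sum[OF elem_mat_carrier b pq(1) that]
        using pq kl by (simp add: if_distrib if_distribR sum.delta cong: if_cong conj_cong)
      have "b (y * z * y') $$ (p, q) = (\<Sum>s<n2. (?A * b z) $$ (p, s) * ?D $$ (s, q))"
        unfolding bb by (rule index_mult_mat_sum[OF Ab _ pq]) simp
      also have "\<dots> = (\<Sum>s<n2. if s = l then (if p = i \<and> q = j then 1 else 0) else 0)"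
        by (intro sum.cong refl) (use pq kl in \<open>auto simp: row\<close>)
      also have "\<dots> = (if p = i \<and> q = j then 1 else 0)" using kl by simp
      finally show ?thesis .
    qed
    have "r (y * z * y') = elem_mat (n1 + n2) i (n1 + j)"
      by (rule rI) (use ij entry in \<open>auto simp: t1 t2\<close>)
    then show ?thesis by blast
  qed
  have corner: "\<exists>x. r x = M" if M: "M \<in> carrier_mat (n1 + n2) (n1 + n2)"
    and supp: "\<And>i j. i < n1 + n2 \<Longrightarrow> j < n1 + n2 \<Longrightarrow> \<not> (i < n1 \<and> n1 \<le> j) \<Longrightarrow> M $$ (i, j) = 0" for M
  proof -
    have "\<exists>x. \<forall>c\<in>{()}. (\<lambda>_. r) c x = (\<lambda>_. M) c"
    proof (rule image_spanned_by_matrix_units[where d = "\<lambda>_. n1 + n2" and I = "{()} \<times> ({..<n1} \<times> {n1..<n1 + n2})"])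
      show "mat_rep smul \<pi> (n1 + n2) r" by (rule rep)
      show "\<exists>x. \<forall>c\<in>{()}. r x = (if c = b' then elem_mat (n1 + n2) i j else 0\<^sub>m (n1 + n2) (n1 + n2))"
        if "(b', i, j) \<in> {()} \<times> ({..<n1} \<times> {n1..<n1 + n2})" for b' i j
        using unit[of i "j - n1"] that by auto
      show "M $$ (i, j) = 0" if "i < n1 + n2" "j < n1 + n2" "(b', i, j) \<notin> {()} \<times> ({..<n1} \<times> {n1..<n1 + n2})" for b' i j
        by (rule supp) (use that in auto)
    qed (use M surj in auto)
    then show ?thesis by simp
  qed
  obtain x where x: "\<tau>1 x = mat n1 n1 (\<lambda>(i, j). N $$ (i, j))" "\<tau>2 x = mat n2 n2 (\<lambda>(i, j). N $$ (n1 + i, n1 + j))"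
    using dense[of "mat n1 n1 (\<lambda>(i, j). N $$ (i, j))" "mat n2 n2 (\<lambda>(i, j). N $$ (n1 + i, n1 + j))"] by auto
  let ?M = "mat (n1 + n2) (n1 + n2) (\<lambda>(i, j). if i < n1 \<and> n1 \<le> j then N $$ (i, j) - b x $$ (i, j - n1) else 0)"
  have "\<exists>y. r y = ?M" by (rule corner) auto
  then obtain y where y: "r y = ?M" by blast
  have "r (x + y) = N"
  proof (rule eq_matI)
    fix i j assume "i < dim_row N" "j < dim_col N"
    then have ij: "i < n1 + n2" "j < n1 + n2" using N by auto
    show "r (x + y) $$ (i, j) = N $$ (i, j)"
      unfolding rep_add[OF rep] y r[of x] x using ij low[of i j] N by auto
  qed (use N rep_dims[OF rep] in auto)
  then show ?thesis by blast
qed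

end

section \<open>Local rings\<close>

text \<open>
  Zorn's lemma; chains have an upper bound because they are stationary in a noetherian ring.
\<close>

lemma ideal_subset_maximal:
  assumes noeth: "noetherian_ring (class_ring :: 'a::comm_ring_1 ring)"
    and J: "is_ideal (J :: 'a set)" "1 \<notin> J"
  shows "\<exists>M. maximalideal M (class_ring :: 'a ring) \<and> J \<subseteq> M"
proof -
  interpret N: noetherian_ring "class_ring :: 'a ring" by (rule noeth)
  let ?S = "{I. is_ideal I \<and> 1 \<notin> I \<and> J \<subseteq> I}"
  have "\<exists>M\<in>?S. \<forall>I\<in>?S. M \<subseteq> I \<longrightarrow> I = M"
  proof (rule subset_Zorn)
    fix \<C> assume chain: "subset.chain ?S \<C>"
    show "\<exists>U\<in>?S. \<forall>I\<in>\<C>. I \<subseteq> U"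
    proof (cases "\<C> = {}")
      case True
      then show ?thesis using J by blast
    next
      case False
      have "subset.chain {I. ideal I (class_ring :: 'a ring)} \<C>"
        using chain unfolding subset.chain_def by (auto simp: ideal_class_ring_iff)
      then have "\<Union>\<C> \<in> \<C>" by (rule N.ideal_chain_is_trivial[OF False])
      moreover have "\<C> \<subseteq> ?S" using chain unfolding subset.chain_def by simp
      ultimately have "\<Union>\<C> \<in> ?S" by (rule rev_subsetD)
      then show ?thesis by (rule bexI[rotated]) blast
    qed
  qed
  then obtain M where MS: "M \<in> ?S" and maxS: "\<forall>I\<in>?S. M \<subseteq> I \<longrightarrow> I = M" by (rule bexE)
  from MS have M: "is_ideal M" "1 \<notin> M" "J \<subseteq> M" by simp_all
  have max: "I = M" if "is_ideal I" "1 \<notin> I" "M \<subseteq> I" for I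
    using bspec[OF maxS, of I] that M(3) by simp
  have "maximalideal M (class_ring :: 'a ring)"
  proof (rule maximalidealI)
    show "ideal M (class_ring :: 'a ring)" using M by (simp add: ideal_class_ring_iff)
    show "carrier (class_ring :: 'a ring) \<noteq> M" using M(2) by auto
    fix I assume I: "ideal I (class_ring :: 'a ring)" "M \<subseteq> I"
    have iI: "is_ideal I" using I by (simp add: ideal_class_ring_iff)
    show "I = M \<or> I = carrier (class_ring :: 'a ring)"
    proof (cases "1 \<in> I")
      case True
      then have "x \<in> I" for x using ideal_mult[OF iI, of 1 x] by simp
      then show ?thesis by auto
    next
      case False
      then show ?thesis using max[OF iI False I(2)] by simp
    qed
  qed
  then show ?thesis using M(3) by blast
qed

lemma local_ring_unit:
  fixes \<pi> :: "'a::comm_ring_1 \<Rightarrow> 'f::field"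
  assumes noeth: "noetherian_ring (class_ring :: 'a ring)"
    and loc: "local_ring_with_maximal_ideal m" and res: "residue_map m \<pi>" and a: "\<pi> a \<noteq> 0"
  shows "a dvd 1"
proof (rule ccontr)
  assume n: "\<not> a dvd 1"
  have "is_ideal {r * a | r. True}"
    unfolding is_ideal_def by (auto simp: mult.assoc[symmetric] distrib_right[symmetric] intro: exI[of _ 0])
  moreover have "1 \<notin> {r * a | r. True}" using n by (auto simp: dvd_def mult.commute)
  ultimately obtain M where M: "maximalideal M (class_ring :: 'a ring)" "{r * a | r. True} \<subseteq> M"
    using ideal_subset_maximal[OF noeth] by blast
  have "M = m" using M(1) loc unfolding local_ring_with_maximal_ideal_def by blast
  moreover have "a \<in> {r * a | r. True}" by (auto intro: exI[of _ 1])
  ultimately show False using M(2) res a unfolding residue_map_def by blast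
qed

section \<open>Diagonalisation over a henselian local ring\<close>

text \<open>
  The characteristic polynomial of a matrix with pairwise distinct residual eigenvalues has simple
  roots modulo the maximal ideal, and these lift.
\<close>

lemma henselian_eigenvalues:
  fixes \<pi> :: "'a::comm_ring_1 \<Rightarrow> 'f::field"
  assumes hom: "comm_ring_hom \<pi>" and hens: "henselian \<pi>"
    and A: "A \<in> carrier_mat n n" and red: "map_mat \<pi> A = mat_diag n l"
    and inj: "inj_on l {..<n}" and i: "i < n"
  shows "\<exists>a. poly (char_poly A) a = 0 \<and> \<pi> a = l i"
proof -
  interpret comm_ring_hom \<pi> by fact
  have "upper_triangular (mat_diag n l)" unfolding upper_triangular_def mat_diag_def by auto
  then have "map_poly \<pi> (char_poly A) = (\<Prod>a\<leftarrow>diag_mat (mat_diag n l). [:- a, 1:])"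
    unfolding char_poly_hom[OF A, symmetric] red
    by (rule char_poly_upper_triangular[OF mat_diag_dim])
  also have "diag_mat (mat_diag n l) = map l [0..<n]"
    unfolding diag_mat_def mat_diag_def by (auto intro!: map_cong)
  also have "(\<Prod>a\<leftarrow>map l [0..<n]. [:- a, 1:]) = (\<Prod>j<n. [:- l j, 1:])"
    by (simp add: comp_def prod.list_conv_set_nth atLeast0LessThan)
  also have "\<dots> = [:- l i, 1:] * (\<Prod>j\<in>{..<n} - {i}. [:- l j, 1:])" (is "_ = _ * ?q")
    using i by (subst prod.remove[of _ i]) auto
  finally have p: "map_poly \<pi> (char_poly A) = [:- l i, 1:] * ?q" .
  have "poly ?q (l i) = (\<Prod>j\<in>{..<n} - {i}. l i - l j)" by (simp add: poly_prod)
  also have "\<dots> \<noteq> 0" using inj i by (auto simp: inj_on_def)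
  finally have q: "poly ?q (l i) \<noteq> 0" .
  have "poly (pderiv (map_poly \<pi> (char_poly A))) (l i) = poly ?q (l i)"
    unfolding p pderiv_mult by (simp add: pderiv_pCons)
  moreover have "poly (map_poly \<pi> (char_poly A)) (l i) = 0" unfolding p by simp
  moreover have "lead_coeff (char_poly A) = 1" using degree_monic_char_poly[OF A] by simp
  ultimately show ?thesis using hens q unfolding henselian_def by metis
qed

text \<open>
  If \<open>det (a - A) = 0\<close>, the columns of the adjugate of \<open>a - A\<close> are eigenvectors. The \<open>i\<close>-th column
  reduces to a multiple of the \<open>i\<close>-th basis vector, the factor being \<open>\<Prod>\<^bsub>j \<noteq> i\<^esub> (l i - l j) \<noteq> 0\<close>.
\<close>

lemma henselian_eigenvector:
  fixes \<pi> :: "'a::comm_ring_1 \<Rightarrow> 'f::field"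
  assumes hom: "comm_ring_hom \<pi>" and unit: "\<And>a. \<pi> a \<noteq> 0 \<Longrightarrow> a dvd 1"
    and A: "A \<in> carrier_mat n n" and red: "map_mat \<pi> A = mat_diag n l"
    and inj: "inj_on l {..<n}" and i: "i < n"
    and a: "poly (char_poly A) a = 0" "\<pi> a = l i"
  shows "\<exists>v. (\<forall>p<n. (\<Sum>k<n. A $$ (p, k) * v k) = a * v p) \<and>
    (\<forall>p<n. \<pi> (v p) = (if p = i then 1 else 0))"
proof -
  interpret comm_ring_hom \<pi> by fact
  have redA: "\<pi> (A $$ (p, q)) = (if p = q then l q else 0)" if "p < n" "q < n" for p q
  proof -
    have "\<pi> (A $$ (p, q)) = map_mat \<pi> A $$ (p, q)" using A that by simp
    then show ?thesis unfolding red mat_diag_def using that by simp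
  qed
  define M where "M = a \<cdot>\<^sub>m 1\<^sub>m n - A"
  have M: "M \<in> carrier_mat n n" unfolding M_def by (rule minus_carrier_mat[OF A])
  have det0: "det M = 0"
    using poly_det_cong[OF M char_poly_matrix_closed[OF A], of a] a(1) A
    unfolding char_poly_def by (auto simp: M_def char_poly_matrix_def)
  let ?B = "adj_mat M"
  have B: "?B \<in> carrier_mat n n" and MB: "M * ?B = 0\<^sub>m n n"
    using adj_mat[OF M] unfolding det0 by auto
  define v where "v p = ?B $$ (p, i)" for p
  have eig: "(\<Sum>k<n. A $$ (p, k) * v k) = a * v p" if p: "p < n" for p
  proof -
    have "0 = (M * ?B) $$ (p, i)" unfolding MB using p i by simp
    also have "\<dots> = (\<Sum>k<n. M $$ (p, k) * v k)" unfolding v_def by (rule index_mult_mat_sum[OF M B p i])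
    also have "\<dots> = (\<Sum>k<n. (if k = p then a * v k else 0) - A $$ (p, k) * v k)"
      unfolding M_def using A p by (intro sum.cong refl) (auto simp: algebra_simps)
    also have "\<dots> = a * v p - (\<Sum>k<n. A $$ (p, k) * v k)" using p by (simp add: sum_subtractf)
    finally show ?thesis by simp
  qed
  have vi: "\<pi> (v i) \<noteq> 0"
  proof -
    let ?D = "mat_delete M i i"
    have Dc: "map_mat \<pi> ?D \<in> carrier_mat (n - 1) (n - 1)" using mat_delete_carrier[OF M] by simp
    have Dentry: "map_mat \<pi> ?D $$ (p, q) = (if p = q then l i - l (insert_index i p) else 0)"
      if pq: "p < n - 1" "q < n - 1" for p q
    proof -
      obtain n' where n': "n = Suc n'" using i by (cases n) auto
      have lt: "insert_index i p < n" "insert_index i q < n" using pq by (auto simp: insert_index_def)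
      have "?D $$ (p, q) = M $$ (insert_index i p, insert_index i q)"
        using mat_delete_index[of M n' i i p q] M pq i unfolding n' by simp
      moreover have "map_mat \<pi> ?D $$ (p, q) = \<pi> (?D $$ (p, q))" using M pq by simp
      moreover have "insert_index i p = insert_index i q \<longleftrightarrow> p = q" by (auto simp: insert_index_def split: if_splits)
      ultimately show ?thesis using lt A a(2) redA[OF lt] by (auto simp: M_def hom_minus)
    qed
    have "upper_triangular (map_mat \<pi> ?D)"
      unfolding upper_triangular_def using Dentry Dc by auto
    then have "det (map_mat \<pi> ?D) = prod_list (diag_mat (map_mat \<pi> ?D))"
      by (rule det_upper_triangular[OF _ Dc])
    also have "\<dots> \<noteq> 0"
    proof -
      have "l i - l (insert_index i p) \<noteq> 0" if "p < n - 1" for p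
      proof -
        have "insert_index i p < n" "insert_index i p \<noteq> i"
          using that by (auto simp: insert_index_def split: if_splits)
        then have "l (insert_index i p) \<noteq> l i" using inj_on_eq_iff[OF inj] i by (metis lessThan_iff)
        then show ?thesis by simp
      qed
      then show ?thesis using Dentry Dc unfolding diag_mat_def prod_list_zero_iff by auto
    qed
    finally have "\<pi> (det ?D) \<noteq> 0" by simp
    moreover have "v i = det ?D"
      unfolding v_def adj_mat_def cofactor_def using M i by (auto simp flip: mult_2 simp: power_mult)
    ultimately show ?thesis by simp
  qed
  obtain c where c: "v i * c = 1" using unit[OF vi] by (metis dvdE)
  have "\<pi> (v p * c) = (if p = i then 1 else 0)" if p: "p < n" for p
  proof (cases "p = i")
    case True
    then show ?thesis using c by simp
  next
    case False
    have "\<pi> (\<Sum>k<n. A $$ (p, k) * v k) = (\<Sum>k<n. if k = p then l p * \<pi> (v p) else 0)"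
      unfolding hom_sum by (intro sum.cong refl) (use p redA in \<open>auto simp: hom_mult\<close>)
    then have "l p * \<pi> (v p) = l i * \<pi> (v p)" using eig[OF p] a(2) p by (auto simp add: hom_mult)
    moreover have "l p \<noteq> l i" using False inj p i unfolding inj_on_def by auto
    ultimately show ?thesis using False by (simp add: hom_mult)
  qed
  moreover have "(\<Sum>k<n. A $$ (p, k) * (v k * c)) = a * (v p * c)" if "p < n" for p
    using eig[OF that] by (metis (no_types, lifting) mult.assoc sum.cong sum_distrib_right)
  ultimately show ?thesis by (intro exI[of _ "\<lambda>p. v p * c"]) auto
qed

lemma inverse_of_unit_det:
  fixes Q :: "'a::comm_ring_1 mat"
  assumes Q: "Q \<in> carrier_mat n n" and "det Q dvd 1"
  obtains Q' where "Q' \<in> carrier_mat n n" "Q * Q' = 1\<^sub>m n" "Q' * Q = 1\<^sub>m n"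
proof -
  obtain c where c: "det Q * c = 1" using assms(2) by (metis dvdE)
  let ?Q' = "c \<cdot>\<^sub>m adj_mat Q"
  note adj = adj_mat[OF Q]
  have "Q * ?Q' = 1\<^sub>m n"
    unfolding mult_smult_distrib[OF Q adj(1)] adj(2) using c
    by (intro eq_matI) (auto simp: mult.commute)
  moreover have "?Q' * Q = 1\<^sub>m n"
    unfolding mult_smult_assoc_mat[OF adj(1) Q] adj(3) using c
    by (intro eq_matI) (auto simp: mult.commute)
  ultimately show thesis using that[of ?Q'] adj(1) by simp
qed

text \<open>
  The lifted eigenvectors form the columns of \<open>Q\<close>. That \<open>Q\<close> reduces to the identity makes it
  invertible, and conjugating with it does not change residual representations.
\<close>

proposition henselian_diagonalization:
  fixes \<pi> :: "'a::comm_ring_1 \<Rightarrow> 'f::field"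
  assumes hom: "comm_ring_hom \<pi>" and hens: "henselian \<pi>" and unit: "\<And>a. \<pi> a \<noteq> 0 \<Longrightarrow> a dvd 1"
    and A: "A \<in> carrier_mat n n" and red: "map_mat \<pi> A = mat_diag n l"
    and inj: "inj_on l {..<n}"
  shows "\<exists>a Q Q'. Q \<in> carrier_mat n n \<and> Q' \<in> carrier_mat n n \<and> Q * Q' = 1\<^sub>m n \<and> Q' * Q = 1\<^sub>m n \<and>
    map_mat \<pi> Q = 1\<^sub>m n \<and> Q' * A * Q = mat_diag n a \<and> (\<forall>i<n. \<pi> (a i) = l i)"
proof -
  interpret comm_ring_hom \<pi> by fact
  have "\<forall>i\<in>{..<n}. \<exists>a. poly (char_poly A) a = 0 \<and> \<pi> a = l i"
    using henselian_eigenvalues[OF hom hens A red inj] by simp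
  then obtain a where a: "\<And>i. i < n \<Longrightarrow> poly (char_poly A) (a i) = 0" "\<And>i. i < n \<Longrightarrow> \<pi> (a i) = l i"
    by (metis lessThan_iff)
  have "\<forall>i\<in>{..<n}. \<exists>v. (\<forall>p<n. (\<Sum>k<n. A $$ (p, k) * v k) = a i * v p) \<and>
      (\<forall>p<n. \<pi> (v p) = (if p = i then 1 else 0))"
    using henselian_eigenvector[OF hom unit A red inj] a by simp
  then obtain v where v: "\<And>i p. i < n \<Longrightarrow> p < n \<Longrightarrow> (\<Sum>k<n. A $$ (p, k) * v i k) = a i * v i p"
    "\<And>i p. i < n \<Longrightarrow> p < n \<Longrightarrow> \<pi> (v i p) = (if p = i then 1 else 0)"
    by (metis lessThan_iff)
  define Q where "Q = mat n n (\<lambda>(p, i). v i p)"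
  have Q: "Q \<in> carrier_mat n n" unfolding Q_def by simp
  have Qred: "map_mat \<pi> Q = 1\<^sub>m n" unfolding Q_def by (rule eq_matI) (auto simp: v)
  have "\<pi> (det Q) = 1" using hom_det[of Q] unfolding Qred by simp
  then have "det Q dvd 1" using unit by simp
  then obtain Q' where Q': "Q' \<in> carrier_mat n n" "Q * Q' = 1\<^sub>m n" "Q' * Q = 1\<^sub>m n"
    using inverse_of_unit_det[OF Q] by blast
  have AQ: "A * Q = Q * mat_diag n a"
  proof (rule eq_matI)
    fix p i assume "p < dim_row (Q * mat_diag n a)" "i < dim_col (Q * mat_diag n a)"
    then have pi: "p < n" "i < n" using Q by (auto simp: mat_diag_def)
    have "(A * Q) $$ (p, i) = a i * v i p"
      unfolding index_mult_mat_sum[OF A Q pi] using v(1)[OF pi(2,1)] pi by (simp add: Q_def)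
    also have "\<dots> = (Q * mat_diag n a) $$ (p, i)"
      unfolding index_mult_mat_sum[OF Q mat_diag_dim pi] using pi
      by (simp add: Q_def mat_diag_def if_distrib cong: if_cong)
    finally show "(A * Q) $$ (p, i) = (Q * mat_diag n a) $$ (p, i)" .
  qed (use A Q in \<open>auto simp: mat_diag_def\<close>)
  have "Q' * A * Q = Q' * Q * mat_diag n a"
    using AQ assoc_mult_mat[OF Q'(1) A Q] assoc_mult_mat[OF Q'(1) Q mat_diag_dim, of a] by simp
  also have "\<dots> = mat_diag n a" unfolding Q'(3) by (rule left_mult_one_mat[OF mat_diag_dim])
  finally show ?thesis using Q Q' Qred a(2) by (intro exI[of _ a] exI[of _ Q] exI[of _ Q'] conjI) simp_all
qed

section \<open>Representations with image a tiled order\<close>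

lemma elem_sandwich:
  fixes M :: "'a::comm_ring_1 mat"
  assumes M: "M \<in> carrier_mat n n" and "i < n" "j < n"
  shows "elem_mat n p i * M * elem_mat n j q = M $$ (i, j) \<cdot>\<^sub>m elem_mat n p q"
proof (rule eq_matI)
  have EM: "elem_mat n p i * M \<in> carrier_mat n n" by (rule mult_carrier_mat[OF _ M]) simp
  have row: "(elem_mat n p i * M) $$ (s, t) = (if s = p then M $$ (i, t) else 0)" if "s < n" "t < n" for s t
    unfolding index_mult_mat_sum[OF elem_mat_carrier M that]
    using that assms by (simp add: if_distrib if_distribR sum.delta cong: if_cong conj_cong)
  fix s t assume "s < dim_row (M $$ (i, j) \<cdot>\<^sub>m elem_mat n p q)" "t < dim_col (M $$ (i, j) \<cdot>\<^sub>m elem_mat n p q)"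
  then have st: "s < n" "t < n" by auto
  have "(elem_mat n p i * M * elem_mat n j q) $$ (s, t) = (\<Sum>k<n. if k = j then (if s = p \<and> t = q then M $$ (i, j) else 0) else 0)"
    unfolding index_mult_mat_sum[OF EM elem_mat_carrier st]
    by (intro sum.cong refl) (use st assms in \<open>auto simp: row simp del: index_mult_mat(1)\<close>)
  then show "(elem_mat n p i * M * elem_mat n j q) $$ (s, t) = (M $$ (i, j) \<cdot>\<^sub>m elem_mat n p q) $$ (s, t)"
    using st assms by simp
qed auto

text \<open>
  The image is the order of block matrices with entries in \<open>A\<close> except for a lower left block with entries in the
  ideal \<open>C\<close>. It is recorded through the matrix units that it contains.
\<close>

locale tiled_rep =
  fixes smul :: "'a::comm_ring_1 \<Rightarrow> 'r::ring_1 \<Rightarrow> 'r" and \<pi> :: "'a \<Rightarrow> 'f::field"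
    and n1 n2 :: nat and \<rho> :: "'r \<Rightarrow> 'a mat" and C :: "'a set"
  assumes algebra: "assoc_algebra smul"
    and hom: "comm_ring_hom \<pi>"
    and unit: "\<And>a. \<pi> a \<noteq> 0 \<Longrightarrow> a dvd 1"
    and pos: "0 < n1" "0 < n2"
    and rep: "mat_rep smul (\<lambda>a. a) (n1 + n2) \<rho>"
    and C: "is_ideal C" and C_kernel: "C \<subseteq> {a. \<pi> a = 0}"
    and lower_mem: "\<And>x i j. n1 \<le> i \<Longrightarrow> i < n1 + n2 \<Longrightarrow> j < n1 \<Longrightarrow> \<rho> x $$ (i, j) \<in> C"
    and upper_unit: "\<And>i j. i < n1 + n2 \<Longrightarrow> j < n1 + n2 \<Longrightarrow> \<not> (n1 \<le> i \<and> j < n1) \<Longrightarrow>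
        \<exists>x. \<rho> x = elem_mat (n1 + n2) i j"
    and lower_unit: "\<And>c i j. c \<in> C \<Longrightarrow> n1 \<le> i \<Longrightarrow> i < n1 + n2 \<Longrightarrow> j < n1 \<Longrightarrow>
        \<exists>x. \<rho> x = c \<cdot>\<^sub>m elem_mat (n1 + n2) i j"

text \<open>
  Lagrange interpolation in a diagonal element with distinct residual entries yields all diagonal matrix units,
  which cut the image into ideals of \<open>A\<close>, one for each entry. Outside the lower left block these ideals contain
  units; multiplying by the corresponding matrix units shows that all ideals in the lower left
  block agree with the one at \<open>(n1, 0)\<close>.
\<close>

proposition tiled_rep_of_diagonal:
  fixes smul :: "'a::comm_ring_1 \<Rightarrow> 'r::ring_1 \<Rightarrow> 'r" and \<pi> :: "'a \<Rightarrow> 'f::field"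
  assumes algebra: "assoc_algebra smul" and hom: "comm_ring_hom \<pi>"
    and unit: "\<And>a. \<pi> a \<noteq> 0 \<Longrightarrow> a dvd 1" and pos: "0 < n1" "0 < n2"
    and rep: "mat_rep smul (\<lambda>a. a) (n1 + n2) \<rho>"
    and upper: "\<And>x i j. n1 \<le> i \<Longrightarrow> i < n1 + n2 \<Longrightarrow> j < n1 \<Longrightarrow> \<pi> (\<rho> x $$ (i, j)) = 0"
    and surj: "\<And>i j. i < n1 + n2 \<Longrightarrow> j < n1 + n2 \<Longrightarrow> \<not> (n1 \<le> i \<and> j < n1) \<Longrightarrow>
        \<exists>x. map_mat \<pi> (\<rho> x) = elem_mat (n1 + n2) i j"
    and diag: "\<rho> x0 = mat_diag (n1 + n2) a"
    and distinct: "\<And>i j. i < n1 + n2 \<Longrightarrow> j < n1 + n2 \<Longrightarrow> i \<noteq> j \<Longrightarrow> \<pi> (a i) \<noteq> \<pi> (a j)"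
  shows "tiled_rep smul \<pi> n1 n2 \<rho> {\<rho> x $$ (n1, 0) | x. True}"
proof -
  interpret comm_ring_hom \<pi> by fact
  let ?n = "n1 + n2" and ?C = "{\<rho> x $$ (n1, 0) | x. True}"
  note car = rep_carrier[OF rep] and rmult = rep_mult[OF rep] and rsmul = rep_smul[OF rep]
  have idem: "\<exists>x. \<rho> x = elem_mat ?n i i" if i: "i < ?n" for i
  proof -
    \<comment> \<open>Lagrange interpolation, one factor \<open>(x0 - a j) / (a i - a j)\<close> at a time.\<close>
    have "\<exists>y g. \<rho> y = mat_diag ?n g \<and> g i = 1 \<and> (\<forall>j\<in>J. g j = 0)" if "finite J" "J \<subseteq> {..<?n} - {i}" for J
      using that
    proof (induction J rule: finite_induct)
      case empty
      have "\<rho> 1 = mat_diag ?n (\<lambda>_. 1)" unfolding rep_one[OF rep] by (auto simp: mat_diag_def)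
      then show ?case by (intro exI[of _ 1] exI[of _ "\<lambda>_. 1"]) simp
    next
      case (insert j J)
      then obtain y g where y: "\<rho> y = mat_diag ?n g" "g i = 1" "\<And>k. k \<in> J \<Longrightarrow> g k = 0" by auto
      have "\<pi> (a i - a j) \<noteq> 0" using distinct[OF i, of j] insert.prems by (auto simp: hom_minus)
      then obtain c where c: "(a i - a j) * c = 1" using unit by (metis dvdE)
      have z: "\<rho> (smul c (x0 - smul (a j) 1)) = mat_diag ?n (\<lambda>p. (a p - a j) * c)"
        unfolding rsmul rep_diff[OF rep] rep_one[OF rep] diag
        by (rule eq_matI) (auto simp: mat_diag_def mult.commute)
      have "\<rho> (y * smul c (x0 - smul (a j) 1)) = mat_diag ?n (\<lambda>p. g p * ((a p - a j) * c))"
        unfolding rmult y z by (rule mat_diag_diag)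
      then show ?case using y c
        by (intro exI[of _ "y * smul c (x0 - smul (a j) 1)"] exI[of _ "\<lambda>p. g p * ((a p - a j) * c)"]) auto
    qed
    from this[of "{..<?n} - {i}"] obtain y g
      where y: "\<rho> y = mat_diag ?n g" "g i = 1" "\<And>j. j < ?n \<Longrightarrow> j \<noteq> i \<Longrightarrow> g j = 0" by auto
    have "\<rho> y = elem_mat ?n i i"
      unfolding y(1) by (rule eq_matI) (use y i in \<open>auto simp: mat_diag_def\<close>)
    then show ?thesis by blast
  qed
  have sandwich: "\<exists>z. \<rho> z = \<rho> x $$ (i, j) \<cdot>\<^sub>m elem_mat ?n p q"
    if "\<rho> y = elem_mat ?n p i" "\<rho> y' = elem_mat ?n j q" "i < ?n" "j < ?n" for x y y' i j p q
  proof -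
    have "\<rho> (y * x * y') = \<rho> x $$ (i, j) \<cdot>\<^sub>m elem_mat ?n p q"
      unfolding rmult that(1,2) by (rule elem_sandwich[OF car that(3,4)])
    then show ?thesis by blast
  qed
  have up: "\<exists>x. \<rho> x = elem_mat ?n i j" if ij: "i < ?n" "j < ?n" "\<not> (n1 \<le> i \<and> j < n1)" for i j
  proof -
    obtain x where x: "map_mat \<pi> (\<rho> x) = elem_mat ?n i j" using surj[OF ij] by blast
    have "\<pi> (\<rho> x $$ (i, j)) = map_mat \<pi> (\<rho> x) $$ (i, j)" using ij car[of x] by simp
    also have "\<dots> = 1" unfolding x using ij by simp
    finally have "\<pi> (\<rho> x $$ (i, j)) \<noteq> 0" by simp
    then obtain c where c: "\<rho> x $$ (i, j) * c = 1" using unit by (metis dvdE)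
    obtain z where z: "\<rho> z = \<rho> x $$ (i, j) \<cdot>\<^sub>m elem_mat ?n i j"
      using sandwich[of _ i i _ j j x] idem[OF ij(1)] idem[OF ij(2)] ij by blast
    have "\<rho> (smul c z) = elem_mat ?n i j"
      unfolding rsmul z using c by (intro eq_matI) (auto simp: mult.commute)
    then show ?thesis by blast
  qed
  have n1: "n1 < ?n" and z0: "0 < ?n" using pos by auto
  have addC: "\<rho> (x + y) $$ (n1, 0) = \<rho> x $$ (n1, 0) + \<rho> y $$ (n1, 0)" for x y
    unfolding rep_add[OF rep] using rep_dims[OF rep, of y] n1 z0 by simp
  have smC: "\<rho> (smul c x) $$ (n1, 0) = c * \<rho> x $$ (n1, 0)" for c x
    unfolding rsmul using rep_dims[OF rep, of x] n1 z0 by simp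
  have zC: "\<rho> 0 $$ (n1, 0) = 0" unfolding rep_zero[OF rep] using n1 z0 by simp
  show ?thesis
  proof (rule tiled_rep.intro)
    show "is_ideal ?C" unfolding is_ideal_def
    proof (intro conjI ballI allI)
      show "0 \<in> ?C" using zC by force
      fix a assume "a \<in> ?C"
      then obtain x where x: "a = \<rho> x $$ (n1, 0)" by blast
      show "c * a \<in> ?C" for c unfolding x smC[symmetric] by blast
      fix b assume "b \<in> ?C"
      then obtain y where y: "b = \<rho> y $$ (n1, 0)" by blast
      show "a + b \<in> ?C" unfolding x y addC[symmetric] by blast
    qed
    show "?C \<subseteq> {a. \<pi> a = 0}" using upper[of n1 0] n1 pos by auto
    fix x i j assume ij: "n1 \<le> i" "i < ?n" "j < n1"
    have "\<exists>y. \<rho> y = elem_mat ?n n1 i" "\<exists>y. \<rho> y = elem_mat ?n j 0"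
      using up[of n1 i] up[of j 0] ij n1 z0 by auto
    then obtain z where "\<rho> z = \<rho> x $$ (i, j) \<cdot>\<^sub>m elem_mat ?n n1 0"
      using sandwich[of _ n1 i _ j 0 x] ij by fastforce
    then have "\<rho> z $$ (n1, 0) = \<rho> x $$ (i, j)" using n1 z0 by simp
    then show "\<rho> x $$ (i, j) \<in> ?C" by (intro CollectI exI[of _ z]) simp
  next
    fix c i j assume c: "c \<in> ?C" and ij: "n1 \<le> i" "i < ?n" "j < n1"
    obtain x where x: "c = \<rho> x $$ (n1, 0)" using c by blast
    have "\<exists>y. \<rho> y = elem_mat ?n i n1" "\<exists>y. \<rho> y = elem_mat ?n 0 j"
      using up[of i n1] up[of 0 j] ij n1 z0 pos by auto
    then show "\<exists>x. \<rho> x = c \<cdot>\<^sub>m elem_mat ?n i j"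
      unfolding x using sandwich[of _ i n1 _ 0 j x] n1 z0 by blast
  qed (use assms up in auto)
qed

lemma rep_map:
  assumes hom: "comm_ring_hom \<pi>" and rep: "mat_rep smul (\<lambda>a. a) n \<rho>"
  shows "mat_rep smul \<pi> n (\<lambda>x. map_mat \<pi> (\<rho> x))"
proof -
  interpret comm_ring_hom \<pi> by fact
  have "map_mat \<pi> (A + B) = map_mat \<pi> A + map_mat \<pi> B" if "A \<in> carrier_mat n n" "B \<in> carrier_mat n n" for A B
    using that by (intro eq_matI) (auto simp: hom_add)
  moreover have "map_mat \<pi> (c \<cdot>\<^sub>m A) = \<pi> c \<cdot>\<^sub>m map_mat \<pi> A" for A c
    by (intro eq_matI) (auto simp: hom_mult)
  moreover have "map_mat \<pi> (1\<^sub>m n) = 1\<^sub>m n" by (intro eq_matI) auto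
  ultimately show ?thesis using rep mat_hom_mult[of _ n n _ n] unfolding mat_rep_def by auto
qed

lemma rep_conjugate:
  fixes \<rho> :: "'r::ring_1 \<Rightarrow> 'a::comm_ring_1 mat"
  assumes rep: "mat_rep smul \<phi> n \<rho>" and Q: "Q \<in> carrier_mat n n" "Q' \<in> carrier_mat n n"
    and QQ: "Q * Q' = 1\<^sub>m n" "Q' * Q = 1\<^sub>m n"
  shows "mat_rep smul \<phi> n (\<lambda>x. Q' * \<rho> x * Q)"
proof -
  note car = rep_carrier[OF rep]
  have QA: "Q' * A \<in> carrier_mat n n" if "A \<in> carrier_mat n n" for A using Q that by simp
  have "Q' * (A * B) * Q = Q' * A * Q * (Q' * B * Q)" if AB: "A \<in> carrier_mat n n" "B \<in> carrier_mat n n" for A B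
  proof -
    have "Q' * A * Q * (Q' * B * Q) = Q' * A * (Q * (Q' * B * Q))"
      by (rule assoc_mult_mat[OF QA[OF AB(1)] Q(1) mult_carrier_mat[OF QA[OF AB(2)] Q(1)]])
    also have "Q * (Q' * B * Q) = Q * Q' * B * Q"
      using assoc_mult_mat[OF Q(1) QA[OF AB(2)] Q(1)] assoc_mult_mat[OF Q AB(2)] by simp
    also have "\<dots> = B * Q" unfolding QQ(1) using AB by simp
    also have "Q' * A * (B * Q) = Q' * (A * B) * Q"
      using assoc_mult_mat[OF QA[OF AB(1)] AB(2) Q(1)] assoc_mult_mat[OF Q(2) AB] by simp
    finally show ?thesis by simp
  qed
  moreover have "Q' * (A + B) * Q = Q' * A * Q + Q' * B * Q" if "A \<in> carrier_mat n n" "B \<in> carrier_mat n n" for A B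
    using mult_add_distrib_mat[OF Q(2) that] add_mult_distrib_mat[OF QA[OF that(1)] QA[OF that(2)] Q(1)] by simp
  moreover have "Q' * (c \<cdot>\<^sub>m A) * Q = c \<cdot>\<^sub>m (Q' * A * Q)" if "A \<in> carrier_mat n n" for A c
    using mult_smult_distrib[OF Q(2) that] mult_smult_assoc_mat[OF QA[OF that] Q(1)] by simp
  moreover have "Q' * 1\<^sub>m n * Q = 1\<^sub>m n" using Q QQ by simp
  ultimately show ?thesis using rep Q car unfolding mat_rep_def by (auto simp del: assoc_mult_mat)
qed

lemma trace_conjugate:
  fixes A :: "'a::comm_ring_1 mat"
  assumes A: "A \<in> carrier_mat n n" and Q: "Q \<in> carrier_mat n n" "Q' \<in> carrier_mat n n"
    and QQ: "Q * Q' = 1\<^sub>m n"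
  shows "mat_trace (Q' * A * Q) = mat_trace A"
proof -
  have "mat_trace (Q' * A * Q) = mat_trace (Q * (Q' * A))"
    by (rule mat_trace_mult_commute) (use A Q in auto)
  also have "Q * (Q' * A) = Q * Q' * A" using assoc_mult_mat[OF Q A] by simp
  finally show ?thesis using A by (simp add: QQ)
qed

section \<open>The reducibility ideal of a tiled representation\<close>

lemma sum_lessThan_add:
  fixes f :: "nat \<Rightarrow> 'a::comm_monoid_add"
  shows "(\<Sum>k<m + n. f k) = (\<Sum>k<m. f k) + (\<Sum>k<n. f (m + k))"
  by (induction n) (simp_all add: add.assoc)

lemma mat_trace_mult_elem:
  fixes M :: "'a::comm_ring_1 mat"
  assumes M: "M \<in> carrier_mat n n" and ij: "i < n" "j < n"
  shows "mat_trace (M * elem_mat n i j) = M $$ (j, i)"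
proof -
  have "mat_trace (M * elem_mat n i j) = (\<Sum>p<n. (M * elem_mat n i j) $$ (p, p))"
    unfolding mat_trace_def using M by simp
  also have "\<dots> = (\<Sum>p<n. if p = j then M $$ (j, i) else 0)"
  proof (intro sum.cong refl)
    fix p assume "p \<in> {..<n}"
    then have p: "p < n" by simp
    have "(M * elem_mat n i j) $$ (p, p) = (\<Sum>k<n. if k = i then (if p = j then M $$ (p, i) else 0) else 0)"
      unfolding index_mult_mat_sum[OF M elem_mat_carrier p p] using p by (intro sum.cong refl) auto
    then show "(M * elem_mat n i j) $$ (p, p) = (if p = j then M $$ (j, i) else 0)" using ij by auto
  qed
  finally show ?thesis using ij by simp
qed

lemma elem_middle:
  fixes A :: "'a::comm_ring_1 mat"
  assumes A: "A \<in> carrier_mat n n" and B: "B \<in> carrier_mat n n"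
    and "i < n" "j < n" "p < n" "q < n"
  shows "(A * elem_mat n p q * B) $$ (i, j) = A $$ (i, p) * B $$ (q, j)"
proof -
  have AE: "A * elem_mat n p q \<in> carrier_mat n n" by (rule mult_carrier_mat[OF A]) simp
  have row: "(A * elem_mat n p q) $$ (i, k) = (if k = q then A $$ (i, p) else 0)" if k: "k < n" for k
  proof -
    have "(A * elem_mat n p q) $$ (i, k) = (\<Sum>s<n. if s = p then (if k = q then A $$ (i, p) else 0) else 0)"
      unfolding index_mult_mat_sum[OF A elem_mat_carrier \<open>i < n\<close> k] using k by (intro sum.cong refl) auto
    then show ?thesis using assms by simp
  qed
  have "(A * elem_mat n p q * B) $$ (i, j) = (\<Sum>k<n. if k = q then A $$ (i, p) * B $$ (q, j) else 0)"
    unfolding index_mult_mat_sum[OF AE B \<open>i < n\<close> \<open>j < n\<close>]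
    by (intro sum.cong refl) (auto simp: row simp del: index_mult_mat(1))
  then show ?thesis using assms by simp
qed

locale residual_tiled_rep = tiled_rep smul \<pi> n1 n2 \<rho> C
  for smul :: "'a::comm_ring_1 \<Rightarrow> 'r::ring_1 \<Rightarrow> 'r" and \<pi> :: "'a \<Rightarrow> 'f::field"
    and n1 n2 :: nat and \<rho> :: "'r \<Rightarrow> 'a mat" and C :: "'a set" +
  fixes \<tau>1 \<tau>2 :: "'r \<Rightarrow> 'f mat"
  assumes rep1: "mat_rep smul \<pi> n1 \<tau>1" and rep2: "mat_rep smul \<pi> n2 \<tau>2"
    and red1: "\<And>x i j. i < n1 \<Longrightarrow> j < n1 \<Longrightarrow> \<pi> (\<rho> x $$ (i, j)) = \<tau>1 x $$ (i, j)"
    and red2: "\<And>x i j. i < n2 \<Longrightarrow> j < n2 \<Longrightarrow> \<pi> (\<rho> x $$ (n1 + i, n1 + j)) = \<tau>2 x $$ (i, j)"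
begin

sublocale \<pi>: comm_ring_hom \<pi> by (rule hom)

abbreviation "n \<equiv> n1 + n2"

lemmas car = rep_carrier[OF rep]

lemma dims [simp]: "dim_row (\<rho> x) = n" "dim_col (\<rho> x) = n"
  using rep_dims[OF rep] by auto

lemma trace_tau1: "mat_trace (\<tau>1 x) = (\<Sum>i<n1. \<pi> (\<rho> x $$ (i, i)))"
  unfolding mat_trace_def using rep_dims[OF rep1, of x] by (simp add: red1)

lemma trace_tau2: "mat_trace (\<tau>2 x) = (\<Sum>i<n2. \<pi> (\<rho> x $$ (n1 + i, n1 + i)))"
  unfolding mat_trace_def using rep_dims[OF rep2, of x] by (simp add: red2)

text \<open>
  Modulo \<open>C\<close> the representation is block upper triangular, so its diagonal blocks are multiplicative
  and the trace is the sum of their traces.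
\<close>

lemma reducible_mod_corner_ideal: "reducible_mod smul \<pi> (\<lambda>x. mat_trace (\<rho> x)) n1 \<tau>1 n2 \<tau>2 C"
proof -
  define B1 where "B1 x = mat n1 n1 (\<lambda>(p, q). \<rho> x $$ (p, q))" for x
  define B2 where "B2 x = mat n2 n2 (\<lambda>(p, q). \<rho> x $$ (n1 + p, n1 + q))" for x
  have B1c: "B1 x \<in> carrier_mat n1 n1" and B2c: "B2 x \<in> carrier_mat n2 n2" for x
    unfolding B1_def B2_def by auto
  have mult: "\<rho> (x * y) $$ (p, q) = (\<Sum>k<n1. \<rho> x $$ (p, k) * \<rho> y $$ (k, q)) + (\<Sum>k<n2. \<rho> x $$ (p, n1 + k) * \<rho> y $$ (n1 + k, q))"
    if "p < n" "q < n" for x y p q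
    unfolding rep_mult[OF rep] index_mult_mat_sum[OF car car that] by (rule sum_lessThan_add)
  have "pseudochar_mod smul C n1 (\<lambda>x. mat_trace (B1 x))"
  proof (rule pseudochar_mod_trace[OF C B1c])
    show "B1 1 = 1\<^sub>m n1" unfolding B1_def rep_one[OF rep] by (rule eq_matI) auto
    show "B1 (x + y) = B1 x + B1 y" for x y unfolding B1_def rep_add[OF rep] by (rule eq_matI) auto
    show "B1 (smul a x) = a \<cdot>\<^sub>m B1 x" for a x unfolding B1_def rep_smul[OF rep] by (rule eq_matI) auto
    fix x y p q assume pq: "p < n1" "q < n1"
    have "(B1 x * B1 y) $$ (p, q) = (\<Sum>k<n1. \<rho> x $$ (p, k) * \<rho> y $$ (k, q))"
      unfolding index_mult_mat_sum[OF B1c B1c pq] using pq by (simp add: B1_def)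
    then have "B1 (x * y) $$ (p, q) - (B1 x * B1 y) $$ (p, q) = (\<Sum>k<n2. \<rho> x $$ (p, n1 + k) * \<rho> y $$ (n1 + k, q))"
      using mult[of p q x y] pq by (simp add: B1_def)
    also have "\<dots> \<in> C" by (intro ideal_sum[OF C] ideal_mult[OF C] lower_mem) (use pq in auto)
    finally show "B1 (x * y) $$ (p, q) - (B1 x * B1 y) $$ (p, q) \<in> C" .
  qed
  moreover have "pseudochar_mod smul C n2 (\<lambda>x. mat_trace (B2 x))"
  proof (rule pseudochar_mod_trace[OF C B2c])
    show "B2 1 = 1\<^sub>m n2" unfolding B2_def rep_one[OF rep] by (rule eq_matI) auto
    show "B2 (x + y) = B2 x + B2 y" for x y unfolding B2_def rep_add[OF rep] by (rule eq_matI) auto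
    show "B2 (smul a x) = a \<cdot>\<^sub>m B2 x" for a x unfolding B2_def rep_smul[OF rep] by (rule eq_matI) auto
    fix x y p q assume pq: "p < n2" "q < n2"
    have "(B2 x * B2 y) $$ (p, q) = (\<Sum>k<n2. \<rho> x $$ (n1 + p, n1 + k) * \<rho> y $$ (n1 + k, n1 + q))"
      unfolding index_mult_mat_sum[OF B2c B2c pq] using pq by (simp add: B2_def)
    then have "B2 (x * y) $$ (p, q) - (B2 x * B2 y) $$ (p, q) = (\<Sum>k<n1. \<rho> x $$ (n1 + p, k) * \<rho> y $$ (k, n1 + q))"
      using mult[of "n1 + p" "n1 + q" x y] pq by (simp add: B2_def)
    also have "\<dots> \<in> C" by (intro ideal_sum[OF C] ideal_mult'[OF C] lower_mem) (use pq in auto)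
    finally show "B2 (x * y) $$ (p, q) - (B2 x * B2 y) $$ (p, q) \<in> C" .
  qed
  moreover have "mat_trace (\<rho> x) - (mat_trace (B1 x) + mat_trace (B2 x)) \<in> C" for x
  proof -
    have "mat_trace (\<rho> x) = mat_trace (B1 x) + mat_trace (B2 x)"
      unfolding mat_trace_def B1_def B2_def by (simp add: sum_lessThan_add)
    then show ?thesis using ideal_zero[OF C] by simp
  qed
  moreover have "\<pi> (mat_trace (B1 x)) = mat_trace (\<tau>1 x)" "\<pi> (mat_trace (B2 x)) = mat_trace (\<tau>2 x)" for x
    unfolding trace_tau1 trace_tau2 by (simp_all add: mat_trace_def B1_def B2_def \<pi>.hom_sum)
  ultimately show ?thesis unfolding reducible_mod_iff[OF hom] using C C_kernel by blast
qed

text \<open>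
  Distinct diagonal matrix units are orthogonal.
\<close>

lemma trace_diagonal_units_product:
  assumes rep': "mat_rep smul \<pi> d \<tau>'" and x: "\<And>i. i < d \<Longrightarrow> \<tau>' (x i) = elem_mat d i i"
    and l: "2 \<le> length l" "distinct l" "set l \<subseteq> {..<d}"
  shows "mat_trace (\<tau>' (prod_list (map x l))) = 0"
proof -
  obtain i j l' where l': "l = i # j # l'" using l(1) by (cases l; cases "tl l") auto
  then have ij: "i < d" "j < d" "i \<noteq> j" using l by auto
  have "\<tau>' (x i * x j) = 0\<^sub>m d d"
    unfolding rep_mult[OF rep'] x[OF ij(1)] x[OF ij(2)]
  proof (rule eq_matI)
    fix p q assume "p < dim_row (0\<^sub>m d d)" "q < dim_col (0\<^sub>m d d)"
    then have pq: "p < d" "q < d" by auto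
    show "(elem_mat d i i * elem_mat d j j) $$ (p, q) = 0\<^sub>m d d $$ (p, q)"
      unfolding index_mult_mat_sum[OF elem_mat_carrier elem_mat_carrier pq]
      using pq ij by (auto intro!: sum.neutral)
  qed auto
  then have "\<tau>' ((x i * x j) * prod_list (map x l')) = 0\<^sub>m d d"
    unfolding rep_mult[OF rep', of "x i * x j"] using left_mult_zero_mat[OF rep_carrier[OF rep']] by simp
  then show ?thesis unfolding l' by (simp add: mult.assoc mat_trace_def)
qed

text \<open>
  Let the trace be \<open>t1 + t2\<close> modulo \<open>I\<close>. The annihilator construction gives \<open>u\<close> killed by \<open>t1\<close> and acting
  with diagonal entries 1 in \<open>\<tau>2\<close>, and \<open>v\<close> with the roles exchanged. By centrality \<open>v x u y\<close> is killed
  by both, so its trace lies in \<open>I\<close>. For \<open>x\<close> and \<open>y\<close> with images the matrix unit at \<open>(0, n1)\<close> and \<open>c\<close> times the one at \<open>(n1, 0)\<close>, the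
  trace is \<open>c\<close> times the product of a diagonal entry of \<open>\<rho> u\<close> and one of \<open>\<rho> v\<close>, both of which are units.
\<close>

lemma corner_ideal_minimal:
  assumes "reducible_mod smul \<pi> (\<lambda>x. mat_trace (\<rho> x)) n1 \<tau>1 n2 \<tau>2 I"
  shows "C \<subseteq> I"
proof
  fix c assume c: "c \<in> C"
  obtain t1 t2 where I: "is_ideal I" and
    t1: "pseudochar_mod smul I n1 t1" and t2: "pseudochar_mod smul I n2 t2" and
    sum: "\<And>x. mat_trace (\<rho> x) - (t1 x + t2 x) \<in> I" and
    r1: "\<And>x. \<pi> (t1 x) = mat_trace (\<tau>1 x)" and r2: "\<And>x. \<pi> (t2 x) = mat_trace (\<tau>2 x)"
    using assms unfolding reducible_mod_iff[OF hom] by blast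
  have "\<forall>i\<in>{..<n}. \<exists>x. \<rho> x = elem_mat n i i" using upper_unit by auto
  then obtain e where e: "\<And>i. i < n \<Longrightarrow> \<rho> (e i) = elem_mat n i i" by (metis lessThan_iff)
  have e11: "\<tau>1 (e i) = elem_mat n1 i i" and e12: "\<tau>2 (e i) = 0\<^sub>m n2 n2" if "i < n1" for i
    by (rule eq_matI; use that rep_dims[OF rep1] rep_dims[OF rep2] e[of i] in
        \<open>auto simp flip: red1 red2\<close>)+
  have e22: "\<tau>2 (e (n1 + i)) = elem_mat n2 i i" and e21: "\<tau>1 (e (n1 + i)) = 0\<^sub>m n1 n1" if "i < n2" for i
    by (rule eq_matI; use that rep_dims[OF rep1] rep_dims[OF rep2] e[of "n1 + i"] in
        \<open>auto simp flip: red1 red2\<close>)+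
  have tr1: "mat_trace (elem_mat d i i :: 'f mat) = 1" if "i < d" for d i
    unfolding mat_trace_def using that by simp
  obtain u where u: "\<And>y. t1 (u * y) \<in> I" "\<And>p. p < n2 \<Longrightarrow> \<tau>2 u $$ (p, p) = 1"
  proof -
    have "\<exists>u. (\<forall>y. t1 (u * y) \<in> I) \<and> (\<forall>p<n2. \<tau>2 u $$ (p, p) = 1)"
    proof (rule pseudochar_annihilator[OF algebra I hom t1 rep2])
      show "\<pi> (t1 (e i)) = 1" if "i < n1" for i unfolding r1 e11[OF that] by (rule tr1[OF that])
      show "\<pi> (t1 (prod_list (map e l))) = 0" if "2 \<le> length l" "distinct l" "set l \<subseteq> {..<n1}" for l
        unfolding r1 by (rule trace_diagonal_units_product[OF rep1 e11 that])
      show "\<tau>2 (e i) = 0\<^sub>m n2 n2" if "i < n1" for i by (rule e12[OF that])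
    qed
    then show thesis using that by blast
  qed
  obtain v where v: "\<And>y. t2 (v * y) \<in> I" "\<And>p. p < n1 \<Longrightarrow> \<tau>1 v $$ (p, p) = 1"
  proof -
    have "\<exists>v. (\<forall>y. t2 (v * y) \<in> I) \<and> (\<forall>p<n1. \<tau>1 v $$ (p, p) = 1)"
    proof (rule pseudochar_annihilator[OF algebra I hom t2 rep1, of "\<lambda>i. e (n1 + i)"])
      show "\<pi> (t2 (e (n1 + i))) = 1" if "i < n2" for i unfolding r2 e22[OF that] by (rule tr1[OF that])
      show "\<pi> (t2 (prod_list (map (\<lambda>i. e (n1 + i)) l))) = 0"
        if "2 \<le> length l" "distinct l" "set l \<subseteq> {..<n2}" for l
        unfolding r2 by (rule trace_diagonal_units_product[OF rep2 _ that]) (rule e22)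
      show "\<tau>1 (e (n1 + i)) = 0\<^sub>m n1 n1" if "i < n2" for i by (rule e21[OF that])
    qed
    then show thesis using that by blast
  qed
  have n1n: "n1 < n" and zn: "0 < n" using pos by auto
  obtain x where x: "\<rho> x = elem_mat n 0 n1" using upper_unit[OF zn n1n] pos by auto
  obtain y where y: "\<rho> y = c \<cdot>\<^sub>m elem_mat n n1 0" using lower_unit[OF c, of n1 0] n1n pos by auto
  have central: "t1 (a * b) - t1 (b * a) \<in> I" for a b using t1 unfolding pseudochar_mod_def by blast
  have "t1 ((v * x) * (u * y)) \<in> I"
    using ideal_add[OF I central[of "v * x" "u * y"] u(1)[of "y * (v * x)"]] by (simp add: mult.assoc)
  moreover have "t2 (v * (x * (u * y))) \<in> I" by (rule v(1))
  ultimately have "t1 (v * x * (u * y)) + t2 (v * x * (u * y)) \<in> I"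
    using ideal_add[OF I] by (simp add: mult.assoc)
  then have "mat_trace (\<rho> (v * x * (u * y))) \<in> I"
    using ideal_add[OF I sum[of "v * x * (u * y)"]] by fastforce
  moreover have "mat_trace (\<rho> (v * x * (u * y))) = c * \<rho> u $$ (n1, n1) * \<rho> v $$ (0, 0)"
  proof -
    have E: "elem_mat n n1 0 \<in> carrier_mat n n" "elem_mat n 0 n1 \<in> carrier_mat n n" by auto
    have vE: "\<rho> v * elem_mat n 0 n1 \<in> carrier_mat n n" by (rule mult_carrier_mat[OF car E(2)])
    have uE: "\<rho> u * elem_mat n n1 0 \<in> carrier_mat n n" by (rule mult_carrier_mat[OF car E(1)])
    have "\<rho> (v * x * (u * y)) = \<rho> v * elem_mat n 0 n1 * (\<rho> u * (c \<cdot>\<^sub>m elem_mat n n1 0))"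
      unfolding rep_mult[OF rep] x y ..
    also have "\<dots> = c \<cdot>\<^sub>m (\<rho> v * elem_mat n 0 n1 * (\<rho> u * elem_mat n n1 0))"
      unfolding mult_smult_distrib[OF car E(1)] mult_smult_distrib[OF vE uE] ..
    also have "\<rho> v * elem_mat n 0 n1 * (\<rho> u * elem_mat n n1 0) = \<rho> v * (elem_mat n 0 n1 * \<rho> u * elem_mat n n1 0)"
      using assoc_mult_mat[OF car E(2) uE] assoc_mult_mat[OF E(2) car E(1)] by simp
    also have "\<dots> = \<rho> u $$ (n1, n1) \<cdot>\<^sub>m (\<rho> v * elem_mat n 0 0)"
      unfolding elem_sandwich[OF car n1n n1n] by (rule mult_smult_distrib[OF car elem_mat_carrier])
    finally have "\<rho> (v * x * (u * y)) = c \<cdot>\<^sub>m (\<rho> u $$ (n1, n1) \<cdot>\<^sub>m (\<rho> v * elem_mat n 0 0))" .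
    moreover have "mat_trace (a \<cdot>\<^sub>m M) = a * mat_trace M" if "M \<in> carrier_mat n n" for a and M :: "'a mat"
      using that unfolding mat_trace_def by (simp add: sum_distrib_left)
    moreover have "\<rho> v * elem_mat n 0 0 \<in> carrier_mat n n" by (rule mult_carrier_mat[OF car elem_mat_carrier])
    ultimately show ?thesis using mat_trace_mult_elem[OF car zn zn, of v] by (simp add: mult.assoc)
  qed
  ultimately have cI: "c * \<rho> u $$ (n1, n1) * \<rho> v $$ (0, 0) \<in> I" by simp
  have "\<pi> (\<rho> u $$ (n1, n1)) \<noteq> 0" using red2[of 0 0 u] u(2)[of 0] pos by simp
  moreover have "\<pi> (\<rho> v $$ (0, 0)) \<noteq> 0" using red1[of 0 0 v] v(2)[of 0] pos by simp
  ultimately obtain a b where ab: "\<rho> u $$ (n1, n1) * a = 1" "\<rho> v $$ (0, 0) * b = 1"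
    using unit by (metis dvdE)
  have "c = c * (\<rho> u $$ (n1, n1) * a) * (\<rho> v $$ (0, 0) * b)" unfolding ab by simp
  also have "\<dots> = c * \<rho> u $$ (n1, n1) * \<rho> v $$ (0, 0) * (a * b)" by (simp only: ac_simps)
  finally have "c = c * \<rho> u $$ (n1, n1) * \<rho> v $$ (0, 0) * (a * b)" .
  then show "c \<in> I" using ideal_mult'[OF I cI, of "a * b"] by simp
qed

proposition ideal_of_reducibility_eq_corner_ideal:
  "ideal_of_reducibility smul \<pi> (\<lambda>x. mat_trace (\<rho> x)) n1 \<tau>1 n2 \<tau>2 = C"
  unfolding ideal_of_reducibility_def
  by (rule Least_equality, rule reducible_mod_corner_ideal, rule corner_ideal_minimal)

text \<open>
  For \<open>i = 0\<close> and \<open>j = n1\<close>, the upper right corner of the image at \<open>(i, j)\<close> is generated by one matrix unit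
  \<open>E\<^sub>i\<^sub>j\<close>, and \<open>\<tau>\<close> exchanges it with the corner cut out by the images of \<open>E\<^sub>j\<^sub>j\<close> and \<open>E\<^sub>i\<^sub>i\<close> under \<open>\<tau>\<close>. The
  trace conditions on \<open>\<tau>1\<close> and \<open>\<tau>2\<close> give these images a unit on the diagonal in the expected
  blocks, at \<open>(l, l)\<close> and \<open>(K, K)\<close>, so every \<open>c\<close> in \<open>C\<close> shows up, up to a unit, as the \<open>(K, l)\<close> entry of
  an element of that corner, and is therefore a multiple of the \<open>(K, l)\<close> entry \<open>g\<close> of the image of \<open>E\<^sub>i\<^sub>j\<close>.
  Elements of \<open>R\<close> are compared through traces, which \<open>\<tau>\<close> preserves and which detect the entries in
  the lower left block because the image contains the opposite matrix units.
\<close>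

proposition corner_ideal_principal:
  assumes anti: "anti_automorphism smul \<tau>"
    and involution: "\<And>x. \<tau> (\<tau> x) = x"
    and T_tau: "\<And>x. mat_trace (\<rho> (\<tau> x)) = mat_trace (\<rho> x)"
    and tau1: "\<And>x. mat_trace (\<tau>1 (\<tau> x)) = mat_trace (\<tau>1 x)"
    and tau2: "\<And>x. mat_trace (\<tau>2 (\<tau> x)) = mat_trace (\<tau>2 x)"
  shows "\<exists>g. C = {r * g | r. True}"
proof -
  have \<tau>_mult: "\<tau> (x * y) = \<tau> y * \<tau> x" for x y using anti unfolding anti_automorphism_def by blast
  interpret \<tau>: Modules.module_hom smul smul \<tau> using anti unfolding anti_automorphism_def by blast
  have n1n: "n1 < n" and zn: "0 < n" using pos by auto
  obtain ri where ri: "\<rho> ri = elem_mat n 0 0" using upper_unit[OF zn zn] pos by auto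
  obtain rj where rj: "\<rho> rj = elem_mat n n1 n1" using upper_unit[OF n1n n1n] by auto
  obtain rij where rij: "\<rho> rij = elem_mat n 0 n1" using upper_unit[OF zn n1n] pos by auto
  have "mat_trace (\<tau>2 (\<tau> rj)) = 1"
    unfolding tau2 unfolding trace_tau2 rj using pos by (simp add: if_distrib cong: if_cong)
  then have "\<exists>k<n2. \<pi> (\<rho> (\<tau> rj) $$ (n1 + k, n1 + k)) \<noteq> 0"
    unfolding trace_tau2 by (metis (no_types, lifting) lessThan_iff sum.neutral zero_neq_one)
  then obtain k where k: "k < n2" "\<pi> (\<rho> (\<tau> rj) $$ (n1 + k, n1 + k)) \<noteq> 0" by blast
  have "mat_trace (\<tau>1 (\<tau> ri)) = 1"
    unfolding tau1 unfolding trace_tau1 ri using pos by (simp add: if_distrib cong: if_cong)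
  then have "\<exists>l<n1. \<pi> (\<rho> (\<tau> ri) $$ (l, l)) \<noteq> 0"
    unfolding trace_tau1 by (metis (no_types, lifting) lessThan_iff sum.neutral zero_neq_one)
  then obtain l where l: "l < n1" "\<pi> (\<rho> (\<tau> ri) $$ (l, l)) \<noteq> 0" by blast
  let ?K = "n1 + k"
  have Kn: "?K < n" and ln: "l < n" using k l by auto
  define g where "g = \<rho> (\<tau> rij) $$ (?K, l)"
  have gC: "g \<in> C" unfolding g_def by (rule lower_mem) (use k l in auto)
  have "\<exists>r. c = r * g" if c: "c \<in> C" for c
  proof -
    obtain s where s: "\<rho> s = c \<cdot>\<^sub>m elem_mat n ?K l" using lower_unit[OF c _ Kn l(1)] by auto
    define \<alpha> where "\<alpha> = \<rho> (\<tau> s) $$ (0, n1)"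
    \<comment> \<open>\<open>z\<close> lies in the kernel of \<open>\<rho>\<close>, so the trace pairs \<open>\<tau> z\<close> trivially with everything.\<close>
    define z where "z = ri * \<tau> s * rj - smul \<alpha> rij"
    have z0: "\<rho> z = 0\<^sub>m n n"
      unfolding z_def rep_diff[OF rep] rep_mult[OF rep] rep_smul[OF rep] ri rj rij
        elem_sandwich[OF car zn n1n] \<alpha>_def[symmetric] by (intro eq_matI) auto
    have \<tau>z: "\<tau> z = \<tau> rj * s * \<tau> ri - smul \<alpha> (\<tau> rij)"
      unfolding z_def \<tau>.diff \<tau>.scale \<tau>_mult involution by (simp add: mult.assoc)
    obtain w where w: "\<rho> w = elem_mat n l ?K" using upper_unit[OF ln Kn] l by auto
    have "\<rho> (\<tau> z) $$ (?K, l) = mat_trace (\<rho> (\<tau> z * w))"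
      unfolding rep_mult[OF rep] w by (rule mat_trace_mult_elem[OF car ln Kn, symmetric])
    also have "\<dots> = mat_trace (\<rho> (\<tau> w * z))"
      using T_tau[of "\<tau> z * w"] unfolding \<tau>_mult involution by simp
    also have "\<dots> = 0" unfolding rep_mult[OF rep] z0 right_mult_zero_mat[OF car]
      by (simp add: mat_trace_def)
    finally have "\<rho> (\<tau> rj * s * \<tau> ri) $$ (?K, l) = \<alpha> * g"
      unfolding \<tau>z rep_diff[OF rep] rep_smul[OF rep] g_def using Kn ln by simp
    moreover have "\<rho> (\<tau> rj * s * \<tau> ri) $$ (?K, l) = c * (\<rho> (\<tau> rj) $$ (?K, ?K) * \<rho> (\<tau> ri) $$ (l, l))"
    proof -
      have E: "\<rho> (\<tau> rj) * elem_mat n ?K l \<in> carrier_mat n n" by (rule mult_carrier_mat[OF car elem_mat_carrier])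
      have EE: "\<rho> (\<tau> rj) * elem_mat n ?K l * \<rho> (\<tau> ri) \<in> carrier_mat n n" by (rule mult_carrier_mat[OF E car])
      have "\<rho> (\<tau> rj * s * \<tau> ri) = c \<cdot>\<^sub>m (\<rho> (\<tau> rj) * elem_mat n ?K l * \<rho> (\<tau> ri))"
        unfolding rep_mult[OF rep] s mult_smult_distrib[OF car elem_mat_carrier]
        by (rule mult_smult_assoc_mat[OF E car])
      then show ?thesis using elem_middle[OF car car Kn ln Kn ln, of "\<tau> rj" "\<tau> ri"] EE Kn ln by auto
    qed
    ultimately have eq: "c * (\<rho> (\<tau> rj) $$ (?K, ?K) * \<rho> (\<tau> ri) $$ (l, l)) = \<alpha> * g" by simp
    obtain a b where ab: "\<rho> (\<tau> rj) $$ (?K, ?K) * a = 1" "\<rho> (\<tau> ri) $$ (l, l) * b = 1"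
      using unit[OF k(2)] unit[OF l(2)] by (metis dvdE)
    have "c = c * (\<rho> (\<tau> rj) $$ (?K, ?K) * a) * (\<rho> (\<tau> ri) $$ (l, l) * b)" unfolding ab by simp
    also have "\<dots> = c * (\<rho> (\<tau> rj) $$ (?K, ?K) * \<rho> (\<tau> ri) $$ (l, l)) * (a * b)"
      by (simp only: ac_simps)
    also have "\<dots> = (\<alpha> * (a * b)) * g" unfolding eq by (simp add: ac_simps)
    finally show ?thesis by blast
  qed
  then have "C = {r * g | r. True}" using ideal_mult[OF C gC] by auto
  then show ?thesis by blast
qed

end

section \<open>Finite quotients and zero divisors\<close>

text \<open>
  Let \<open>g y = 0\<close>. If \<open>y\<close> is a unit then \<open>C = 0\<close>, and the ring would be finite. Otherwise two powers of
  \<open>y\<close> agree in the finite quotient, say \<open>y\<^sup>i (1 - y\<^sup>j\<^sup>-\<^sup>i) \<in> C\<close>; the second factor is a unit, so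
  \<open>y\<^sup>i\<close> is a multiple of \<open>g\<close> and \<open>y\<close> is nilpotent, hence zero.
\<close>

lemma non_zero_divisor_of_finite_quotient:
  fixes C :: "'a::comm_ring_1 set" and \<pi> :: "'a \<Rightarrow> 'f::field"
  assumes hom: "comm_ring_hom \<pi>" and unit: "\<And>a. \<pi> a \<noteq> 0 \<Longrightarrow> a dvd 1"
    and C: "is_ideal C" "C = {r * g | r. True}"
    and fin: "finite (carrier (class_ring Quot C))" and inf: "infinite (UNIV :: 'a set)"
    and reduced: "\<And>(a::'a) k::nat. a ^ k = 0 \<Longrightarrow> a = 0"
    and gy: "g * y = 0"
  shows "y = 0"
proof -
  interpret comm_ring_hom \<pi> by fact
  have fin': "finite (range (coset C))" using fin unfolding carrier_quot .
  have "g \<noteq> 0"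
  proof
    assume "g = 0"
    then have "C = {0}" using C(2) by auto
    then have "inj (coset C)" using coset_eq_iff[OF C(1)] by (auto intro!: injI)
    then show False using fin' inf finite_imageD by blast
  qed
  have y: "\<pi> y = 0"
  proof (rule ccontr)
    assume "\<pi> y \<noteq> 0"
    then obtain b where "y * b = 1" using unit by (metis dvdE)
    then have "g = g * y * b" by (simp add: mult.assoc)
    then show False using gy \<open>g \<noteq> 0\<close> by simp
  qed
  have "finite (range (\<lambda>k. coset C (y ^ k)))" by (rule finite_subset[OF _ fin']) auto
  then have "\<not> inj (\<lambda>k::nat. coset C (y ^ k))" using finite_imageD infinite_UNIV_nat by blast
  then obtain i j :: nat where ij: "i < j" "coset C (y ^ i) = coset C (y ^ j)"
    unfolding inj_def by (metis nat_neq_iff)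
  then have "y ^ i - y ^ j \<in> C" using coset_eq_iff[OF C(1)] by blast
  moreover have "y ^ j = y ^ i * y ^ (j - i)" using ij(1) by (metis le_add_diff_inverse less_imp_le power_add)
  ultimately have mem: "y ^ i * (1 - y ^ (j - i)) \<in> C" by (simp add: right_diff_distrib)
  have "\<pi> (1 - y ^ (j - i)) \<noteq> 0" using y ij(1) by (simp add: hom_minus hom_power power_0_left)
  then obtain b where b: "(1 - y ^ (j - i)) * b = 1" using unit by (metis dvdE)
  have "y ^ i * (1 - y ^ (j - i)) * b \<in> C" by (rule ideal_mult'[OF C(1) mem])
  then have "y ^ i \<in> C" using b by (simp add: mult.assoc)
  then obtain r where "y ^ i = r * g" using C(2) by blast
  then have "y ^ Suc i = r * (g * y)" by (simp add: ac_simps)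
  then show ?thesis using gy reduced[of y "Suc i"] by simp
qed

text \<open>
  This provides pairwise distinct residual eigenvalues for the diagonalisation.
\<close>

lemma inj_on_of_nat_below_unit_factorial:
  fixes \<pi> :: "'a::comm_ring_1 \<Rightarrow> 'f::field"
  assumes hom: "comm_ring_hom \<pi>" and fact_unit: "(of_nat (fact n) :: 'a) dvd 1"
  shows "inj_on (of_nat :: nat \<Rightarrow> 'f) {..<n}"
proof -
  interpret comm_ring_hom \<pi> by fact
  obtain c where "of_nat (fact n) * c = (1::'a)" using fact_unit by (metis dvdE)
  then have "\<pi> (of_nat (fact n)) * \<pi> c = 1" by (metis hom_mult hom_one)
  moreover have "\<pi> (of_nat k) = of_nat k" for k by (induction k) (simp_all add: hom_add)
  ultimately have nz: "(of_nat (fact n) :: 'f) \<noteq> 0" by (metis mult_zero_left zero_neq_one)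
  have nzk: "(of_nat k :: 'f) \<noteq> 0" if "0 < k" "k \<le> n" for k
  proof -
    have "k dvd fact n" using that by (intro dvd_fact) auto
    then show ?thesis using nz by (metis dvdE mult_zero_left of_nat_mult)
  qed
  have "(of_nat i :: 'f) \<noteq> of_nat j" if ij: "i < j" "j < n" for i j
  proof
    assume eq: "(of_nat i :: 'f) = of_nat j"
    have "(of_nat j :: 'f) = of_nat i + of_nat (j - i)" using ij by (simp flip: of_nat_add)
    then have "(of_nat (j - i) :: 'f) = 0" using eq by simp
    moreover have "0 < j - i" "j - i \<le> n" using ij by auto
    ultimately show False using nzk by blast
  qed
  then show ?thesis unfolding inj_on_def by (metis lessThan_iff nat_neq_iff)
qed

section \<open>Principality of the reducibility ideal\<close>

theorem corollary3p5:
  fixes m :: "'a::comm_ring_1 set"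
    and \<pi> :: "'a \<Rightarrow> 'f::field"
    and smul :: "'a \<Rightarrow> 'r::ring_1 \<Rightarrow> 'r"
    and n n1 n2 :: nat
    and \<rho> :: "'r \<Rightarrow> 'a mat"
    and T :: "'r \<Rightarrow> 'a"
    and \<tau>1 \<tau>2 :: "'r \<Rightarrow> 'f mat"
    and I\<^sub>T :: "'a set"
    and \<tau> :: "'r \<Rightarrow> 'r"
  assumes noetherian: "noetherian_ring (class_ring :: 'a ring)"
    and local_A: "local_ring_with_maximal_ideal m"
    and residue: "residue_map m \<pi>"
    and henselian: "henselian \<pi>"
    and algebra_R: "assoc_algebra smul"
    and rho: "mat_rep smul (\<lambda>a. a) n \<rho>"
    and T_def: "T = (\<lambda>x. mat_trace (\<rho> x))"
    and fact_unit: "(of_nat (fact n) :: 'a) dvd 1"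
    and dims: "n1 + n2 = n"
    and tau1: "mat_rep smul \<pi> n1 \<tau>1" "absolutely_irreducible_rep n1 \<tau>1"
    and tau2: "mat_rep smul \<pi> n2 \<tau>2" "absolutely_irreducible_rep n2 \<tau>2"
    and non_isomorphic: "\<not> isomorphic_reps n1 \<tau>1 n2 \<tau>2"
    and extension: "\<And>x. \<exists>b\<in>carrier_mat n1 n2.
          map_mat \<pi> (\<rho> x) = four_block_mat (\<tau>1 x) b (0\<^sub>m n2 n1) (\<tau>2 x)"
    and non_semisimple: "\<not> semisimple_rep n (\<lambda>x. map_mat \<pi> (\<rho> x))"
    and reduced: "\<And>(a::'a) k::nat. a ^ k = 0 \<Longrightarrow> a = 0"
    and infinite_A: "infinite (UNIV :: 'a set)"
    and I\<^sub>T_def: "I\<^sub>T = ideal_of_reducibility smul \<pi> T n1 \<tau>1 n2 \<tau>2"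
    and finite_quotient: "finite (carrier (class_ring Quot I\<^sub>T))"
    and anti: "anti_automorphism smul \<tau>"
    and involution: "\<And>x. \<tau> (\<tau> x) = x"
    and T_tau: "\<And>x. T (\<tau> x) = T x"
    and tau1_tau: "\<And>x. mat_trace (\<tau>1 (\<tau> x)) = mat_trace (\<tau>1 x)"
    and tau2_tau: "\<And>x. mat_trace (\<tau>2 (\<tau> x)) = mat_trace (\<tau>2 x)"
  shows "\<exists>f. I\<^sub>T = PIdl\<^bsub>class_ring\<^esub> f \<and> (\<forall>y. f * y = 0 \<longrightarrow> y = 0)"
proof -
  have \<pi>: "comm_ring_hom \<pi>" and surj: "surj \<pi>" using residue unfolding residue_map_def by auto
  interpret comm_ring_hom \<pi> by (rule \<pi>)
  have unit: "a dvd 1" if "\<pi> a \<noteq> 0" for a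
    by (rule local_ring_unit[OF noetherian local_A residue that])
  have pos: "0 < n1" "0 < n2"
    using tau1(2) tau2(2) unfolding absolutely_irreducible_rep_def irreducible_rep_def by auto
  have rho': "mat_rep smul (\<lambda>a. a) (n1 + n2) \<rho>" using rho dims by simp
  define r where "r x = map_mat \<pi> (\<rho> x)" for x
  have r: "mat_rep smul \<pi> (n1 + n2) r" unfolding r_def by (rule rep_map[OF \<pi> rho'])
  have "\<forall>x. \<exists>b. b \<in> carrier_mat n1 n2 \<and> r x = four_block_mat (\<tau>1 x) b (0\<^sub>m n2 n1) (\<tau>2 x)"
    unfolding r_def using extension by blast
  then obtain b where b: "\<And>x. b x \<in> carrier_mat n1 n2"
      "\<And>x. r x = four_block_mat (\<tau>1 x) (b x) (0\<^sub>m n2 n1) (\<tau>2 x)" by metis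
  interpret E: block_extension smul \<pi> n1 n2 r \<tau>1 \<tau>2 b
    by (rule block_extension.intro[OF surj r tau1(1) tau2(1) b])
      (rule density_two_reps[OF surj tau1 tau2 non_isomorphic])
  have ns: "\<not> semisimple_rep (n1 + n2) r" using non_semisimple dims unfolding r_def by simp
  note image = E.upper_triangular_image[OF ns]
  have inj: "inj_on (of_nat :: nat \<Rightarrow> 'f) {..<n1 + n2}"
    using inj_on_of_nat_below_unit_factorial[OF \<pi> fact_unit] dims by simp
  have "\<exists>x. r x = mat_diag (n1 + n2) of_nat" by (rule image) (auto simp: mat_diag_def)
  then obtain x0 where x0: "map_mat \<pi> (\<rho> x0) = mat_diag (n1 + n2) of_nat" unfolding r_def by blast
  have "\<exists>a Q Q'. Q \<in> carrier_mat (n1 + n2) (n1 + n2) \<and> Q' \<in> carrier_mat (n1 + n2) (n1 + n2) \<and>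
      Q * Q' = 1\<^sub>m (n1 + n2) \<and> Q' * Q = 1\<^sub>m (n1 + n2) \<and> map_mat \<pi> Q = 1\<^sub>m (n1 + n2) \<and>
      Q' * \<rho> x0 * Q = mat_diag (n1 + n2) a \<and> (\<forall>i<n1 + n2. \<pi> (a i) = of_nat i)"
    by (rule henselian_diagonalization[OF \<pi> henselian _ rep_carrier[OF rho'] x0 inj]) (rule unit)
  then obtain a Q Q' where Q: "Q \<in> carrier_mat (n1 + n2) (n1 + n2)" "Q' \<in> carrier_mat (n1 + n2) (n1 + n2)"
      "Q * Q' = 1\<^sub>m (n1 + n2)" "Q' * Q = 1\<^sub>m (n1 + n2)" "map_mat \<pi> Q = 1\<^sub>m (n1 + n2)"
    and diag: "Q' * \<rho> x0 * Q = mat_diag (n1 + n2) a"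
    and a: "\<And>i. i < n1 + n2 \<Longrightarrow> \<pi> (a i) = of_nat i"
    by (elim exE conjE) simp
  define \<rho>' where "\<rho>' x = Q' * \<rho> x * Q" for x
  have rep': "mat_rep smul (\<lambda>a. a) (n1 + n2) \<rho>'"
    unfolding \<rho>'_def by (rule rep_conjugate[OF rho' Q(1-4)])
  have trace': "mat_trace (\<rho>' x) = T x" for x
    unfolding \<rho>'_def T_def by (rule trace_conjugate[OF rep_carrier[OF rho'] Q(1-3)])
  have Q'1: "map_mat \<pi> Q' = 1\<^sub>m (n1 + n2)"
  proof -
    have "map_mat \<pi> Q' = map_mat \<pi> Q' * map_mat \<pi> Q" unfolding Q(5) using Q(2) by simp
    also have "\<dots> = map_mat \<pi> (Q' * Q)" using mat_hom_mult[OF Q(2,1)] by simp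
    also have "\<dots> = 1\<^sub>m (n1 + n2)" unfolding Q(4) by (intro eq_matI) auto
    finally show ?thesis .
  qed
  have red: "map_mat \<pi> (\<rho>' x) = r x" for x
  proof -
    have "map_mat \<pi> (\<rho>' x) = map_mat \<pi> Q' * r x * map_mat \<pi> Q"
      unfolding \<rho>'_def r_def using mat_hom_mult[OF mult_carrier_mat[OF Q(2) rep_carrier[OF rho']] Q(1)]
        mat_hom_mult[OF Q(2) rep_carrier[OF rho']] by simp
    then show ?thesis unfolding Q'1 Q(5) using rep_carrier[OF r, of x] by simp
  qed
  have red_entry: "\<pi> (\<rho>' x $$ (i, j)) = r x $$ (i, j)" if "i < n1 + n2" "j < n1 + n2" for x i j
    using that rep_dims[OF rep', of x] unfolding red[symmetric] by simp
  note tdims = rep_dims[OF tau1(1)] rep_dims[OF tau2(1)]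
  let ?C = "{\<rho>' x $$ (n1, 0) | x. True}"
  interpret residual_tiled_rep smul \<pi> n1 n2 \<rho>' ?C \<tau>1 \<tau>2
  proof (rule residual_tiled_rep.intro)
    show "tiled_rep smul \<pi> n1 n2 \<rho>' ?C"
    proof (rule tiled_rep_of_diagonal[OF algebra_R \<pi> _ pos rep'])
      show "c dvd 1" if "\<pi> c \<noteq> 0" for c by (rule unit[OF that])
      show "\<pi> (\<rho>' x $$ (i, j)) = 0" if "n1 \<le> i" "i < n1 + n2" "j < n1" for x i j
        using red_entry[of i j x] that unfolding b(2) by (simp add: tdims)
      show "\<exists>x. map_mat \<pi> (\<rho>' x) = elem_mat (n1 + n2) i j"
        if "i < n1 + n2" "j < n1 + n2" "\<not> (n1 \<le> i \<and> j < n1)" for i j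
        unfolding red by (rule image) (use that in auto)
      show "\<rho>' x0 = mat_diag (n1 + n2) a" unfolding \<rho>'_def by (rule diag)
      show "\<pi> (a i) \<noteq> \<pi> (a j)" if "i < n1 + n2" "j < n1 + n2" "i \<noteq> j" for i j
        using inj that unfolding a[OF that(1)] a[OF that(2)] inj_on_def by auto
    qed
    show "residual_tiled_rep_axioms smul \<pi> n1 n2 \<rho>' \<tau>1 \<tau>2"
    proof (rule residual_tiled_rep_axioms.intro[OF tau1(1) tau2(1)])
      show "\<pi> (\<rho>' x $$ (i, j)) = \<tau>1 x $$ (i, j)" if "i < n1" "j < n1" for x i j
        using red_entry[of i j x] that unfolding b(2) by (simp add: tdims)
      show "\<pi> (\<rho>' x $$ (n1 + i, n1 + j)) = \<tau>2 x $$ (i, j)" if "i < n2" "j < n2" for x i j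
        using red_entry[of "n1 + i" "n1 + j" x] that unfolding b(2) by (simp add: tdims)
    qed
  qed
  have IC: "I\<^sub>T = ?C"
    using ideal_of_reducibility_eq_corner_ideal unfolding I\<^sub>T_def trace' by simp
  obtain g where g: "?C = {r * g | r. True}"
    using corner_ideal_principal[OF anti involution _ tau1_tau tau2_tau] T_tau unfolding trace' by blast
  have "y = 0" if "g * y = 0" for y
    by (rule non_zero_divisor_of_finite_quotient[OF \<pi> _ C g _ infinite_A _ that])
      (use finite_quotient IC unit reduced in simp_all)
  moreover have "I\<^sub>T = PIdl\<^bsub>class_ring\<^esub> g"
    unfolding IC g cgenideal_def by auto
  ultimately show ?thesis by blast
qed

end
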